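(* Let $d$ be a positive integer and let $\Lambda=(\lambda_n)_n$ be a random sequence in the unit ball $\mathbb{B}_d$ with prescribed radii $(r_n)_n$ and counting function $(N_m)_{m\in\mathbb{N}}$. If there exist $\varepsilon>0$ and $C>0$ such that $N_m\le C\,2^{d(1-\varepsilon)m}$ for all $m\in\mathbb{N}$, then $$\mathbb{P}\left(\Lambda\text{ is a Carleson sequence for } B^0_d\right)=1.$$ Otherwise (that is, if no such $\varepsilon, C>0$ exist), $$\mathbb{P}\left(\Lambda\text{ is a Carleson sequence for } B^0_d\right)=0.$$
   Context: Conventions: $\mathbb{N}=\{0,1,2,\dots\}$. $\mathbb{B}_d=\{z=(z^1,\dots,z^d)\in\mathbb{C}^d : |z|^2=\sum_{i=1}^d|z^i|^2<1\}$ and $\langle z,w\rangle_{\mathbb{C}^d}=\sum_{i=1}^d z^i\overline{w^i}$. Hardy space on the ball: $B^0_d$ is the reproducing kernel Hilbert space of analytic functions on $\mathbb{B}_d$ with kernel $k_w(z)=\frac{1}{(1-\langle z,w\rangle_{\mathbb{C}^d})^{d}}$. Carleson sequence: a sequence $Z=(z_n)_n$ in $\mathbb{B}_d$ is a Carleson sequence for $B^0_d$ if the measure $\mu_Z=\sum_n\|k_{z_n}\|^{-2}\delta_{z_n}$ is a Carleson measure for $B^0_d$, i.e. there is a constant $C_Z$ with $\|f\|_{L^2(\mathbb{B}_d,\mu_Z)}\le C_Z\|f\|_{B^0_d}$ for all $f\in B^0_d$; here $\|k_z\|^{-2}=(1-|z|^2)^d$. Random sequence: let $(r_n)_{n\in\mathbb{N}}$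 be a deterministic sequence in $(0,1)$ and $(\xi_n)_{n\in\mathbb{N}}$ i.i.d. random variables on a probability space $(\Omega,\mathcal{A},\mathbb{P})$, uniformly distributed on the unit sphere $\partial\mathbb{B}_d$. The random sequence is $\Lambda=(\lambda_n)_{n\in\mathbb{N}}$ with $\lambda_n=r_n\xi_n$. Counting function: for $m\in\mathbb{N}$, $N_m\in\mathbb{N}\cup\{\infty\}$ is the (deterministic) number of indices $n$ with $2^{-(m+1)}\le 1-|\lambda_n|<2^{-m}$. *)

theory Defs
  imports "HOL-Probability.Probability"
begin

section \<open>Reproducing kernel Hilbert spaces\<close>

definition ip_norm :: "(('a \<Rightarrow> complex) \<Rightarrow> ('a \<Rightarrow> complex) \<Rightarrow> complex) \<Rightarrow> ('a \<Rightarrow> complex) \<Rightarrow> real" where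
  "ip_norm ip f = sqrt (Re (ip f f))"

text \<open>The kernel function at \<open>w\<close> is \<open>k w = (\<lambda>z. K z w)\<close>.
  A function on \<open>X\<close> is represented by the total function that vanishes outside \<open>X\<close>.\<close>

definition kernel_fun :: "'a set \<Rightarrow> ('a \<Rightarrow> 'a \<Rightarrow> complex) \<Rightarrow> 'a \<Rightarrow> 'a \<Rightarrow> complex" where
  "kernel_fun X K w = (\<lambda>z. if z \<in> X then K z w else 0)"

text \<open>\<open>H\<close> with the inner product \<open>ip\<close> (linear in the first argument) is a Hilbert space of
  functions on \<open>X\<close> with reproducing kernel \<open>K\<close>; these conditions determine \<open>H\<close>, and \<open>ip\<close>
  on \<open>H\<close>, from \<open>X\<close> and \<open>K\<close>. Values of \<open>ip\<close> outside \<open>H\<close> are irrelevant.\<close>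

locale rkhs =
  fixes X :: "'a set" and K :: "'a \<Rightarrow> 'a \<Rightarrow> complex"
    and H :: "('a \<Rightarrow> complex) set" and ip :: "('a \<Rightarrow> complex) \<Rightarrow> ('a \<Rightarrow> complex) \<Rightarrow> complex"
  assumes supported: "f \<in> H \<Longrightarrow> x \<notin> X \<Longrightarrow> f x = 0"
    and zero_mem: "(\<lambda>x. 0) \<in> H"
    and add_mem: "f \<in> H \<Longrightarrow> g \<in> H \<Longrightarrow> (\<lambda>x. f x + g x) \<in> H"
    and scale_mem: "f \<in> H \<Longrightarrow> (\<lambda>x. c * f x) \<in> H"
    and ip_add: "f \<in> H \<Longrightarrow> g \<in> H \<Longrightarrow> h \<in> H \<Longrightarrow> ip (\<lambda>x. f x + g x) h = ip f h + ip g h"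
    and ip_scale: "f \<in> H \<Longrightarrow> g \<in> H \<Longrightarrow> ip (\<lambda>x. c * f x) g = c * ip f g"
    and ip_cnj: "f \<in> H \<Longrightarrow> g \<in> H \<Longrightarrow> ip g f = cnj (ip f g)"
    and ip_nonneg: "f \<in> H \<Longrightarrow> 0 \<le> Re (ip f f)"
    and ip_definite: "f \<in> H \<Longrightarrow> ip f f = 0 \<Longrightarrow> f = (\<lambda>x. 0)"
    and complete:
      "(\<And>n. F n \<in> H) \<Longrightarrow>
       (\<And>e. 0 < e \<Longrightarrow> \<exists>N. \<forall>m\<ge>N. \<forall>n\<ge>N. ip_norm ip (\<lambda>x. F m x - F n x) < e) \<Longrightarrow>
       \<exists>f\<in>H. (\<lambda>n. ip_norm ip (\<lambda>x. F n x - f x)) \<longlonglongrightarrow> 0"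
    and kernel_mem: "w \<in> X \<Longrightarrow> kernel_fun X K w \<in> H"
    and reproducing: "f \<in> H \<Longrightarrow> w \<in> X \<Longrightarrow> f w = ip f (kernel_fun X K w)"

section \<open>Carleson measures and Carleson sequences\<close>

text \<open>The embedding inequality between the \<open>L\<^sup>2(X, \<mu>)\<close> norm and the norm of \<open>H\<close>, squared.\<close>

definition carleson_measure ::
  "'a set \<Rightarrow> ('a \<Rightarrow> complex) set \<Rightarrow> (('a \<Rightarrow> complex) \<Rightarrow> ('a \<Rightarrow> complex) \<Rightarrow> complex) \<Rightarrow> 'a measure \<Rightarrow> bool"
where
  "carleson_measure X H ip \<mu> \<longleftrightarrow>
     (\<exists>C\<ge>0. \<forall>f\<in>H. (\<integral>\<^sup>+z\<in>X. ennreal ((cmod (f z))\<^sup>2) \<partial>\<mu>) \<le> ennreal ((C * ip_norm ip f)\<^sup>2))"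

text \<open>The measure \<open>\<Sum>n. \<parallel>k (z n)\<parallel>\<^sup>-\<^sup>2 \<delta> (z n)\<close>, as the image under \<open>z\<close> of a weighted counting
  measure on the indices; repeated points are counted with multiplicity.\<close>

definition sequence_measure ::
  "'a::topological_space set \<Rightarrow> ('a \<Rightarrow> 'a \<Rightarrow> complex) \<Rightarrow>
   (('a \<Rightarrow> complex) \<Rightarrow> ('a \<Rightarrow> complex) \<Rightarrow> complex) \<Rightarrow> (nat \<Rightarrow> 'a) \<Rightarrow> 'a measure"
where
  "sequence_measure X K ip z =
     distr (density (count_space UNIV) (\<lambda>n. ennreal (1 / (ip_norm ip (kernel_fun X K (z n)))\<^sup>2))) borel z"

definition carleson_sequence ::
  "'a::topological_space set \<Rightarrow> ('a \<Rightarrow> 'a \<Rightarrow> complex) \<Rightarrow> ('a \<Rightarrow> complex) set \<Rightarrow>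
   (('a \<Rightarrow> complex) \<Rightarrow> ('a \<Rightarrow> complex) \<Rightarrow> complex) \<Rightarrow> (nat \<Rightarrow> 'a) \<Rightarrow> bool"
where
  "carleson_sequence X K H ip z \<longleftrightarrow>
     (\<forall>n. z n \<in> X) \<and> carleson_measure X H ip (sequence_measure X K ip z)"

section \<open>The Hardy space on the unit ball of \<open>\<complex>\<^sup>d\<close>\<close>

definition cinner_vec :: "complex^'d \<Rightarrow> complex^'d \<Rightarrow> complex" where
  "cinner_vec z w = (\<Sum>i\<in>UNIV. z $ i * cnj (w $ i))"

definition szego_kernel :: "complex^'d \<Rightarrow> complex^'d \<Rightarrow> complex" where
  "szego_kernel z w = 1 / (1 - cinner_vec z w) ^ CARD('d)"

text \<open>Analyticity in several variables: the real derivative exists and is complex linear.\<close>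

definition analytic_several :: "(complex^'d \<Rightarrow> complex) \<Rightarrow> (complex^'d) set \<Rightarrow> bool" where
  "analytic_several f S \<longleftrightarrow>
     (\<forall>z\<in>S. \<exists>D. (f has_derivative D) (at z) \<and> (\<forall>c v. D (c *s v) = c * D v))"

locale hardy_space = rkhs "ball (0 :: complex^'d) 1" szego_kernel H ip
  for H :: "(complex^'d \<Rightarrow> complex) set" and ip +
  assumes analytic: "f \<in> H \<Longrightarrow> analytic_several f (ball 0 1)"
begin

lemma ip_norm_kernel:
  assumes "w \<in> ball 0 1"
  shows "1 / (ip_norm ip (kernel_fun (ball 0 1) szego_kernel w))\<^sup>2 = (1 - (norm w)\<^sup>2) ^ CARD('d)"
proof -
  let ?k = "kernel_fun (ball 0 1) szego_kernel w"
  have c: "cinner_vec w w = of_real ((norm w)\<^sup>2)"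
    by (simp add: cinner_vec_def norm_vec_def L2_set_def sum_nonneg complex_norm_square
        del: of_real_power)
  have "ip ?k ?k = ?k w"
    using reproducing[OF kernel_mem[OF assms] assms] by simp
  also have "\<dots> = of_real (1 / (1 - (norm w)\<^sup>2) ^ CARD('d))"
    using assms by (simp add: kernel_fun_def szego_kernel_def c)
  finally have "Re (ip ?k ?k) = 1 / (1 - (norm w)\<^sup>2) ^ CARD('d)"
    by simp
  moreover have "(norm w)\<^sup>2 \<le> 1"
    using assms by (simp add: abs_square_le_1)
  ultimately show ?thesis
    by (simp add: ip_norm_def)
qed

end

section \<open>Random sequences\<close>

text \<open>Normalised surface measure on the unit sphere, in polar coordinates: the image of the
  normalised Lebesgue measure on the unit ball under \<open>x \<mapsto> x / \<parallel>x\<parallel>\<close>.\<close>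

definition sphere_uniform :: "'a::euclidean_space measure" where
  "sphere_uniform = distr (uniform_measure lborel (ball 0 1)) borel (\<lambda>x. x /\<^sub>R norm x)"

lemma sets_sphere_uniform [simp]: "sets sphere_uniform = sets borel"
  by (simp add: sphere_uniform_def)

lemma emeasure_unit_ball:
  "emeasure lborel (ball (0::'a::euclidean_space) 1) \<noteq> 0"
  "emeasure lborel (ball (0::'a::euclidean_space) 1) \<noteq> \<infinity>"
proof -
  show "emeasure lborel (ball (0::'a) 1) \<noteq> 0"
    using open_not_negligible[of "ball (0::'a) 1"]
    by (auto simp: negligible_iff_emeasure0)
  show "emeasure lborel (ball (0::'a) 1) \<noteq> \<infinity>"
    using emeasure_lborel_ball_finite[of "0::'a" 1] by simp
qed

lemma prob_space_sphere_uniform: "prob_space (sphere_uniform :: 'a::euclidean_space measure)"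
  unfolding sphere_uniform_def
  by (intro prob_space.prob_space_distr prob_space_uniform_measure emeasure_unit_ball)
     simp_all

lemma AE_sphere_uniform: "AE x in sphere_uniform. x \<in> sphere (0::'a::euclidean_space) 1"
proof -
  have "AE x in lborel. x \<noteq> (0::'a)"
    by (rule AE_lborel_singleton)
  then have "AE x in uniform_measure lborel (ball (0::'a) 1). x /\<^sub>R norm x \<in> sphere 0 1"
    by (intro AE_uniform_measureI) auto
  then show ?thesis
    unfolding sphere_uniform_def by (subst AE_distr_iff) auto
qed

text \<open>\<open>N\<^sub>m\<close>: the number of indices in the dyadic shell of level \<open>m\<close>, where \<open>r n\<close> is the modulus
  of the \<open>n\<close>-th point.\<close>

definition dyadic_indices :: "(nat \<Rightarrow> real) \<Rightarrow> nat \<Rightarrow> nat set" where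
  "dyadic_indices r m = {n. (1/2) ^ (m + 1) \<le> 1 - r n \<and> 1 - r n < (1/2) ^ m}"

definition counting_function :: "(nat \<Rightarrow> real) \<Rightarrow> nat \<Rightarrow> enat" where
  "counting_function r m =
     (if finite (dyadic_indices r m) then enat (card (dyadic_indices r m)) else \<infinity>)"

end

theory Submission
  imports Defs
begin

text \<open>
  Write \<open>D = 2 ^ d\<close> and \<open>z\<^sub>n = r\<^sub>n \<xi>\<^sub>n\<close>. Everything is governed by the quantity \<open>\<bar>1 - \<langle>z,w\<rangle>\<bar>\<close>, which is a
  quasi-metric on the closed ball and whose \<open>-d\<close>-th power is the modulus of the kernel. A cap of
  quasi-radius \<open>h\<close> on the sphere has measure comparable to \<open>h\<^sup>d\<close> (\<open>emeasure_cap_upper\<close>,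
  \<open>emeasure_cap_lower\<close>): by unitary invariance it may be centred at a coordinate vector, and then the
  cone over it is sandwiched between two boxes. So at scale \<open>2 ^ -m\<close> the sphere has about \<open>D ^ m\<close>
  disjoint cells, each hit by a given \<open>\<xi>\<^sub>n\<close> with probability about \<open>D ^ -m\<close>, and \<open>N\<^sub>m\<close> points are thrown
  into these cells.

  Suppose \<open>N\<^sub>m \<le> C D ^ ((1 - \<epsilon>) m)\<close>. A cap of quasi-radius \<open>2 ^ -l\<close>, \<open>l \<le> m + 1\<close>, is expected to
  contain at most \<open>D ^ (m - l - \<epsilon> m)\<close> points of level \<open>m\<close>, up to constants. The binomial moment of a
  large order \<open>K\<close>, a union bound over caps centred at points of the same level, and Borel-Cantelli
  show that almost surely all of these caps contain at most a constant times
  \<open>1 + D ^ (m - l - \<epsilon> m / 2)\<close> points. The exponential gain left over is enough for Schur's test on the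
  Gram matrix of normalised kernels, with a test vector that is exponential in the level
  (\<open>carleson_of_box_counts\<close>). By duality (\<open>schur_test\<close>) the boundedness of the Gram matrix is the
  Carleson inequality.

  Conversely, if the growth condition fails for every \<open>\<epsilon>\<close>, then for each \<open>K\<close> there are arbitrarily
  high levels \<open>m\<close> with \<open>N\<^sub>m\<close> so close to \<open>D ^ m\<close>, on the exponential scale, that the expected number of
  cells with \<open>K\<close> points is at least of order \<open>D ^ (m / 2)\<close>. The events for distinct cells are negatively
  correlated, so by Chebyshev's inequality such a cell exists with probability tending to \<open>1\<close>
  (\<open>AE_cluster\<close>). A cluster of \<open>K\<close> points of level \<open>m\<close> at mutual quasi-distance of order \<open>2 ^ -m\<close> forces the
  Carleson constant to be at least of order \<open>\<surd>K\<close>, as one sees by testing on the kernel at one of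
  these points (\<open>carleson_cluster_bound\<close>). A level with infinitely many points violates the
  Carleson inequality by the same test.
\<close>

section \<open>The Hermitian inner product and the nonisotropic quasi-distance\<close>

lemma cinner_vec_add_left: "cinner_vec (a + b) c = cinner_vec a c + cinner_vec b c"
  by (simp add: cinner_vec_def sum.distrib algebra_simps)

lemma cinner_vec_diff_left: "cinner_vec (a - b) c = cinner_vec a c - cinner_vec b c"
  by (simp add: cinner_vec_def sum_subtractf algebra_simps)

lemma cinner_vec_diff_right: "cinner_vec a (b - c) = cinner_vec a b - cinner_vec a c"
  by (simp add: cinner_vec_def sum_subtractf algebra_simps)

lemma cinner_vec_scale_left: "cinner_vec (c *s a) b = c * cinner_vec a b"
  by (simp add: cinner_vec_def sum_distrib_left algebra_simps)

lemma cinner_vec_scale_right: "cinner_vec a (c *s b) = cnj c * cinner_vec a b"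
  by (simp add: cinner_vec_def sum_distrib_left algebra_simps)

lemma cinner_vec_scaleR_left: "cinner_vec (c *\<^sub>R a) b = of_real c * cinner_vec a b"
  by (simp add: cinner_vec_def sum_distrib_left algebra_simps scaleR_conv_of_real[where 'a=complex])

lemma cinner_vec_scaleR_right: "cinner_vec a (c *\<^sub>R b) = of_real c * cinner_vec a b"
  by (simp add: cinner_vec_def sum_distrib_left algebra_simps scaleR_conv_of_real[where 'a=complex])

lemma cinner_vec_commute: "cinner_vec b a = cnj (cinner_vec a b)"
  by (simp add: cinner_vec_def mult.commute)

lemma cinner_vec_self: "cinner_vec z z = of_real ((norm z)\<^sup>2)"
  by (simp add: cinner_vec_def norm_vec_def L2_set_def sum_nonneg complex_norm_square
        del: of_real_power)

lemma cinner_vec_axis: "cinner_vec x (axis k 1) = x $ k"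
  unfolding cinner_vec_def axis_def by (simp add: if_distrib[of cnj] if_distrib cong: if_cong)

lemma Re_cinner_vec: "Re (cinner_vec z w) = z \<bullet> w"
  by (simp add: cinner_vec_def inner_vec_def inner_complex_def)

lemma continuous_on_cinner_vec [continuous_intros]:
  "continuous_on S f \<Longrightarrow> continuous_on S g \<Longrightarrow> continuous_on S (\<lambda>x. cinner_vec (f x) (g x))"
  unfolding cinner_vec_def by (intro continuous_intros)

lemma norm_vector_scalar_mult_complex: "norm (c *s (z::complex^'d)) = cmod c * norm z"
  by (simp add: norm_vec_def L2_set_def norm_mult power_mult_distrib flip: sum_distrib_left)
     (simp add: real_sqrt_mult)

lemma exists_phase:
  obtains c where "cmod c = 1" "cnj c * a = of_real (cmod a)"
proof (cases "a = 0")
  case False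
  have "cnj (sgn a) * a = (a * cnj a) / of_real (cmod a)"
    by (simp add: sgn_div_norm scaleR_conv_of_real field_simps)
  also have "\<dots> = of_real (cmod a)"
    using False by (simp add: complex_norm_square[symmetric] power2_eq_square)
  finally show ?thesis
    using False by (intro that[of "sgn a"]) (auto simp: norm_sgn)
qed (use that[of 1] in auto)

lemma cinner_vec_cauchy_schwarz: "cmod (cinner_vec z w) \<le> norm z * norm w"
proof -
  obtain c where c: "cmod c = 1" "cnj c * cinner_vec z w = of_real (cmod (cinner_vec z w))"
    by (rule exists_phase)
  have "cmod (cinner_vec z w) = Re (cinner_vec (cnj c *s z) w)"
    by (metis c(2) cinner_vec_scale_left Re_complex_of_real)
  also have "\<dots> \<le> norm (cnj c *s z) * norm w"
    unfolding Re_cinner_vec by (rule norm_cauchy_schwarz)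
  finally show ?thesis
    by (simp add: norm_vector_scalar_mult_complex c)
qed

text \<open>On the unit sphere the square root of this quantity is Koranyi's nonisotropic metric. Here
  it is used on the closed ball, where it also controls the distance to the sphere; the modulus of
  the Szego kernel is its \<open>-d\<close>-th power.\<close>

definition quasi_dist :: "complex^'d \<Rightarrow> complex^'d \<Rightarrow> real" where
  "quasi_dist z w = cmod (1 - cinner_vec z w)"

lemma quasi_dist_nonneg [simp]: "0 \<le> quasi_dist z w"
  by (simp add: quasi_dist_def)

lemma quasi_dist_commute: "quasi_dist z w = quasi_dist w z"
  unfolding quasi_dist_def cinner_vec_commute[of z w]
  by (metis complex_cnj_diff complex_cnj_one complex_mod_cnj)

lemma norm_szego_kernel: "cmod (szego_kernel (z::complex^'d) w) = 1 / quasi_dist z w ^ CARD('d)"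
  by (simp add: szego_kernel_def quasi_dist_def norm_divide norm_power)

lemma borel_measurable_quasi_dist [measurable (raw)]:
  assumes "f \<in> borel_measurable M" "g \<in> borel_measurable M"
  shows "(\<lambda>x. quasi_dist (f x) (g x)) \<in> borel_measurable M"
proof -
  have "(\<lambda>p. quasi_dist (fst p) (snd p)) \<in> borel_measurable borel"
    unfolding quasi_dist_def by (intro borel_measurable_continuous_onI continuous_intros)
  from measurable_compose[OF borel_measurable_Pair[OF assms] this] show ?thesis
    by simp
qed

lemma quasi_dist_le_2:
  assumes "norm z \<le> 1" "norm w \<le> 1" shows "quasi_dist z w \<le> 2"
proof -
  have "cmod (cinner_vec z w) \<le> 1"
    using cinner_vec_cauchy_schwarz[of z w] mult_le_one[of "norm z" "norm w"] assms by simp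
  then show ?thesis
    unfolding quasi_dist_def using norm_triangle_ineq4[of 1 "cinner_vec z w"] by simp
qed

lemma quasi_dist_ge: 
  assumes "norm z \<le> 1" "norm w \<le> 1" shows "1 - norm z * norm w \<le> quasi_dist z w"
  using norm_triangle_ineq2[of 1 "cinner_vec z w"] cinner_vec_cauchy_schwarz[of z w]
  by (simp add: quasi_dist_def)

text \<open>Polarisation, \<open>2 Re (1 - \<langle>z,w\<rangle>) = (1 - \<bar>z\<bar>\<^sup>2) + (1 - \<bar>w\<bar>\<^sup>2) + \<bar>z - w\<bar>\<^sup>2\<close>, bounds all three
  summands as soon as both points lie in the closed ball.\<close>

lemma quasi_dist_polarisation:
  assumes "norm z \<le> 1" "norm w \<le> 1"
  shows "(norm (z - w))\<^sup>2 \<le> 2 * quasi_dist z w" "1 - (norm z)\<^sup>2 \<le> 2 * quasi_dist z w"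
    "1 - (norm w)\<^sup>2 \<le> 2 * quasi_dist z w"
proof -
  have "(norm (z - w))\<^sup>2 = (norm z)\<^sup>2 + (norm w)\<^sup>2 - 2 * Re (cinner_vec z w)"
    by (simp add: Re_cinner_vec power2_norm_eq_inner inner_commute algebra_simps)
  moreover have "1 - Re (cinner_vec z w) \<le> quasi_dist z w"
    unfolding quasi_dist_def using complex_Re_le_cmod[of "1 - cinner_vec z w"] by simp
  moreover have "(norm z)\<^sup>2 \<le> 1" "(norm w)\<^sup>2 \<le> 1"
    using assms by (simp_all add: abs_square_le_1)
  ultimately show "(norm (z - w))\<^sup>2 \<le> 2 * quasi_dist z w" "1 - (norm z)\<^sup>2 \<le> 2 * quasi_dist z w"
    "1 - (norm w)\<^sup>2 \<le> 2 * quasi_dist z w"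
    using zero_le_power2[of "norm (z - w)"] by linarith+
qed

text \<open>From \<open>1 - \<langle>z,w\<rangle> = (1 - \<langle>z,u\<rangle>) + (1 - \<langle>u,w\<rangle>) - (1 - \<bar>u\<bar>\<^sup>2) + \<langle>z - u, u - w\<rangle>\<close>, where the last
  two terms are again controlled by polarisation.\<close>

lemma quasi_dist_triangle:
  assumes "norm z \<le> 1" "norm u \<le> 1" "norm w \<le> 1"
  shows "quasi_dist z w \<le> 3 * (quasi_dist z u + quasi_dist u w)"
proof -
  let ?a = "quasi_dist z u" and ?b = "quasi_dist u w"
  have "1 - cinner_vec z w = (1 - cinner_vec z u) + (1 - cinner_vec u w)
      - of_real (1 - (norm u)\<^sup>2) + cinner_vec (z - u) (u - w)"
    using cinner_vec_self[of u] by (simp add: cinner_vec_diff_left cinner_vec_diff_right)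
  also have "cmod \<dots> \<le> ?a + ?b + cmod (of_real (1 - (norm u)\<^sup>2)) + cmod (cinner_vec (z - u) (u - w))"
    unfolding quasi_dist_def
    by (intro order_trans[OF norm_triangle_ineq] order_trans[OF norm_triangle_ineq4] add_mono order_refl)
  also have "\<dots> \<le> ?a + ?b + (?a + ?b) + (?a + ?b)"
  proof (intro add_mono order_refl)
    have "cmod (of_real (1 - (norm u)\<^sup>2)) = 1 - (norm u)\<^sup>2"
      unfolding norm_of_real using assms by (simp add: abs_square_le_1)
    moreover have "1 - (norm u)\<^sup>2 \<le> 2 * ?a" "1 - (norm u)\<^sup>2 \<le> 2 * ?b"
      using quasi_dist_polarisation assms by blast+
    ultimately show "cmod (of_real (1 - (norm u)\<^sup>2)) \<le> ?a + ?b"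
      by linarith
    have "cmod (cinner_vec (z - u) (u - w)) \<le> norm (z - u) * norm (u - w)"
      by (rule cinner_vec_cauchy_schwarz)
    moreover have "2 * norm (z - u) * norm (u - w) \<le> (norm (z - u))\<^sup>2 + (norm (u - w))\<^sup>2"
      by (rule sum_squares_bound)
    ultimately show "cmod (cinner_vec (z - u) (u - w)) \<le> ?a + ?b"
      using quasi_dist_polarisation(1)[OF assms(1,2)] quasi_dist_polarisation(1)[OF assms(2,3)]
      by linarith
  qed
  finally show ?thesis
    by (simp add: quasi_dist_def)
qed

text \<open>Put \<open>\<lambda> = \<langle>x,y\<rangle>\<close> and \<open>t = r s\<close>. The first bound follows from
  \<open>1 - \<lambda> = (1 - t \<lambda>) - (1 - t) \<lambda>\<close> and \<open>1 - t \<le> \<bar>1 - t \<lambda>\<bar>\<close>, the second from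
  \<open>1 - t \<lambda> = (1 - t) + t (1 - \<lambda>)\<close>. They allow the points of the ball to be replaced by their
  directions.\<close>

lemma quasi_dist_radial:
  assumes "norm x \<le> 1" "norm y \<le> 1" "0 \<le> r" "r \<le> 1" "0 \<le> s" "s \<le> 1"
  shows "quasi_dist x y \<le> 2 * quasi_dist (r *\<^sub>R x) (s *\<^sub>R y)"
    "quasi_dist (r *\<^sub>R x) (s *\<^sub>R y) \<le> (1 - r) + (1 - s) + quasi_dist x y"
proof -
  let ?l = "cinner_vec x y" and ?c = "complex_of_real (r * s)"
  have l: "cmod ?l \<le> 1"
    using cinner_vec_cauchy_schwarz[of x y] mult_le_one[of "norm x" "norm y"] assms by simp
  have rs: "r * s \<le> 1" "0 \<le> r * s"
    using assms by (auto intro: mult_le_one)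
  have q: "quasi_dist (r *\<^sub>R x) (s *\<^sub>R y) = cmod (1 - ?c * ?l)"
    by (simp add: quasi_dist_def cinner_vec_scaleR_left cinner_vec_scaleR_right ac_simps)
  have c1: "cmod (1 - ?c) = 1 - r * s"
    using rs by (metis abs_of_nonneg diff_ge_0_iff_ge norm_of_real of_real_1 of_real_diff)
  have "cmod (1 - ?l) = cmod ((1 - ?c * ?l) - (1 - ?c) * ?l)"
    by (simp add: algebra_simps)
  also have "\<dots> \<le> cmod (1 - ?c * ?l) + (1 - r * s) * cmod ?l"
    using norm_triangle_ineq4[of "1 - ?c * ?l" "(1 - ?c) * ?l"] by (simp only: norm_mult c1)
  also have "(1 - r * s) * cmod ?l \<le> 1 - r * s"
    using rs l by (simp add: mult_left_le)
  also have "1 - r * s \<le> 1 - cmod (?c * ?l)"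
    using rs l by (simp add: norm_mult mult_left_le abs_mult assms)
  also have "\<dots> \<le> cmod (1 - ?c * ?l)"
    using norm_triangle_ineq2[of 1 "?c * ?l"] by simp
  finally show "quasi_dist x y \<le> 2 * quasi_dist (r *\<^sub>R x) (s *\<^sub>R y)"
    unfolding q by (simp add: quasi_dist_def)
  have "cmod (1 - ?c * ?l) = cmod ((1 - ?c) + ?c * (1 - ?l))"
    by (simp add: algebra_simps)
  also have "\<dots> \<le> (1 - r * s) + r * s * cmod (1 - ?l)"
    using norm_triangle_ineq[of "1 - ?c" "?c * (1 - ?l)"] rs
    by (simp only: norm_mult c1 norm_of_real abs_of_nonneg)
  also have "r * s * cmod (1 - ?l) \<le> cmod (1 - ?l)"
    using rs by (simp add: mult_left_le_one_le)
  also have "1 - r * s \<le> (1 - r) + (1 - s)"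
    using mult_nonneg_nonneg[of "1 - r" "1 - s"] assms by (simp add: algebra_simps)
  finally show "quasi_dist (r *\<^sub>R x) (s *\<^sub>R y) \<le> (1 - r) + (1 - s) + quasi_dist x y"
    unfolding q by (simp add: quasi_dist_def)
qed

section \<open>Uniform measure of nonisotropic caps\<close>

text \<open>The push-forward \<open>\<nu>\<close> is translation invariant and agrees with Lebesgue measure \<open>\<lambda>\<close> on the unit
  ball \<open>B\<close>. Computing the integral of \<open>1\<^sub>A(x) 1\<^sub>B(y)\<close> with respect to \<open>\<nu>\<close> in \<open>x\<close> and \<open>\<lambda>\<close> in \<open>y\<close>, with a
  shift of either variable, gives \<open>\<nu>(A) \<lambda>(B) = \<lambda>(A) \<nu>(B)\<close>. This is the uniqueness proof for Haar
  measure.\<close>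

lemma distr_lborel_linear_isometry:
  fixes f :: "'a::euclidean_space \<Rightarrow> 'a"
  assumes "linear f" and iso: "\<And>x. norm (f x) = norm x"
  shows "distr lborel borel f = lborel"
proof -
  have cont: "continuous_on UNIV f"
    using assms(1) by (simp add: linear_continuous_on linear_conv_bounded_linear)
  have [measurable]: "f \<in> borel_measurable borel"
    using cont by (rule borel_measurable_continuous_onI)
  have surj: "surj f"
    using assms linear_injective_imp_surjective[of f]
    by (metis (no_types, lifting) linear_injective_0 norm_eq_zero)
  define N where "N = distr lborel borel f"
  have [measurable_cong, simp]: "sets N = sets borel" and [simp]: "space N = UNIV"
    by (simp_all add: N_def)
  let ?B = "ball (0::'a) 1"
  have vball: "f -` ?B = ?B"
    by (auto simp: iso)
  have NB: "emeasure N ?B = emeasure lborel ?B"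
    unfolding N_def by (subst emeasure_distr) (simp_all add: vball)
  \<comment> \<open>the push-forward is again translation invariant, because \<open>f\<close> is additive and onto\<close>
  have shift: "(\<integral>\<^sup>+x. g (x + y) \<partial>N) = (\<integral>\<^sup>+x. g x \<partial>N)" if [measurable]: "g \<in> borel_measurable borel"
    for y and g :: "'a \<Rightarrow> ennreal"
  proof -
    obtain u where u: "y = f u" using surj by blast
    have "(\<integral>\<^sup>+x. g (x + y) \<partial>N) = (\<integral>\<^sup>+x. g (f x + y) \<partial>lborel)"
      unfolding N_def by (subst nn_integral_distr) auto
    also have "\<dots> = (\<integral>\<^sup>+x. g (f (u + x)) \<partial>lborel)"
      using u linear_add[OF assms(1)] by (simp add: add.commute)
    also have "\<dots> = (\<integral>\<^sup>+x. g (f x) \<partial>(distr lborel borel ((+) u)))"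
      by (subst nn_integral_distr) auto
    also have "\<dots> = (\<integral>\<^sup>+x. g x \<partial>N)"
      unfolding N_def by (subst nn_integral_distr) (auto simp: lborel_distr_plus)
    finally show ?thesis .
  qed
  have lshift: "(\<integral>\<^sup>+x. g (x + y) \<partial>lborel) = (\<integral>\<^sup>+x. g x \<partial>lborel)" if [measurable]: "g \<in> borel_measurable borel"
    for y and g :: "'a \<Rightarrow> ennreal"
  proof -
    have "(\<integral>\<^sup>+x. g (x + y) \<partial>lborel) = (\<integral>\<^sup>+x. g x \<partial>(distr lborel borel ((+) y)))"
      by (subst nn_integral_distr) (auto simp: add.commute)
    then show ?thesis by (simp add: lborel_distr_plus)
  qed
  have sf: "sigma_finite_measure N"
  proof
    have fin: "emeasure N (ball 0 (real n)) \<noteq> \<infinity>" for n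
    proof -
      have "f -` (ball 0 (real n)) = ball 0 (real n)" by (auto simp: iso)
      then show ?thesis unfolding N_def
        using emeasure_lborel_ball_finite[of "0::'a" "real n"]
        by (subst emeasure_distr) (auto simp: less_top)
    qed
    have "(\<Union>n. ball (0::'a) (real n)) = UNIV"
      by (auto simp: reals_Archimedean2)
    then show "\<exists>A. countable A \<and> A \<subseteq> sets N \<and> \<Union> A = space N \<and> (\<forall>a\<in>A. emeasure N a \<noteq> \<infinity>)"
      using fin by (intro exI[of _ "range (\<lambda>n. ball (0::'a) (real n))"]) auto
  qed
  interpret N: sigma_finite_measure N by (rule sf)
  interpret P: pair_sigma_finite N "lborel :: 'a measure"
    by (simp add: pair_sigma_finite_def sf sigma_finite_lborel)
  have main: "emeasure N A = emeasure lborel A" if [measurable]: "A \<in> sets borel" for A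
  proof -
    have [measurable]: "ball (0::'a) 1 \<in> sets borel" by simp
    let ?a = "\<lambda>x. indicator A x :: ennreal" and ?b = "\<lambda>x. indicator ?B x :: ennreal"
    have in_lb: "(\<integral>\<^sup>+y. ?a x * ?b y \<partial>lborel) = ?a x * emeasure lborel ?B" for x
      by (subst nn_integral_cmult) (auto intro!: borel_measurable_indicator)
    have in_N: "(\<integral>\<^sup>+x. ?a y * ?b x \<partial>N) = ?a y * emeasure N ?B" for y
      by (subst nn_integral_cmult) (auto intro!: borel_measurable_indicator)
    \<comment> \<open>shift \<open>x\<close> by \<open>y\<close> under \<open>N\<close>, then \<open>y\<close> by \<open>- x\<close> under Lebesgue measure, then \<open>x\<close> back by \<open>y\<close>; the
      ball is symmetric\<close>
    have "emeasure N A * emeasure lborel ?B = (\<integral>\<^sup>+x. (\<integral>\<^sup>+y. ?a x * ?b y \<partial>lborel) \<partial>N)"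
      unfolding in_lb by (subst nn_integral_multc) (auto intro!: borel_measurable_indicator)
    also have "\<dots> = (\<integral>\<^sup>+y. (\<integral>\<^sup>+x. ?a x * ?b y \<partial>N) \<partial>lborel)"
      by (rule P.Fubini'[symmetric], measurable)
    also have "\<dots> = (\<integral>\<^sup>+y. (\<integral>\<^sup>+x. ?a (x + y) * ?b y \<partial>N) \<partial>lborel)"
    proof (rule nn_integral_cong)
      fix y
      show "(\<integral>\<^sup>+x. ?a x * ?b y \<partial>N) = (\<integral>\<^sup>+x. ?a (x + y) * ?b y \<partial>N)"
        using shift[of "\<lambda>x. ?a x * ?b y" y] by simp
    qed
    also have "\<dots> = (\<integral>\<^sup>+x. (\<integral>\<^sup>+y. ?a (x + y) * ?b y \<partial>lborel) \<partial>N)"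
      by (rule P.Fubini', measurable)
    also have "\<dots> = (\<integral>\<^sup>+x. (\<integral>\<^sup>+y. ?a y * ?b (x - y) \<partial>lborel) \<partial>N)"
    proof (rule nn_integral_cong)
      fix x
      have "(\<integral>\<^sup>+y. ?a (x + y) * ?b y \<partial>lborel) = (\<integral>\<^sup>+y. ?a (y + x) * ?b (x - (y + x)) \<partial>lborel)"
        by (intro nn_integral_cong) (auto simp: add.commute indicator_def)
      also have "\<dots> = (\<integral>\<^sup>+y. ?a y * ?b (x - y) \<partial>lborel)"
        by (rule lshift) simp
      finally show "(\<integral>\<^sup>+y. ?a (x + y) * ?b y \<partial>lborel) = (\<integral>\<^sup>+y. ?a y * ?b (x - y) \<partial>lborel)" .
    qed
    also have "\<dots> = (\<integral>\<^sup>+y. (\<integral>\<^sup>+x. ?a y * ?b (x - y) \<partial>N) \<partial>lborel)"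
      by (rule P.Fubini'[symmetric], measurable)
    also have "\<dots> = (\<integral>\<^sup>+y. (\<integral>\<^sup>+x. ?a y * ?b x \<partial>N) \<partial>lborel)"
    proof (rule nn_integral_cong)
      fix y
      show "(\<integral>\<^sup>+x. ?a y * ?b (x - y) \<partial>N) = (\<integral>\<^sup>+x. ?a y * ?b x \<partial>N)"
        using shift[of "\<lambda>x. ?a y * ?b x" "-y"] by simp
    qed
    also have "\<dots> = emeasure lborel A * emeasure N ?B"
      unfolding in_N by (subst nn_integral_multc) (auto intro!: borel_measurable_indicator)
    finally have "emeasure N A * emeasure lborel ?B = emeasure lborel A * emeasure lborel ?B"
      using NB by simp
    then show ?thesis
      using emeasure_unit_ball[where 'a='a]
      by (simp add: ennreal_mult_cancel_left mult.commute[of _ "emeasure lborel ?B"])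
  qed
  show ?thesis
    unfolding N_def[symmetric] by (rule measure_eqI) (auto simp: main)
qed

lemma emeasure_sphere_uniform:
  assumes [measurable]: "A \<in> sets borel"
  shows "emeasure sphere_uniform (A :: 'a::euclidean_space set) =
    emeasure lborel (ball 0 1 \<inter> {x. x /\<^sub>R norm x \<in> A}) / emeasure lborel (ball (0::'a) 1)"
proof -
  have "{x. x /\<^sub>R norm x \<in> A} \<in> sets (borel :: 'a measure)"
    by measurable
  then show ?thesis
    unfolding sphere_uniform_def
    by (subst emeasure_distr) (auto simp: emeasure_uniform_measure vimage_def)
qed

lemma emeasure_sphere_uniform_isometry:
  fixes f :: "'a::euclidean_space \<Rightarrow> 'a"
  assumes "linear f" and iso: "\<And>x. norm (f x) = norm x" and [measurable]: "A \<in> sets borel"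
  shows "emeasure sphere_uniform (f -` A) = emeasure sphere_uniform A"
proof -
  have [measurable]: "f \<in> borel_measurable borel"
    using assms(1) by (intro borel_measurable_continuous_onI)
      (simp add: linear_continuous_on linear_conv_bounded_linear)
  have B: "ball 0 1 \<inter> {x. x /\<^sub>R norm x \<in> f -` A} = f -` (ball 0 1 \<inter> {x. x /\<^sub>R norm x \<in> A})"
    by (auto simp: iso linear_scale[OF assms(1)])
  have fA: "f -` A \<in> sets borel"
    using measurable_sets[of f borel borel A] by simp
  have S: "ball 0 1 \<inter> {x. x /\<^sub>R norm x \<in> A} \<in> sets borel"
    by measurable
  have "emeasure lborel (f -` (ball 0 1 \<inter> {x. x /\<^sub>R norm x \<in> A}))
      = emeasure (distr lborel borel f) (ball 0 1 \<inter> {x. x /\<^sub>R norm x \<in> A})"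
    using S by (subst emeasure_distr) auto
  then show ?thesis
    by (simp only: emeasure_sphere_uniform[OF assms(3)] emeasure_sphere_uniform[OF fA] B
        distr_lborel_linear_isometry[OF assms(1,2)])
qed

text \<open>A Householder reflection in the hyperplane orthogonal to \<open>\<zeta> - c e\<^sub>k\<close>, followed by a
  multiplication by the conjugate of the phase \<open>c\<close>. The phase makes \<open>\<langle>\<zeta>, c e\<^sub>k\<rangle>\<close> real, without which
  the complex reflection would not exchange the two vectors.\<close>

lemma unitary_to_axis:
  fixes \<zeta> :: "complex^'d" and k :: 'd
  assumes "norm \<zeta> = 1"
  obtains U where "linear U" "\<And>x. norm (U x) = norm x"
    "\<And>x y. cinner_vec (U x) (U y) = cinner_vec x y" "U \<zeta> = axis k 1"
proof -
  define a where "a = \<zeta> $ k"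
  obtain c where c: "cmod c = 1" "cnj c * a = of_real (cmod a)"
    by (rule exists_phase)
  have cc: "cnj c * c = 1" "c * cnj c = 1"
    using c(1) complex_norm_square[of c] by (auto simp: mult.commute)
  define e :: "complex^'d" where "e = c *s axis k 1"
  have ze: "cinner_vec \<zeta> e = of_real (cmod a)"
    using c by (simp add: e_def cinner_vec_scale_right cinner_vec_axis a_def)
  have ee: "cinner_vec e e = 1"
    by (simp add: e_def cinner_vec_scale_right cinner_vec_scale_left cinner_vec_axis cc mult.assoc[symmetric])
  have zz: "cinner_vec \<zeta> \<zeta> = 1"
    using assms by (simp add: cinner_vec_self)
  have ez: "cinner_vec e \<zeta> = of_real (cmod a)"
    using ze cinner_vec_commute[of e \<zeta>] by simp
  define v where "v = \<zeta> - e"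
  have vv: "cinner_vec v v = of_real (2 - 2 * cmod a)"
    by (simp add: v_def cinner_vec_diff_left cinner_vec_diff_right ze ez ee zz)
  have zv: "cinner_vec \<zeta> v = of_real (1 - cmod a)"
    by (simp add: v_def cinner_vec_diff_right ze zz)
  define R where "R x = (if v = 0 then x else x - (2 * cinner_vec x v / cinner_vec v v) *s v)" for x
  have v0: "cinner_vec v v \<noteq> 0" if "v \<noteq> 0"
    using that by (simp add: cinner_vec_self)
  have R_ip: "cinner_vec (R x) (R y) = cinner_vec x y" for x y
  proof (cases "v = 0")
    case False
    have real_vv: "cnj (cinner_vec v v) = cinner_vec v v"
      by (simp add: cinner_vec_self)
    show ?thesis
      using False v0[OF False] cinner_vec_commute[of v x] cinner_vec_commute[of v y]
        cinner_vec_commute[of x v] cinner_vec_commute[of y v]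
      by (simp add: R_def cinner_vec_diff_left cinner_vec_diff_right cinner_vec_scale_left
          cinner_vec_scale_right real_vv field_simps)
  qed (simp add: R_def)
  have Rz: "R \<zeta> = e"
  proof (cases "v = 0")
    case True
    then show ?thesis by (simp add: R_def v_def)
  next
    case False
    then have "2 - 2 * cmod a \<noteq> 0"
      using v0 vv by auto
    then have "2 * cinner_vec \<zeta> v / cinner_vec v v = 1"
      unfolding vv zv by (metis (no_types, opaque_lifting) divide_self_if mult.right_neutral
          of_real_1 of_real_divide of_real_mult of_real_numeral right_diff_distrib)
    then show ?thesis
      using False by (simp add: R_def v_def)
  qed
  have R_add: "R (x + y) = R x + R y" for x y
    by (simp add: R_def cinner_vec_add_left vec_eq_iff field_simps add_divide_distrib)
  have R_scale: "R (b *\<^sub>R x) = b *\<^sub>R R x" for b x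
    by (simp add: R_def cinner_vec_scaleR_left vec_eq_iff algebra_simps scaleR_conv_of_real[where 'a=complex])
  define U where "U x = cnj c *s R x" for x
  have U_ip: "cinner_vec (U x) (U y) = cinner_vec x y" for x y
    by (simp add: U_def cinner_vec_scale_left cinner_vec_scale_right R_ip cc mult.assoc[symmetric])
  show ?thesis
  proof (rule that)
    show "linear U"
      by (rule linearI) (simp_all add: U_def R_add R_scale vec_eq_iff algebra_simps scaleR_conv_of_real[where 'a=complex])
    show "norm (U x) = norm x" for x
      using U_ip[of x x] by (simp add: cinner_vec_self del: of_real_power)
    show "U \<zeta> = axis k 1"
      by (simp add: U_def Rz e_def vec_eq_iff cc mult.assoc[symmetric])
  qed (rule U_ip)
qed

lemma Basis_complex_vec_image:
  "(Basis :: (complex^'d) set) = (\<lambda>(i, u). axis i u) ` (UNIV \<times> {1, \<i>})"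
  unfolding Basis_vec_def by (auto simp: Basis_complex_def)

lemma mem_cbox_complex_vec:
  fixes l u x :: "complex^'d"
  shows "x \<in> cbox l u \<longleftrightarrow> (\<forall>i. Re (l $ i) \<le> Re (x $ i) \<and> Re (x $ i) \<le> Re (u $ i)
    \<and> Im (l $ i) \<le> Im (x $ i) \<and> Im (x $ i) \<le> Im (u $ i))"
  unfolding mem_box(2) Basis_complex_vec_image by (auto simp: inner_axis inner_complex_def)

lemma emeasure_lborel_cbox_complex_vec:
  fixes l u :: "complex^'d"
  assumes "\<And>i. Re (l $ i) \<le> Re (u $ i)" "\<And>i. Im (l $ i) \<le> Im (u $ i)"
  shows "emeasure lborel (cbox l u)
    = ennreal (\<Prod>i\<in>UNIV. Re (u $ i - l $ i) * Im (u $ i - l $ i))"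
proof -
  have inj: "inj_on (\<lambda>(i::'d, u::complex). axis i u) (UNIV \<times> {1, \<i>})"
    by (auto simp: inj_on_def axis_eq_axis)
  have "emeasure lborel (cbox l u) = ennreal (\<Prod>b\<in>Basis. (u - l) \<bullet> b)"
    using assms by (intro emeasure_lborel_cbox)
      (auto simp: Basis_complex_vec_image inner_axis inner_complex_def)
  also have "(\<Prod>b\<in>Basis. (u - l) \<bullet> b) = (\<Prod>i\<in>UNIV. \<Prod>w\<in>{1, \<i>}. (u - l) \<bullet> axis i w)"
    unfolding Basis_complex_vec_image prod.reindex[OF inj]
    by (subst prod.cartesian_product) (simp add: case_prod_beta)
  finally show ?thesis
    by (simp add: inner_axis inner_complex_def)
qed

lemma sets_nonisotropic_cap [measurable]: "{x. quasi_dist x \<zeta> < h} \<in> sets borel"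
  using borel_measurable_quasi_dist[of "\<lambda>x. x" borel "\<lambda>_. \<zeta>"] by simp

lemma emeasure_unit_ball_measure:
  "emeasure lborel (ball (0::'a::euclidean_space) 1) = ennreal (measure lborel (ball (0::'a) 1))"
  "0 < measure lborel (ball (0::'a) 1)"
proof -
  show *: "emeasure lborel (ball (0::'a) 1) = ennreal (measure lborel (ball (0::'a) 1))"
    using emeasure_unit_ball[where 'a='a] by (intro emeasure_eq_ennreal_measure) simp
  show "0 < measure lborel (ball (0::'a) 1)"
    using emeasure_unit_ball(1)[where 'a='a] unfolding * by (simp add: zero_less_measure_iff)
qed

lemma emeasure_cap_axis:
  fixes \<zeta> :: "complex^'d" and k :: 'd
  assumes "norm \<zeta> = 1"
  shows "emeasure sphere_uniform {x. quasi_dist x \<zeta> < h} =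
    emeasure lborel (ball 0 1 \<inter> {x. quasi_dist (x /\<^sub>R norm x) (axis k 1) < h})
      / emeasure lborel (ball (0::complex^'d) 1)"
proof -
  obtain U where U: "linear U" "\<And>x. norm (U x) = norm x"
    "\<And>x y. cinner_vec (U x) (U y) = cinner_vec x y" "U \<zeta> = axis k 1"
    using unitary_to_axis[OF assms] by metis
  have "quasi_dist x \<zeta> = quasi_dist (U x) (axis k 1)" for x
    unfolding quasi_dist_def U(4)[symmetric] U(3) ..
  then have "{x. quasi_dist x \<zeta> < h} = U -` {x. quasi_dist x (axis k 1) < h}"
    by auto
  then have "emeasure sphere_uniform {x. quasi_dist x \<zeta> < h}
      = emeasure sphere_uniform {x. quasi_dist x (axis k 1) < h}"
    by (simp only: emeasure_sphere_uniform_isometry[OF U(1,2) sets_nonisotropic_cap])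
  then show ?thesis
    by (simp add: emeasure_sphere_uniform)
qed

lemma prod_if_single:
  fixes k :: "'d::finite"
  shows "(\<Prod>i\<in>UNIV. if i = k then a else b) = a * (b :: real) ^ (CARD('d) - 1)"
  by (subst prod.remove[of _ k]) (auto simp: card_Diff_singleton)

lemma power_card_pred: "x * x ^ (CARD('d::finite) - 1) = (x :: real) ^ CARD('d)"
  by (metis power_eq_if zero_less_card_finite less_numeral_extra(3))

text \<open>In direction \<open>e\<^sub>k\<close>, the cone over a cap of quasi-radius \<open>h\<close> lies in a box with side of order
  \<open>1\<close> in the real direction \<open>e\<^sub>k\<close>, of order \<open>h\<close> in direction \<open>i e\<^sub>k\<close>, and of order \<open>\<surd>h\<close> in the
  remaining \<open>2d - 2\<close> directions; and it contains such a box.\<close>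

lemma emeasure_cap_upper:
  obtains C where "0 < C" "\<And>\<zeta> h. norm (\<zeta> :: complex^'d) = 1 \<Longrightarrow> 0 \<le> h \<Longrightarrow>
    emeasure sphere_uniform {x. quasi_dist x \<zeta> < h} \<le> ennreal (C * h ^ CARD('d))"
proof -
  define V where "V = measure lborel (ball (0::complex^'d) 1)"
  have V: "emeasure lborel (ball (0::complex^'d) 1) = ennreal V" "0 < V"
    unfolding V_def by (rule emeasure_unit_ball_measure)+
  show ?thesis
  proof (rule that[of "8 ^ CARD('d) / V"])
    fix \<zeta> :: "complex^'d" and h :: real
    assume z: "norm \<zeta> = 1" and h: "0 \<le> h"
    obtain k :: 'd where True by blast
    define u :: "complex^'d" where
      "u = (\<chi> i. if i = k then Complex 1 h else Complex (sqrt (2 * h)) (sqrt (2 * h)))"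
    let ?S = "ball 0 1 \<inter> {x. quasi_dist (x /\<^sub>R norm x) (axis k 1) < h}"
    have "?S \<subseteq> cbox (- u) u"
    proof safe
      fix x :: "complex^'d"
      assume x: "x \<in> ball 0 1" and q: "quasi_dist (x /\<^sub>R norm x) (axis k 1) < h"
      have nx: "norm x \<le> 1" using x by simp
      define y where "y = x /\<^sub>R norm x"
      have xy: "x = norm x *\<^sub>R y" and ny: "norm y \<le> 1" by (cases "x = 0"; simp add: y_def)+
      have qy: "cmod (1 - y $ k) < h"
        using q by (simp add: quasi_dist_def cinner_vec_axis y_def)
      have le: "\<bar>Re (x $ i)\<bar> \<le> \<bar>Re (y $ i)\<bar>" "\<bar>Im (x $ i)\<bar> \<le> \<bar>Im (y $ i)\<bar>" for i
        by (subst xy, use nx in \<open>simp add: abs_mult mult_left_le_one_le\<close>)+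
      have R: "\<bar>Re (x $ k)\<bar> \<le> 1"
        using abs_Re_le_cmod[of "x $ k"] Finite_Cartesian_Product.norm_nth_le[of x k] nx by linarith
      have "\<bar>Im (y $ k)\<bar> \<le> h"
        using abs_Im_le_cmod[of "1 - y $ k"] qy by simp
      then have I: "\<bar>Im (x $ k)\<bar> \<le> h"
        using le(2)[of k] by linarith
      have other: "cmod (y $ i) \<le> sqrt (2 * h)" if "i \<noteq> k" for i
      proof (rule real_le_rsqrt)
        have "(cmod (y $ i))\<^sup>2 + (cmod (y $ k))\<^sup>2 = (\<Sum>j\<in>{i,k}. (cmod (y $ j))\<^sup>2)"
          using that by simp
        also have "\<dots> \<le> (\<Sum>j\<in>UNIV. (cmod (y $ j))\<^sup>2)"
          by (rule sum_mono2) auto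
        also have "\<dots> = (norm y)\<^sup>2"
          by (simp add: norm_vec_def L2_set_def sum_nonneg)
        also have "\<dots> \<le> 1"
          using ny by (simp add: abs_square_le_1)
        finally have 1: "(cmod (y $ i))\<^sup>2 + (cmod (y $ k))\<^sup>2 \<le> 1" .
        have "1 - cmod (y $ k) \<le> h"
          using norm_triangle_ineq2[of 1 "y $ k"] qy by simp
        moreover have "0 \<le> (1 - cmod (y $ k))\<^sup>2" by simp
        ultimately show "(cmod (y $ i))\<^sup>2 \<le> 2 * h"
          using 1 by (simp add: power2_eq_square algebra_simps)
      qed
      have "\<bar>Re (x $ i)\<bar> \<le> sqrt (2 * h)" "\<bar>Im (x $ i)\<bar> \<le> sqrt (2 * h)" if "i \<noteq> k" for i
        using le[of i] other[OF that] abs_Re_le_cmod[of "y $ i"] abs_Im_le_cmod[of "y $ i"] by linarith+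
      with R I show "x \<in> cbox (- u) u"
        unfolding mem_cbox_complex_vec by (auto simp: u_def abs_le_iff minus_le_iff)
    qed
    then have "emeasure lborel ?S \<le> emeasure lborel (cbox (- u) u)"
      by (intro emeasure_mono) auto
    also have "\<dots> = ennreal (\<Prod>i\<in>UNIV. Re (u $ i - (- u) $ i) * Im (u $ i - (- u) $ i))"
      by (rule emeasure_lborel_cbox_complex_vec) (auto simp: u_def h)
    also have "(\<Prod>i\<in>UNIV. Re (u $ i - (- u) $ i) * Im (u $ i - (- u) $ i))
        = (\<Prod>i\<in>UNIV. if i = k then 4 * h else 8 * h)"
      by (rule prod.cong) (auto simp: u_def h)
    also have "\<dots> \<le> 8 * h * (8 * h) ^ (CARD('d) - 1)"
      unfolding prod_if_single using h by (intro mult_right_mono) auto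
    also have "\<dots> = 8 ^ CARD('d) * h ^ CARD('d)"
      using power_card_pred[where 'd='d, of "8 * h"] by (simp add: power_mult_distrib)
    finally have S: "emeasure lborel ?S \<le> ennreal (8 ^ CARD('d) * h ^ CARD('d))"
      by (simp add: ennreal_leI)
    have "emeasure sphere_uniform {x. quasi_dist x \<zeta> < h} = emeasure lborel ?S / ennreal V"
      unfolding emeasure_cap_axis[OF z, of h k] V(1) ..
    also have "\<dots> \<le> ennreal (8 ^ CARD('d) * h ^ CARD('d)) / ennreal V"
      by (rule divide_right_mono_ennreal[OF S])
    finally show "emeasure sphere_uniform {x. quasi_dist x \<zeta> < h} \<le> ennreal (8 ^ CARD('d) / V * h ^ CARD('d))"
      using V(2) h by (simp add: divide_ennreal)
  qed (use V in auto)
qed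

lemma emeasure_cap_lower:
  obtains c where "0 < c" "\<And>\<zeta> h. norm (\<zeta> :: complex^'d) = 1 \<Longrightarrow> 0 < h \<Longrightarrow> h \<le> 1 \<Longrightarrow>
    ennreal (c * h ^ CARD('d)) \<le> emeasure sphere_uniform {x. quasi_dist x \<zeta> < h}"
proof -
  let ?d = "real CARD('d)"
  have d1: "?d \<ge> 1" by (simp add: Suc_leI)
  define V where "V = measure lborel (ball (0::complex^'d) 1)"
  have V: "emeasure lborel (ball (0::complex^'d) 1) = ennreal V" "0 < V"
    unfolding V_def by (rule emeasure_unit_ball_measure)+
  show ?thesis
  proof (rule that[of "(1 / (16 * ?d)) ^ CARD('d) / V"])
    show "0 < (1 / (16 * ?d)) ^ CARD('d) / V"
      using d1 V by simp
    fix \<zeta> :: "complex^'d" and h :: real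
    assume z: "norm \<zeta> = 1" and h: "0 < h" "h \<le> 1"
    obtain k :: 'd where True by blast
    \<comment> \<open>small enough that the \<open>2d\<close> real coordinates bounded by \<open>s\<close> contribute at most \<open>h / 8\<close> to the
      squared norm\<close>
    define s where "s = sqrt (h / (16 * ?d))"
    have s: "s\<^sup>2 = h / (16 * ?d)" "0 \<le> s"
      using h by (auto simp: s_def)
    define l u :: "complex^'d" where
      "l = (\<chi> i. if i = k then Complex (1/2) (- h/8) else Complex (- s) (- s))" and
      "u = (\<chi> i. if i = k then Complex (3/4) (h/8) else Complex s s)"
    let ?S = "ball 0 1 \<inter> {x. quasi_dist (x /\<^sub>R norm x) (axis k 1) < h}"
    have sub: "cbox l u \<subseteq> ?S"
    proof
      fix x :: "complex^'d"
      assume x: "x \<in> cbox l u"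
      define a b where "a = Re (x $ k)" and "b = Im (x $ k)"
      have a: "1/2 \<le> a" "a \<le> 3/4" and b: "\<bar>b\<bar> \<le> h/8"
        using x[unfolded mem_cbox_complex_vec, rule_format, of k]
        by (auto simp: l_def u_def a_def b_def)
      have other: "(cmod (x $ i))\<^sup>2 \<le> h / (8 * ?d)" if "i \<noteq> k" for i
      proof -
        have "\<bar>Re (x $ i)\<bar> \<le> s" "\<bar>Im (x $ i)\<bar> \<le> s"
          using that x[unfolded mem_cbox_complex_vec, rule_format, of i] by (auto simp: l_def u_def)
        then have "(Re (x $ i))\<^sup>2 \<le> s\<^sup>2" "(Im (x $ i))\<^sup>2 \<le> s\<^sup>2"
          by (auto simp: abs_le_square_iff[symmetric] s(2))
        then show ?thesis
          unfolding cmod_power2 s(1) by (simp add: field_simps)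
      qed
      have "(norm x)\<^sup>2 = (\<Sum>i\<in>UNIV. (cmod (x $ i))\<^sup>2)"
        by (simp add: norm_vec_def L2_set_def sum_nonneg)
      also have "\<dots> = (cmod (x $ k))\<^sup>2 + (\<Sum>i\<in>UNIV - {k}. (cmod (x $ i))\<^sup>2)"
        by (subst sum.remove[of _ k]) auto
      also have "(\<Sum>i\<in>UNIV - {k}. (cmod (x $ i))\<^sup>2) \<le> (\<Sum>i\<in>UNIV - {k}. h / (8 * ?d))"
        by (rule sum_mono) (use other in auto)
      also have "\<dots> \<le> (\<Sum>i\<in>(UNIV :: 'd set). h / (8 * ?d))"
        using h by (intro sum_mono2) auto
      also have "\<dots> = h / 8"
        using d1 by simp
      finally have nx2: "(norm x)\<^sup>2 \<le> a\<^sup>2 + b\<^sup>2 + h / 8"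
        by (simp add: cmod_power2 a_def b_def)
      have b2: "b\<^sup>2 \<le> h / 64"
      proof -
        have "b\<^sup>2 \<le> (h / 8)\<^sup>2" using b h by (simp add: abs_le_square_iff[symmetric])
        also have "\<dots> \<le> h / 64" using h by (simp add: power2_eq_square)
        finally show ?thesis .
      qed
      have a2: "a\<^sup>2 \<le> (3/4)\<^sup>2"
        using a by (intro power_mono) auto
      have "(norm x)\<^sup>2 < 1"
        using nx2 b2 a2 h by (simp add: power2_eq_square)
      then have n1: "norm x < 1"
        by (simp add: abs_square_less_1)
      have na: "a \<le> norm x"
        using abs_Re_le_cmod[of "x $ k"] Finite_Cartesian_Product.norm_nth_le[of x k] a by (simp add: a_def)
      have "norm x - a \<le> (norm x - a) * (norm x + a)"
        using na a by (simp add: mult_le_cancel_left1)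
      also have "\<dots> = (norm x)\<^sup>2 - a\<^sup>2"
        by (simp add: power2_eq_square algebra_simps)
      finally have gap: "norm x - a \<le> h / 64 + h / 8"
        using nx2 b2 by linarith
      have np: "1/2 \<le> norm x" "norm x > 0" using na a by linarith+
      have "1 - (x /\<^sub>R norm x) $ k = of_real (1 / norm x) * (of_real (norm x) - x $ k)"
        using np by (simp add: scaleR_conv_of_real[where 'a=complex] field_simps)
      then have "quasi_dist (x /\<^sub>R norm x) (axis k 1) = cmod (of_real (norm x) - x $ k) / norm x"
        by (simp add: quasi_dist_def cinner_vec_axis norm_mult norm_divide del: vector_scaleR_component)
      also have "cmod (of_real (norm x) - x $ k) \<le> (norm x - a) + \<bar>b\<bar>"
        using cmod_le[of "of_real (norm x) - x $ k"] na by (simp add: a_def b_def)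
      also have "\<dots> \<le> h / 64 + h / 8 + h / 8"
        using gap b by linarith
      also have "(h / 64 + h / 8 + h / 8) / norm x \<le> (h / 64 + h / 8 + h / 8) / (1/2)"
        using np h by (intro divide_left_mono) auto
      also have "\<dots> < h" using h by simp
      finally have "quasi_dist (x /\<^sub>R norm x) (axis k 1) < h"
        using np by (simp add: divide_right_mono)
      with n1 show "x \<in> ?S" by simp
    qed
    have "(1 / (16 * ?d)) ^ CARD('d) * h ^ CARD('d) = h / (16 * ?d) * (h / (16 * ?d)) ^ (CARD('d) - 1)"
      unfolding power_card_pred by (simp add: power_divide)
    also have "\<dots> \<le> h / 16 * (h / (4 * ?d)) ^ (CARD('d) - 1)"
      using h d1 by (intro mult_mono power_mono divide_left_mono) auto
    also have "\<dots> = (\<Prod>i\<in>UNIV. if i = k then h / 16 else h / (4 * ?d))"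
      unfolding prod_if_single ..
    also have "\<dots> = (\<Prod>i\<in>UNIV. Re (u $ i - l $ i) * Im (u $ i - l $ i))"
      using s by (intro prod.cong) (auto simp: u_def l_def power2_eq_square field_simps)
    finally have "ennreal ((1 / (16 * ?d)) ^ CARD('d) * h ^ CARD('d)) \<le> emeasure lborel (cbox l u)"
      using h s(2) by (subst emeasure_lborel_cbox_complex_vec) (auto simp: u_def l_def intro!: ennreal_leI)
    also have "\<dots> \<le> emeasure lborel ?S"
      by (intro emeasure_mono sub) auto
    finally have S: "ennreal ((1 / (16 * ?d)) ^ CARD('d) * h ^ CARD('d)) \<le> emeasure lborel ?S" .
    have "ennreal ((1 / (16 * ?d)) ^ CARD('d) / V * h ^ CARD('d))
        = ennreal ((1 / (16 * ?d)) ^ CARD('d) * h ^ CARD('d)) / ennreal V"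
      using V(2) h by (simp add: divide_ennreal)
    also have "\<dots> \<le> emeasure lborel ?S / ennreal V"
      by (rule divide_right_mono_ennreal[OF S])
    also have "\<dots> = emeasure sphere_uniform {x. quasi_dist x \<zeta> < h}"
      unfolding emeasure_cap_axis[OF z, of h k] V(1) ..
    finally show "ennreal ((1 / (16 * ?d)) ^ CARD('d) / V * h ^ CARD('d))
      \<le> emeasure sphere_uniform {x. quasi_dist x \<zeta> < h}" .
  qed
qed

section \<open>Carleson sequences: finite sections and Schur's test\<close>

context rkhs
begin

lemma ip_real: "f \<in> H \<Longrightarrow> ip f f = of_real (Re (ip f f))"
  using ip_cnj[of f f] by (simp add: complex_eq_iff)

lemma ip_norm_squared: "f \<in> H \<Longrightarrow> (ip_norm ip f)\<^sup>2 = Re (ip f f)"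
  by (simp add: ip_norm_def ip_nonneg)

lemma sum_mem:
  assumes "finite F" "\<And>j. j \<in> F \<Longrightarrow> g j \<in> H"
  shows "(\<lambda>x. \<Sum>j\<in>F. c j * g j x) \<in> H"
  using assms by (induction F rule: finite_induct) (auto simp: zero_mem intro!: add_mem scale_mem)

lemma ip_sum_left:
  assumes "finite F" "\<And>j. j \<in> F \<Longrightarrow> g j \<in> H" "h \<in> H"
  shows "ip (\<lambda>x. \<Sum>j\<in>F. c j * g j x) h = (\<Sum>j\<in>F. c j * ip (g j) h)"
  using assms
proof (induction F rule: finite_induct)
  case empty
  have "ip (\<lambda>x. 0 * 0) h = 0 * ip (\<lambda>x. 0) h"
    by (rule ip_scale[OF zero_mem \<open>h \<in> H\<close>])
  then show ?case by simp
next
  case (insert a F)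
  then show ?case
    by (simp add: ip_add[OF scale_mem sum_mem] ip_scale)
qed

lemma kernel_hermitian:
  assumes "z \<in> X" "w \<in> X" shows "K z w = cnj (K w z)"
proof -
  have "K z w = ip (kernel_fun X K w) (kernel_fun X K z)"
    using reproducing[OF kernel_mem[OF assms(2)] assms(1)] assms by (simp add: kernel_fun_def)
  moreover have "K w z = ip (kernel_fun X K z) (kernel_fun X K w)"
    using reproducing[OF kernel_mem[OF assms(1)] assms(2)] assms by (simp add: kernel_fun_def)
  ultimately show ?thesis
    using ip_cnj kernel_mem assms by metis
qed

text \<open>Put \<open>S = \<Sum>j\<in>F. w j \<bar>f (z j)\<bar>\<^sup>2\<close> and \<open>g = \<Sum>j\<in>F. w j f (z j) k\<^bsub>z j\<^esub>\<close>. Then \<open>\<langle>g, f\<rangle> = S\<close> by the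
  reproducing property, while Schur's test applied to the Gram matrix gives \<open>\<bar>g\<bar>\<^sup>2 \<le> C S\<close>; expanding
  \<open>0 \<le> \<bar>f - g / C\<bar>\<^sup>2\<close> yields the claim.\<close>

lemma schur_test:
  assumes F: "finite F" "\<And>j. j \<in> F \<Longrightarrow> z j \<in> X" "\<And>j. j \<in> F \<Longrightarrow> 0 \<le> w j" "\<And>j. j \<in> F \<Longrightarrow> 0 < p j"
    and C: "0 < C"
    and schur: "\<And>i. i \<in> F \<Longrightarrow> (\<Sum>j\<in>F. w j * cmod (K (z i) (z j)) * p j) \<le> C * p i"
    and f: "f \<in> H"
  shows "(\<Sum>j\<in>F. w j * (cmod (f (z j)))\<^sup>2) \<le> C * (ip_norm ip f)\<^sup>2"
proof -
  let ?k = "\<lambda>j. kernel_fun X K (z j)"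
  define S where "S = (\<Sum>j\<in>F. w j * (cmod (f (z j)))\<^sup>2)"
  define g where "g = (\<lambda>x. \<Sum>j\<in>F. (of_real (w j) * f (z j)) * ?k j x)"
  have k: "?k j \<in> H" if "j \<in> F" for j
    using that F kernel_mem by simp
  have g: "g \<in> H"
    unfolding g_def by (rule sum_mem) (use F k in auto)
  have ip_k: "ip (?k j) h = cnj (h (z j))" if "j \<in> F" "h \<in> H" for j h
    using reproducing[of h "z j"] ip_cnj[OF \<open>h \<in> H\<close> k[OF \<open>j \<in> F\<close>]] that F by simp
  have gf: "ip g f = of_real S"
  proof -
    have "ip g f = (\<Sum>j\<in>F. of_real (w j) * f (z j) * ip (?k j) f)"
      unfolding g_def by (rule ip_sum_left) (use F k f in auto)
    also have "\<dots> = (\<Sum>j\<in>F. of_real (w j * (cmod (f (z j)))\<^sup>2))"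
      by (rule sum.cong) (simp_all add: ip_k f complex_norm_square del: of_real_power)
    finally show ?thesis by (simp add: S_def)
  qed
  let ?a = "\<lambda>j. cmod (f (z j))" and ?G = "\<lambda>i j. cmod (K (z i) (z j))"
  have gz: "cmod (g (z j)) \<le> (\<Sum>i\<in>F. w i * ?a i * ?G j i)" if "j \<in> F" for j
  proof -
    have "cmod (g (z j)) \<le> (\<Sum>i\<in>F. cmod (of_real (w i) * f (z i) * ?k i (z j)))"
      unfolding g_def by (rule norm_sum)
    also have "\<dots> = (\<Sum>i\<in>F. w i * ?a i * ?G j i)"
      by (rule sum.cong) (use F that in \<open>auto simp: norm_mult kernel_fun_def\<close>)
    finally show ?thesis .
  qed
  have gg: "Re (ip g g) \<le> C * S"
  proof -
    have "ip g g = (\<Sum>j\<in>F. of_real (w j) * f (z j) * ip (?k j) g)"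
      by (subst (1) g_def, rule ip_sum_left) (use F k g in auto)
    also have "cmod \<dots> \<le> (\<Sum>j\<in>F. cmod (of_real (w j) * f (z j) * ip (?k j) g))"
      by (rule norm_sum)
    also have "\<dots> = (\<Sum>j\<in>F. w j * ?a j * cmod (g (z j)))"
      by (rule sum.cong) (use F g in \<open>auto simp: norm_mult ip_k\<close>)
    also have "\<dots> \<le> (\<Sum>j\<in>F. w j * ?a j * (\<Sum>i\<in>F. w i * ?a i * ?G j i))"
      by (intro sum_mono mult_left_mono gz) (use F in auto)
    also have "\<dots> = (\<Sum>j\<in>F. \<Sum>i\<in>F. w j * w i * ?G j i * (?a j * ?a i))"
      by (simp add: sum_distrib_left algebra_simps)
    \<comment> \<open>the arithmetic-geometric mean inequality, weighted by the test vector \<open>p\<close>\<close>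
    also have "\<dots> \<le> (\<Sum>j\<in>F. \<Sum>i\<in>F. w j * w i * ?G j i * ((?a j)\<^sup>2 * (p i / p j) / 2 + (?a i)\<^sup>2 * (p j / p i) / 2))"
    proof (intro sum_mono mult_left_mono)
      fix i j assume ij: "j \<in> F" "i \<in> F"
      have "0 < p i" "0 < p j" using ij F by auto
      then have "0 \<le> (?a j * p i - ?a i * p j)\<^sup>2 / (p i * p j)"
        by simp
      also have "\<dots> = (?a j)\<^sup>2 * (p i / p j) + (?a i)\<^sup>2 * (p j / p i) - 2 * (?a j * ?a i)"
        using \<open>0 < p i\<close> \<open>0 < p j\<close> by (simp add: power2_eq_square field_simps)
      finally have "0 \<le> (?a j)\<^sup>2 * (p i / p j) + (?a i)\<^sup>2 * (p j / p i) - 2 * (?a j * ?a i)" .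
      moreover have "0 \<le> x + y - 2 * t \<Longrightarrow> t \<le> x / 2 + y / 2" for x y t :: real
        by simp
      ultimately show "?a j * ?a i \<le> (?a j)\<^sup>2 * (p i / p j) / 2 + (?a i)\<^sup>2 * (p j / p i) / 2"
        by blast
    qed (use F in auto)
    also have "\<dots> = (\<Sum>j\<in>F. \<Sum>i\<in>F. w j * w i * ?G j i * ((?a j)\<^sup>2 * (p i / p j) / 2))
        + (\<Sum>j\<in>F. \<Sum>i\<in>F. w j * w i * ?G j i * ((?a i)\<^sup>2 * (p j / p i) / 2))"
      by (simp add: sum.distrib distrib_left)
    also have "(\<Sum>j\<in>F. \<Sum>i\<in>F. w j * w i * ?G j i * ((?a i)\<^sup>2 * (p j / p i) / 2))
        = (\<Sum>j\<in>F. \<Sum>i\<in>F. w j * w i * ?G j i * ((?a j)\<^sup>2 * (p i / p j) / 2))"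
    proof (subst sum.swap, intro sum.cong refl)
      fix i j assume "i \<in> F" "j \<in> F"
      then have "?G i j = ?G j i"
        using kernel_hermitian[of "z i" "z j"] F by simp
      then show "w i * w j * ?G i j * ((?a j)\<^sup>2 * (p i / p j) / 2)
          = w j * w i * ?G j i * ((?a j)\<^sup>2 * (p i / p j) / 2)"
        by simp
    qed
    also have "(\<Sum>j\<in>F. \<Sum>i\<in>F. w j * w i * ?G j i * ((?a j)\<^sup>2 * (p i / p j) / 2))
        + (\<Sum>j\<in>F. \<Sum>i\<in>F. w j * w i * ?G j i * ((?a j)\<^sup>2 * (p i / p j) / 2))
        = (\<Sum>j\<in>F. w j * (?a j)\<^sup>2 / p j * (\<Sum>i\<in>F. w i * ?G j i * p i))"
      unfolding sum.distrib[symmetric] sum_distrib_left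
      by (intro sum.cong refl) (simp add: field_simps)
    also have "\<dots> \<le> (\<Sum>j\<in>F. w j * (?a j)\<^sup>2 / p j * (C * p j))"
      by (intro sum_mono mult_left_mono schur) (use F in \<open>auto intro!: divide_nonneg_pos\<close>)
    also have "\<dots> = (\<Sum>j\<in>F. C * (w j * (?a j)\<^sup>2))"
      by (intro sum.cong refl) (use F in \<open>force simp: field_simps\<close>)
    also have "\<dots> = C * S"
      by (simp add: S_def sum_distrib_left)
    finally show ?thesis
      using complex_Re_le_cmod[of "ip g g"] by linarith
  qed
  define t where "t = 1 / C"
  define h where "h = (\<lambda>x. f x + (- of_real t) * g x)"
  have h: "h \<in> H"
    unfolding h_def by (intro add_mem scale_mem f g)
  have left: "ip h u = ip f u - of_real t * ip g u" if "u \<in> H" for u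
    unfolding h_def using that f g scale_mem by (simp only: ip_add ip_scale) simp
  have fg: "ip f g = of_real S"
    using ip_cnj[OF g f] gf by simp
  have fh: "ip f h = of_real (Re (ip f f)) - of_real t * of_real S"
    using ip_cnj[OF h f] left[OF f] gf ip_real[OF f] by (metis complex_cnj_complex_of_real of_real_diff of_real_mult)
  have gh: "ip g h = of_real S - of_real t * of_real (Re (ip g g))"
    using ip_cnj[OF h g] left[OF g] fg ip_real[OF g] by (metis complex_cnj_complex_of_real of_real_diff of_real_mult)
  have "ip h h = of_real (Re (ip f f) - t * S - t * (S - t * Re (ip g g)))"
    unfolding left[OF h] fh gh by simp
  then have "0 \<le> Re (ip f f) - t * S - t * (S - t * Re (ip g g))"
    using ip_nonneg[OF h] by simp
  also have "\<dots> \<le> Re (ip f f) - t * S - t * (S - t * (C * S))"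
    using C by (intro diff_left_mono mult_left_mono gg) (auto simp: t_def)
  also have "\<dots> = Re (ip f f) - S / C"
    using C by (simp add: t_def)
  finally show ?thesis
    using C unfolding ip_norm_squared[OF f] by (simp add: S_def[symmetric] field_simps)
qed

end

lemma suminf_ennreal_le_iff_finite_sums:
  assumes "\<And>n. 0 \<le> a n" "0 \<le> B"
  shows "(\<Sum>n. ennreal (a n)) \<le> ennreal B \<longleftrightarrow> (\<forall>F. finite F \<longrightarrow> sum a F \<le> B)"
proof
  assume L: "(\<Sum>n. ennreal (a n)) \<le> ennreal B"
  show "\<forall>F. finite F \<longrightarrow> sum a F \<le> B"
  proof safe
    fix F :: "nat set" assume "finite F"
    then have "(\<Sum>n\<in>F. ennreal (a n)) \<le> (\<Sum>n. ennreal (a n))"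
      by (intro sum_le_suminf) auto
    then have "ennreal (sum a F) \<le> (\<Sum>n. ennreal (a n))"
      using assms by (simp add: sum_ennreal)
    then show "sum a F \<le> B"
      using L assms by (metis ennreal_le_iff order_trans)
  qed
next
  assume "\<forall>F. finite F \<longrightarrow> sum a F \<le> B"
  then show "(\<Sum>n. ennreal (a n)) \<le> ennreal B"
    using assms by (intro suminf_le_const summableI) (auto simp: sum_ennreal intro!: ennreal_leI)
qed

context hardy_space
begin

lemma continuous_on_mem: "f \<in> H \<Longrightarrow> continuous_on (ball 0 1) f"
  using analytic[of f] unfolding analytic_several_def
  by (meson continuous_at_imp_continuous_on has_derivative_continuous)

text \<open>The constant is taken to be a natural number so that the event below becomes a countable union
  over the constants.\<close>

lemma carleson_sequence_iff_finite_sums: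
  "carleson_sequence (ball 0 1) szego_kernel H ip z \<longleftrightarrow>
    (\<forall>n. z n \<in> ball 0 1) \<and> (\<exists>C::nat. \<forall>f\<in>H. \<forall>F. finite F \<longrightarrow>
      (\<Sum>n\<in>F. (1 - (norm (z n))\<^sup>2) ^ CARD('d) * (cmod (f (z n)))\<^sup>2) \<le> (C * ip_norm ip f)\<^sup>2)"
proof -
  let ?w = "\<lambda>n. (1 - (norm (z n))\<^sup>2) ^ CARD('d)"
  have "carleson_measure (ball 0 1) H ip (sequence_measure (ball 0 1) szego_kernel ip z) \<longleftrightarrow>
    (\<exists>C::nat. \<forall>f\<in>H. \<forall>F. finite F \<longrightarrow> (\<Sum>n\<in>F. ?w n * (cmod (f (z n)))\<^sup>2) \<le> (C * ip_norm ip f)\<^sup>2)"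
    (is "_ \<longleftrightarrow> (\<exists>C::nat. ?P (real C))")
    if z: "\<forall>n. z n \<in> ball 0 1"
  proof -
    have w0: "0 \<le> ?w n" for n
      using z[rule_format, of n] by (simp add: abs_square_le_1)
    have int: "(\<integral>\<^sup>+x\<in>ball 0 1. ennreal ((cmod (f x))\<^sup>2) \<partial>sequence_measure (ball 0 1) szego_kernel ip z)
      = (\<Sum>n. ennreal (?w n * (cmod (f (z n)))\<^sup>2))" if f: "f \<in> H" for f
    proof -
      have m: "(\<lambda>x. ennreal ((cmod (f x))\<^sup>2) * indicator (ball 0 1) x) \<in> borel_measurable borel"
      proof -
        have "(\<lambda>x. indicator (ball 0 1) x *\<^sub>R f x) \<in> borel_measurable borel"
          by (rule borel_measurable_continuous_on_indicator[OF _ continuous_on_mem[OF f]]) simp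
        then have "(\<lambda>x. ennreal ((cmod (indicator (ball 0 1) x *\<^sub>R f x))\<^sup>2)) \<in> borel_measurable borel"
          by measurable
        also have "(\<lambda>x. ennreal ((cmod (indicator (ball 0 1) x *\<^sub>R f x))\<^sup>2))
            = (\<lambda>x. ennreal ((cmod (f x))\<^sup>2) * indicator (ball 0 1) x)"
          by (auto simp: indicator_def)
        finally show ?thesis .
      qed
      have "(\<integral>\<^sup>+x\<in>ball 0 1. ennreal ((cmod (f x))\<^sup>2) \<partial>sequence_measure (ball 0 1) szego_kernel ip z)
        = (\<Sum>n. ennreal (1 / (ip_norm ip (kernel_fun (ball 0 1) szego_kernel (z n)))\<^sup>2)
            * (ennreal ((cmod (f (z n)))\<^sup>2) * indicator (ball 0 1) (z n)))"
        unfolding sequence_measure_def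
        by (subst nn_integral_distr) (auto simp: m nn_integral_density nn_integral_count_space_nat)
      also have "\<dots> = (\<Sum>n. ennreal (?w n * (cmod (f (z n)))\<^sup>2))"
        using z ip_norm_kernel by (simp add: ennreal_mult w0)
      finally show ?thesis .
    qed
    have "carleson_measure (ball 0 1) H ip (sequence_measure (ball 0 1) szego_kernel ip z)
      \<longleftrightarrow> (\<exists>C\<ge>0. ?P C)"
      unfolding carleson_measure_def using int w0
      by (auto simp: suminf_ennreal_le_iff_finite_sums)
    also have "\<dots> \<longleftrightarrow> (\<exists>C::nat. ?P (real C))"
    proof
      assume "\<exists>C\<ge>0. ?P C"
      then obtain C where C: "C \<ge> 0" "?P C" by blast
      obtain n :: nat where n: "C \<le> real n" using real_arch_simple by blast
      have "(C * ip_norm ip f)\<^sup>2 \<le> (real n * ip_norm ip f)\<^sup>2" if "f \<in> H" for f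
        using C n that ip_nonneg[of f] by (intro power_mono mult_right_mono) (auto simp: ip_norm_def)
      with C(2) show "\<exists>C::nat. ?P (real C)" by (meson order_trans)
    qed (meson of_nat_0_le_iff)
    finally show ?thesis .
  qed
  then show ?thesis
    unfolding carleson_sequence_def by blast
qed

text \<open>For a fixed bound, every member of the space imposes a relatively closed condition on the
  sequence, because members of the space are continuous on the ball. So even the uncountable
  intersection over all members is a Borel set of sequences.\<close>

lemma carleson_event_measurable:
  assumes [measurable]: "\<And>n. \<xi> n \<in> borel_measurable M"
  shows "{\<omega> \<in> space M. carleson_sequence (ball 0 1) szego_kernel H ip (\<lambda>n. r n *\<^sub>R \<xi> n \<omega>)} \<in> sets M"
proof -
  define B where "B = {x :: nat \<Rightarrow> complex^'d. \<forall>n. r n *\<^sub>R x n \<in> ball 0 1}"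
  define T where "T C f F = {x \<in> B. (\<Sum>n\<in>F. (1 - (norm (r n *\<^sub>R x n))\<^sup>2) ^ CARD('d)
      * (cmod (f (r n *\<^sub>R x n)))\<^sup>2) \<le> (real C * ip_norm ip f)\<^sup>2}" for C :: nat and f F
  have coord: "continuous_on UNIV (\<lambda>x :: nat \<Rightarrow> complex^'d. r n *\<^sub>R x n)" for n
    by (intro continuous_intros continuous_on_product_coordinates)
  have B: "B \<in> sets borel"
  proof -
    have "B = (\<Inter>n. (\<lambda>x. r n *\<^sub>R x n) -` ball 0 1)"
      by (auto simp: B_def)
    also have "\<dots> \<in> sets borel"
      using borel_open[OF open_vimage[OF open_ball coord]] by (intro sets.countable_INT) auto
    finally show ?thesis .
  qed
  have closed: "closedin (top_of_set B) (T C f F)" if "f \<in> H" for C f F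
  proof -
    have "continuous_on B (\<lambda>x. f (r n *\<^sub>R x n))" for n
      by (rule continuous_on_compose2[OF continuous_on_mem[OF that] continuous_on_subset[OF coord]])
         (auto simp: B_def)
    then have "continuous_on B (\<lambda>x. \<Sum>n\<in>F. (1 - (norm (r n *\<^sub>R x n))\<^sup>2) ^ CARD('d) * (cmod (f (r n *\<^sub>R x n)))\<^sup>2)"
      by (intro continuous_intros continuous_on_subset[OF coord]) auto
    from continuous_closedin_preimage[OF this, of "{..(real C * ip_norm ip f)\<^sup>2}"]
    show ?thesis
      by (simp add: T_def vimage_def Int_def)
  qed
  define G where "G C = (\<Inter>p\<in>H \<times> {F. finite F}. T C (fst p) (snd p))" for C
  have G: "G C \<in> sets borel" for C
  proof -
    have "H \<times> {F. finite F} \<noteq> ({} :: ((complex^'d \<Rightarrow> complex) \<times> nat set) set)"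
      using zero_mem by blast
    then have "closedin (top_of_set B) (G C)"
      unfolding G_def by (intro closedin_INT) (auto intro!: closed)
    then obtain Q where "closed Q" "G C = B \<inter> Q"
      by (auto simp: closedin_closed)
    then show ?thesis
      using B by auto
  qed
  have G_iff: "x \<in> G C \<longleftrightarrow> (\<forall>n. r n *\<^sub>R x n \<in> ball 0 1) \<and> (\<forall>f\<in>H. \<forall>F. finite F \<longrightarrow>
      (\<Sum>n\<in>F. (1 - (norm (r n *\<^sub>R x n))\<^sup>2) ^ CARD('d) * (cmod (f (r n *\<^sub>R x n)))\<^sup>2)
        \<le> (real C * ip_norm ip f)\<^sup>2)" for x C
  proof -
    have "x \<in> G C \<longleftrightarrow> (\<forall>f\<in>H. \<forall>F. finite F \<longrightarrow> x \<in> T C f F)"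
      unfolding G_def INT_iff by (simp only: Ball_def mem_Times_iff mem_Collect_eq split_paired_All fst_conv snd_conv) blast
    also have "\<dots> \<longleftrightarrow> x \<in> B \<and> (\<forall>f\<in>H. \<forall>F. finite F \<longrightarrow>
      (\<Sum>n\<in>F. (1 - (norm (r n *\<^sub>R x n))\<^sup>2) ^ CARD('d) * (cmod (f (r n *\<^sub>R x n)))\<^sup>2)
        \<le> (real C * ip_norm ip f)\<^sup>2)"
      unfolding T_def mem_Collect_eq using zero_mem finite.emptyI by blast
    finally show ?thesis
      unfolding B_def mem_Collect_eq .
  qed
  have "(\<lambda>\<omega>. \<lambda>n. \<xi> n \<omega>) \<in> borel_measurable M"
    by (rule measurable_coordinatewise_then_product) simp
  moreover have "(\<Union>C. G C) \<in> sets borel"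
    using G by auto
  ultimately have "(\<lambda>\<omega>. \<lambda>n. \<xi> n \<omega>) -` (\<Union>C. G C) \<inter> space M \<in> sets M"
    by (rule measurable_sets)
  also have "(\<lambda>\<omega>. \<lambda>n. \<xi> n \<omega>) -` (\<Union>C. G C) \<inter> space M
    = {\<omega> \<in> space M. carleson_sequence (ball 0 1) szego_kernel H ip (\<lambda>n. r n *\<^sub>R \<xi> n \<omega>)}"
    unfolding carleson_sequence_iff_finite_sums by (simp only: vimage_def UN_iff G_iff) blast
  finally show ?thesis .
qed

text \<open>Test the Carleson inequality on the kernel at one point of the cluster: every point of the
  cluster contributes at least \<open>a ^ d / Q ^ (2 * d)\<close> to the left-hand side, and the squared norm of the
  kernel is at most \<open>1 / a ^ d\<close>.\<close>

lemma carleson_cluster_bound: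
  assumes C: "\<And>f F. f \<in> H \<Longrightarrow> finite F \<Longrightarrow>
      (\<Sum>n\<in>F. (1 - (norm (z n))\<^sup>2) ^ CARD('d) * (cmod (f (z n)))\<^sup>2) \<le> (C * ip_norm ip f)\<^sup>2"
    and ball: "\<And>n. z n \<in> ball 0 1"
    and J: "finite J" "i \<in> J" "\<And>j. j \<in> J \<Longrightarrow> quasi_dist (z j) (z i) \<le> Q"
      "\<And>j. j \<in> J \<Longrightarrow> a \<le> 1 - norm (z j)" and a: "0 < a"
  shows "real (card J) \<le> C\<^sup>2 * (Q / a) ^ (2 * CARD('d))"
proof -
  let ?d = "CARD('d)"
  let ?w = "\<lambda>n. (1 - (norm (z n))\<^sup>2) ^ ?d"
  let ?k = "kernel_fun (ball 0 1) szego_kernel (z i)"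
  have a_le: "a \<le> 1 - (norm (z j))\<^sup>2" if "j \<in> J" for j
  proof -
    have "(norm (z j))\<^sup>2 \<le> norm (z j)"
      using ball[of j] by (simp add: power2_eq_square mult_left_le_one_le)
    then show ?thesis using J(4)[OF that] by linarith
  qed
  have a_w: "a ^ ?d \<le> ?w j" if "j \<in> J" for j
    using a_le[OF that] a by (intro power_mono) auto
  have q_pos: "0 < quasi_dist (z j) (z i)" if "j \<in> J" for j
  proof -
    have "norm (z j) * norm (z i) \<le> norm (z j)"
      using ball[of i] by (simp add: mult_left_le)
    then show ?thesis
      using quasi_dist_ge[of "z j" "z i"] ball[of i] ball[of j] by simp
  qed
  have Q: "0 < Q"
    using q_pos[OF J(2)] J(3)[OF J(2)] by linarith
  have "real (card J) * (a ^ ?d * (1 / Q ^ ?d)\<^sup>2) = (\<Sum>j\<in>J. a ^ ?d * (1 / Q ^ ?d)\<^sup>2)"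
    by simp
  also have "\<dots> \<le> (\<Sum>j\<in>J. ?w j * (cmod (?k (z j)))\<^sup>2)"
  proof (intro sum_mono mult_mono a_w)
    fix j assume j: "j \<in> J"
    have "1 / Q ^ ?d \<le> 1 / quasi_dist (z j) (z i) ^ ?d"
      using q_pos[OF j] J(3)[OF j] Q by (intro divide_left_mono power_mono mult_pos_pos) auto
    then have "1 / Q ^ ?d \<le> cmod (?k (z j))"
      using ball by (simp add: kernel_fun_def norm_szego_kernel)
    then show "(1 / Q ^ ?d)\<^sup>2 \<le> (cmod (?k (z j)))\<^sup>2"
      using Q by (intro power_mono) auto
    show "0 \<le> ?w j"
      using a_w[OF j] a by (meson order_trans zero_le_power less_imp_le)
  qed (use Q in auto)
  also have "\<dots> \<le> (C * ip_norm ip ?k)\<^sup>2"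
    by (rule C) (use kernel_mem ball J in auto)
  also have "\<dots> = C\<^sup>2 / ?w i"
    unfolding ip_norm_kernel[OF ball, symmetric] by (simp add: power_mult_distrib)
  also have "\<dots> \<le> C\<^sup>2 / a ^ ?d"
    using a_w[OF J(2)] a by (intro divide_left_mono mult_pos_pos) (auto intro: less_le_trans[rotated])
  finally show ?thesis
    using a Q by (simp add: field_simps power_mult power_even_eq power2_eq_square power_divide)
qed

end

section \<open>From box counts to the Carleson property\<close>

lemma exists_dyadic_level:
  fixes y :: real
  assumes "0 < y" "y < 1"
  obtains m where "(1/2) ^ (m + 1) \<le> y" "y < (1/2) ^ m"
proof -
  obtain n where n: "(1/2) ^ n < y"
    using real_arch_pow_inv[of y "1/2"] assms by auto
  define m where "m = (LEAST m. (1/2) ^ (m + 1) \<le> y)"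
  have "(1/2) ^ (n + 1) \<le> y"
    by (rule order.trans[OF power_decreasing less_imp_le[OF n]]) auto
  then have m: "(1/2) ^ (m + 1) \<le> y"
    unfolding m_def by (rule LeastI)
  moreover have "y < (1/2) ^ m"
  proof (cases m)
    case (Suc k)
    then have "\<not> (1/2) ^ (k + 1) \<le> y"
      using not_less_Least[of k "\<lambda>m. (1/2) ^ (m + 1) \<le> y"] by (simp add: m_def)
    then show ?thesis by (simp add: Suc)
  qed (use assms in simp)
  ultimately show ?thesis by (rule that)
qed

lemma dyadic_level_unique:
  fixes y :: real
  assumes "(1/2) ^ (m + 1) \<le> y" "y < (1/2) ^ m" "(1/2) ^ (n + 1) \<le> y" "y < (1/2) ^ n"
  shows "m = n"
proof -
  have "\<not> a < b" if "(1/2) ^ (a + 1) \<le> y" "y < (1/2) ^ b" for a b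
  proof
    assume "a < b"
    then have "(1/2) ^ b \<le> (1/2 :: real) ^ (a + 1)"
      by (intro power_decreasing) auto
    with that show False by linarith
  qed
  then show ?thesis
    using assms by (meson linorder_neqE_nat)
qed

lemma exists_level:
  assumes "\<And>n. 0 < r n \<and> r n < 1"
  obtains lev where "\<And>n m. n \<in> dyadic_indices r m \<longleftrightarrow> lev n = m"
proof -
  have "\<exists>m. n \<in> dyadic_indices r m" for n
    using exists_dyadic_level[of "1 - r n"] assms[of n] unfolding dyadic_indices_def by auto
  then obtain lev where lev: "\<And>n. n \<in> dyadic_indices r (lev n)" by metis
  have "n \<in> dyadic_indices r m \<longleftrightarrow> lev n = m" for n m
    using lev[of n] dyadic_level_unique[of m "1 - r n" "lev n"] unfolding dyadic_indices_def by auto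
  then show ?thesis by (rule that)
qed

text \<open>A single term, with \<open>2 ^ -l \<le> q \<le> 2 * 2 ^ -l\<close>, already suffices. The sum over all scales has
  the advantage that the scale does not depend on \<open>q\<close>, so that summing over points turns the
  conditions into box counts.\<close>

lemma inverse_power_le_dyadic_sum:
  fixes q :: real
  assumes "(1/2) ^ (k + 1) \<le> q" "q \<le> 2"
  shows "1 / q ^ d \<le> (\<Sum>l\<le>k + 1. if q \<le> 2 * (1/2) ^ l then (2 ^ d) ^ l else 0)"
proof -
  define l where "l = (LEAST l. (1/2) ^ l \<le> q)"
  have l: "(1/2) ^ l \<le> q" "l \<le> k + 1"
    unfolding l_def by (rule LeastI[of _ "k + 1"], rule assms(1)) (rule Least_le, rule assms(1))
  have q: "q \<le> 2 * (1/2) ^ l"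
  proof (cases l)
    case (Suc j)
    then have "\<not> (1/2) ^ j \<le> q"
      using not_less_Least[of j "\<lambda>l. (1/2) ^ l \<le> q"] by (simp add: l_def)
    then show ?thesis by (simp add: Suc)
  qed (use assms in simp)
  have "0 < q" using l(1) by (meson less_le_trans zero_less_power half_gt_zero zero_less_one)
  have "1 / q ^ d \<le> 1 / ((1/2) ^ l) ^ d"
    using l(1) \<open>0 < q\<close> by (intro divide_left_mono power_mono) auto
  also have "\<dots> = (2 ^ d) ^ l"
    by (simp add: power_divide power_mult[symmetric] mult.commute)
  also have "\<dots> = (if q \<le> 2 * (1/2) ^ l then (2 ^ d) ^ l else 0)"
    using q by simp
  also have "\<dots> \<le> (\<Sum>l\<le>k + 1. if q \<le> 2 * (1/2) ^ l then (2 ^ d) ^ l else 0)"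
    by (rule member_le_sum) (use l in auto)
  finally show ?thesis .
qed

text \<open>The double sum that comes out of Schur's test. The first summand is geometric in \<open>m\<close> beyond
  \<open>l\<close> with ratio \<open>b / D\<close>, leaving the sum of \<open>b ^ l\<close> over \<open>l \<le> n + 1\<close>; the second converges.\<close>

lemma schur_double_sum:
  fixes b D :: real
  assumes b: "1 < b" "b < D"
  obtains S where "0 < S" "\<And>n N. (\<Sum>m\<le>N. \<Sum>l\<le>min n m + 1. (b / D) ^ m * D ^ l + (1 / b) ^ m) \<le> S * b ^ n"
proof -
  define \<rho> where "\<rho> = b / D"
  have \<rho>: "0 < \<rho>" "\<rho> < 1" and rD: "\<rho> * D = b" using b by (auto simp: \<rho>_def)
  define S2 where "S2 = (\<Sum>m. (real m + 2) * (1 / b) ^ m)"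
  have summ: "summable (\<lambda>m. (real m + 2) * (1 / b) ^ m)"
  proof -
    have c: "norm (1 / b) < 1" using b by simp
    have "summable (\<lambda>m. of_nat (Suc m) * (1 / b) ^ m + (1 / b) ^ m)"
      by (intro summable_add summable_geometric c sums_summable[OF geometric_deriv_sums[OF c]])
    then show ?thesis by (simp add: algebra_simps)
  qed
  define S where "S = b\<^sup>2 / ((b - 1) * \<rho> * (1 - \<rho>)) + S2"
  show ?thesis
  proof (rule that)
    have "0 \<le> S2" unfolding S2_def using b by (intro suminf_nonneg summ) auto
    then show "0 < S" unfolding S_def using b \<rho> by (simp add: add_pos_nonneg)
    fix n N
    have inner: "(\<Sum>m\<le>N. if l \<le> m + 1 then \<rho> ^ m else 0) \<le> \<rho> ^ l / (\<rho> * (1 - \<rho>))" for l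
    proof -
      have "\<rho> * (\<Sum>m\<le>N. if l \<le> m + 1 then \<rho> ^ m else 0) = (\<Sum>m\<in>{m. m \<le> N \<and> l \<le> m + 1}. \<rho> ^ Suc m)"
        unfolding sum_distrib_left by (intro sum.mono_neutral_cong_right) auto
      also have "\<dots> = (\<Sum>k\<in>Suc ` {m. m \<le> N \<and> l \<le> m + 1}. \<rho> ^ k)"
        by (subst sum.reindex) auto
      also have "\<dots> \<le> (\<Sum>k=l..Suc N. \<rho> ^ k)"
        by (rule sum_mono2) (use \<rho> in auto)
      also have "\<dots> \<le> \<rho> ^ l / (1 - \<rho>)"
        unfolding sum_gp using \<rho> by (auto simp del: power_Suc intro!: divide_right_mono)
      finally show ?thesis
        using \<rho> by (simp add: field_simps)
    qed
    have "(\<Sum>m\<le>N. \<Sum>l\<le>min n m + 1. \<rho> ^ m * D ^ l)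
        = (\<Sum>m\<le>N. \<Sum>l\<le>n + 1. D ^ l * (if l \<le> m + 1 then \<rho> ^ m else 0))"
    proof (rule sum.cong[OF refl])
      fix m
      show "(\<Sum>l\<le>min n m + 1. \<rho> ^ m * D ^ l) = (\<Sum>l\<le>n + 1. D ^ l * (if l \<le> m + 1 then \<rho> ^ m else 0))"
        by (intro sum.mono_neutral_cong_left) auto
    qed
    also have "\<dots> = (\<Sum>l\<le>n + 1. D ^ l * (\<Sum>m\<le>N. if l \<le> m + 1 then \<rho> ^ m else 0))"
      by (subst sum.swap) (simp add: sum_distrib_left)
    also have "\<dots> \<le> (\<Sum>l\<le>n + 1. D ^ l * (\<rho> ^ l / (\<rho> * (1 - \<rho>))))"
      using b by (intro sum_mono mult_left_mono inner) auto
    also have "\<dots> = (\<Sum>l\<le>n + 1. b ^ l) / (\<rho> * (1 - \<rho>))"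
      by (simp add: sum_divide_distrib power_mult_distrib[symmetric] mult.commute[of D] rD del: sum.atMost_Suc)
    also have "(\<Sum>l\<le>n + 1. b ^ l) \<le> b ^ (n + 2) / (b - 1)"
      using b sum_gp0[of b "n + 1"] by (simp add: field_simps del: sum.atMost_Suc)
    finally have 1: "(\<Sum>m\<le>N. \<Sum>l\<le>min n m + 1. \<rho> ^ m * D ^ l)
        \<le> b ^ (n + 2) / (b - 1) / (\<rho> * (1 - \<rho>))"
      using \<rho> by (simp add: divide_right_mono)
    have "(\<Sum>m\<le>N. \<Sum>l\<le>min n m + 1. (1 / b) ^ m) \<le> (\<Sum>m\<le>N. (real m + 2) * (1 / b) ^ m)"
      using b by (intro sum_mono) (auto intro!: mult_right_mono)
    also have "\<dots> \<le> S2"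
      unfolding S2_def using b by (intro sum_le_suminf summ) auto
    also have "\<dots> \<le> S2 * b ^ n"
      using \<open>0 \<le> S2\<close> b by (simp add: mult_le_cancel_left1)
    finally have 2: "(\<Sum>m\<le>N. \<Sum>l\<le>min n m + 1. (1 / b) ^ m) \<le> S2 * b ^ n" .
    have "b ^ (n + 2) / (b - 1) / (\<rho> * (1 - \<rho>)) = b\<^sup>2 / ((b - 1) * \<rho> * (1 - \<rho>)) * b ^ n"
      by (simp add: power_add power2_eq_square)
    with 1 2 show "(\<Sum>m\<le>N. \<Sum>l\<le>min n m + 1. (b / D) ^ m * D ^ l + (1 / b) ^ m) \<le> S * b ^ n"
      unfolding \<rho>_def[symmetric] sum.distrib S_def by (simp add: distrib_right)
  qed
qed

context hardy_space
begin

text \<open>Schur's test with the test vector \<open>b ^ m\<close> on the points of level \<open>m\<close>. The number of boxes of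
  scale \<open>2 ^ -m\<close> in one of scale \<open>2 ^ -l\<close> is of order \<open>D ^ (m - l)\<close>, where \<open>D = 2 ^ d\<close>. A box may be
  filled up to this number reduced by the factor \<open>b ^ (2 * m)\<close>; one factor \<open>b ^ m\<close> compensates the
  growth of the test vector and the other one makes the sum over \<open>m\<close> converge.\<close>

lemma carleson_of_box_counts:
  fixes z :: "nat \<Rightarrow> complex^'d" and lev :: "nat \<Rightarrow> nat"
  assumes lev: "\<And>n. (1/2) ^ (lev n + 1) \<le> 1 - norm (z n)" "\<And>n. 1 - norm (z n) < (1/2) ^ lev n"
    and b: "1 < b" "b < 2 ^ CARD('d)" and A: "0 < A"
    and fin: "\<And>m. finite {j. lev j = m}"
    and count: "\<And>i m l. l \<le> m + 1 \<Longrightarrow> card {j. lev j = m \<and> quasi_dist (z i) (z j) \<le> 2 * (1/2) ^ l}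
      \<le> A * (1 + (2 ^ CARD('d)) ^ m / (2 ^ CARD('d)) ^ l / b ^ (2 * m))"
  shows "carleson_sequence (ball 0 1) szego_kernel H ip z"
proof -
  define D :: real where "D = 2 ^ CARD('d)"
  have D: "1 < D" "b < D" unfolding D_def using b by auto
  obtain S where S: "0 < S"
    "\<And>n N. (\<Sum>m\<le>N. \<Sum>l\<le>min n m + 1. (b / D) ^ m * D ^ l + (1 / b) ^ m) \<le> S * b ^ n"
    using schur_double_sum[OF b(1) D(2)] by blast
  have norm1: "norm (z n) < 1" for n
  proof -
    have "(0 :: real) < (1/2) ^ (lev n + 1)" by simp
    then show ?thesis using lev(1)[of n] by linarith
  qed
  then have ball: "z n \<in> ball 0 1" for n
    by simp
  let ?w = "\<lambda>n. (1 - (norm (z n))\<^sup>2) ^ CARD('d)"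
  have w0: "0 \<le> ?w n" for n
    using norm1[of n] by (simp add: abs_square_le_1)
  have w: "?w n \<le> D * (1 / D) ^ lev n" for n
  proof -
    have "1 - (norm (z n))\<^sup>2 = (1 - norm (z n)) * (1 + norm (z n))"
      by (simp add: power2_eq_square algebra_simps)
    also have "\<dots> \<le> (1/2) ^ lev n * 2"
      using norm1[of n] lev(2)[of n] by (intro mult_mono) auto
    finally have "?w n \<le> ((1/2) ^ lev n * 2) ^ CARD('d)"
      using norm1[of n] by (intro power_mono) (auto simp: abs_square_le_1)
    also have "\<dots> = D * (1 / D) ^ lev n"
      by (simp add: D_def power_mult_distrib power_divide power_mult[symmetric] mult.commute)
    finally show ?thesis .
  qed
  have ker: "cmod (szego_kernel (z i) (z j))
      \<le> (\<Sum>l\<le>min (lev i) (lev j) + 1. if quasi_dist (z i) (z j) \<le> 2 * (1/2) ^ l then D ^ l else 0)" for i j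
  proof -
    have "norm (z i) * norm (z j) \<le> norm (z i)" "norm (z i) * norm (z j) \<le> norm (z j)"
      using norm1[of i] norm1[of j] by (auto simp: mult_left_le mult_left_le_one_le)
    then have "(1/2) ^ (lev i + 1) \<le> quasi_dist (z i) (z j)" "(1/2) ^ (lev j + 1) \<le> quasi_dist (z i) (z j)"
      using quasi_dist_ge[of "z i" "z j"] lev(1)[of i] lev(1)[of j] norm1[of i] norm1[of j] by auto
    then have "(1/2) ^ (min (lev i) (lev j) + 1) \<le> quasi_dist (z i) (z j)"
      by (simp add: min_def)
    from inverse_power_le_dyadic_sum[OF this quasi_dist_le_2]
    show ?thesis
      using norm1[of i] norm1[of j] unfolding norm_szego_kernel D_def by simp
  qed
  have schur: "(\<Sum>j\<in>F. ?w j * cmod (szego_kernel (z i) (z j)) * b ^ lev j) \<le> D * A * S * b ^ lev i"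
    if F: "finite F" for F i
  proof -
    let ?n = "lev i" and ?q = "\<lambda>j. quasi_dist (z i) (z j)"
    define N where "N = Max (insert 0 (lev ` F))"
    have N: "lev j \<le> N" if "j \<in> F" for j
      unfolding N_def using F that by (intro Max_ge) auto
    have "(\<Sum>j\<in>F. ?w j * cmod (szego_kernel (z i) (z j)) * b ^ lev j)
      \<le> (\<Sum>j\<in>F. D * (1 / D) ^ lev j * (\<Sum>l\<le>min ?n (lev j) + 1. if ?q j \<le> 2 * (1/2) ^ l then D ^ l else 0) * b ^ lev j)"
      using b D by (intro sum_mono mult_right_mono mult_mono w ker) auto
    also have "\<dots> = (\<Sum>j\<in>F. \<Sum>l\<le>min ?n (lev j) + 1. D * (b / D) ^ lev j * D ^ l * (if ?q j \<le> 2 * (1/2) ^ l then 1 else 0))"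
      by (simp only: sum_distrib_left sum_distrib_right)
         (intro sum.cong refl, simp add: power_divide)
    also have "\<dots> = (\<Sum>m\<le>N. \<Sum>j\<in>{j \<in> F. lev j = m}. \<Sum>l\<le>min ?n (lev j) + 1.
        D * (b / D) ^ lev j * D ^ l * (if ?q j \<le> 2 * (1/2) ^ l then 1 else 0))"
      by (rule sum.group[symmetric]) (use F N in auto)
    also have "\<dots> = (\<Sum>m\<le>N. \<Sum>l\<le>min ?n m + 1. D * (b / D) ^ m * D ^ l
        * (\<Sum>j\<in>{j \<in> F. lev j = m}. if ?q j \<le> 2 * (1/2) ^ l then 1 else 0))"
    proof (rule sum.cong[OF refl])
      fix m
      have "(\<Sum>j\<in>{j \<in> F. lev j = m}. \<Sum>l\<le>min ?n (lev j) + 1.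
        D * (b / D) ^ lev j * D ^ l * (if ?q j \<le> 2 * (1/2) ^ l then 1 else 0))
        = (\<Sum>j\<in>{j \<in> F. lev j = m}. \<Sum>l\<le>min ?n m + 1.
        D * (b / D) ^ m * D ^ l * (if ?q j \<le> 2 * (1/2) ^ l then 1 else 0))"
        by (rule sum.cong) auto
      then show "(\<Sum>j\<in>{j \<in> F. lev j = m}. \<Sum>l\<le>min ?n (lev j) + 1.
        D * (b / D) ^ lev j * D ^ l * (if ?q j \<le> 2 * (1/2) ^ l then 1 else 0))
        = (\<Sum>l\<le>min ?n m + 1. D * (b / D) ^ m * D ^ l
        * (\<Sum>j\<in>{j \<in> F. lev j = m}. if ?q j \<le> 2 * (1/2) ^ l then 1 else 0))"
        by (subst (asm) sum.swap) (simp add: sum_distrib_left)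
    qed
    also have "\<dots> \<le> (\<Sum>m\<le>N. \<Sum>l\<le>min ?n m + 1. D * (b / D) ^ m * D ^ l * (A * (1 + D ^ m / D ^ l / b ^ (2 * m))))"
    proof (intro sum_mono mult_left_mono)
      fix m l assume "l \<in> {..min ?n m + 1}"
      then have l: "l \<le> m + 1" by simp
      have "(\<Sum>j\<in>{j \<in> F. lev j = m}. if ?q j \<le> 2 * (1/2) ^ l then 1 else 0 :: real)
          = real (card {j \<in> F. lev j = m \<and> ?q j \<le> 2 * (1/2) ^ l})"
        using F by (simp add: sum.If_cases Int_def conj_commute conj_left_commute)
      also have "\<dots> \<le> real (card {j. lev j = m \<and> ?q j \<le> 2 * (1/2) ^ l})"
        by (intro of_nat_mono card_mono finite_subset[OF _ fin[of m]]) auto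
      also have "\<dots> \<le> A * (1 + D ^ m / D ^ l / b ^ (2 * m))"
        unfolding D_def by (rule count[OF l])
      finally show "(\<Sum>j\<in>{j \<in> F. lev j = m}. if ?q j \<le> 2 * (1/2) ^ l then 1 else 0 :: real)
        \<le> A * (1 + D ^ m / D ^ l / b ^ (2 * m))" .
    qed (use b D in auto)
    also have "\<dots> = (\<Sum>m\<le>N. \<Sum>l\<le>min ?n m + 1. D * A * ((b / D) ^ m * D ^ l + (1 / b) ^ m))"
      using b D by (intro sum.cong refl) (simp add: field_simps power_mult power2_eq_square power_mult_distrib)
    also have "\<dots> = D * A * (\<Sum>m\<le>N. \<Sum>l\<le>min ?n m + 1. (b / D) ^ m * D ^ l + (1 / b) ^ m)"
      by (simp only: sum_distrib_left)
    also have "\<dots> \<le> D * A * (S * b ^ ?n)"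
      using A D by (intro mult_left_mono S) auto
    finally show ?thesis by (simp only: mult.assoc)
  qed
  define C where "C = D * A * S"
  have C: "0 < C" unfolding C_def using D A S by simp
  obtain N :: nat where N: "max 1 C \<le> real N"
    using real_arch_simple by blast
  have "(\<Sum>n\<in>F. ?w n * (cmod (f (z n)))\<^sup>2) \<le> (real N * ip_norm ip f)\<^sup>2" if "f \<in> H" "finite F" for f F
  proof -
    have "(\<Sum>n\<in>F. ?w n * (cmod (f (z n)))\<^sup>2) \<le> C * (ip_norm ip f)\<^sup>2"
    proof (rule schur_test)
      show "0 < b ^ lev j" for j using b by simp
      show "(\<Sum>j\<in>F. ?w j * cmod (szego_kernel (z i) (z j)) * b ^ lev j) \<le> C * b ^ lev i" for i
        unfolding C_def by (rule schur[OF \<open>finite F\<close>])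
    qed (use that ball w0 C in auto)
    also have "\<dots> \<le> (real N)\<^sup>2 * (ip_norm ip f)\<^sup>2"
    proof (intro mult_right_mono)
      have "C * 1 \<le> real N * real N" using N C by (intro mult_mono) auto
      then show "C \<le> (real N)\<^sup>2" by (simp add: power2_eq_square)
    qed auto
    finally show ?thesis by (simp add: power_mult_distrib)
  qed
  then show ?thesis
    unfolding carleson_sequence_iff_finite_sums using ball by blast
qed

text \<open>If the box around \<open>z i\<close> contains any point \<open>z k\<close> of the level \<open>m\<close>, then the box of comparable
  size around \<open>z k\<close> contains all of them. So it suffices to count points of level \<open>m\<close> around points
  of the same level; this is what makes a union bound over the centres affordable.\<close>

lemma carleson_of_cap_counts:
  fixes x :: "nat \<Rightarrow> complex^'d"
  assumes r: "\<And>n. 0 < r n \<and> r n < 1" and x: "\<And>n. norm (x n) = 1"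
    and b: "1 < b" "b < 2 ^ CARD('d)" and A: "1 \<le> A"
    and fin: "\<And>m. finite (dyadic_indices r m)"
    and count: "\<And>k m l. l \<le> m + 1 \<Longrightarrow> k \<in> dyadic_indices r m \<Longrightarrow>
      card {j \<in> dyadic_indices r m - {k}. quasi_dist (x j) (x k) < 25 * (1/2) ^ l}
      \<le> A * (1 + (2 ^ CARD('d)) ^ m / (2 ^ CARD('d)) ^ l / b ^ (2 * m))"
  shows "carleson_sequence (ball 0 1) szego_kernel H ip (\<lambda>n. r n *\<^sub>R x n)"
proof -
  obtain lev where lev: "\<And>n m. n \<in> dyadic_indices r m \<longleftrightarrow> lev n = m"
    using exists_level[of r, OF r] by metis
  have shell: "dyadic_indices r m = {j. lev j = m}" for m
    using lev by auto
  let ?z = "\<lambda>n. r n *\<^sub>R x n"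
  have nz: "norm (?z n) = r n" for n using r[of n] x by simp
  have n1: "norm (?z n) \<le> 1" for n using r[of n] nz[of n] by simp
  show ?thesis
  proof (rule carleson_of_box_counts[of lev _ b "2 * A"])
    show "(1/2) ^ (lev n + 1) \<le> 1 - norm (?z n)" "1 - norm (?z n) < (1/2) ^ lev n" for n
      using lev[of n "lev n"] unfolding nz dyadic_indices_def by auto
    show "finite {j. lev j = m}" for m
      using fin[of m] by (simp add: shell)
    fix i m l :: nat assume l: "l \<le> m + 1"
    define E where "E = {j. lev j = m \<and> quasi_dist (?z i) (?z j) \<le> 2 * (1/2) ^ l}"
    let ?R = "A * (1 + (2 ^ CARD('d)) ^ m / (2 ^ CARD('d)) ^ l / b ^ (2 * m))"
    have R: "1 \<le> ?R"
      using A b by (simp add: mult_le_cancel_left1 distrib_left add_increasing2)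
    have "real (card E) \<le> 2 * ?R"
    proof (cases "E = {}")
      case True then show ?thesis using R by simp
    next
      case False
      then obtain k where k: "k \<in> E" by blast
      \<comment> \<open>the radial projection costs a factor 2, and the triangle inequality through \<open>z i\<close> a factor 3\<close>
      have "E - {k} \<subseteq> {j \<in> dyadic_indices r m - {k}. quasi_dist (x j) (x k) < 25 * (1/2) ^ l}"
      proof safe
        fix j assume j: "j \<in> E"
        show "j \<in> dyadic_indices r m" using j by (simp add: E_def shell)
        have "quasi_dist (x j) (x k) \<le> 2 * quasi_dist (?z j) (?z k)"
          using quasi_dist_radial(1)[of "x j" "x k" "r j" "r k"] x r[of j] r[of k] by simp
        also have "\<dots> \<le> 2 * (3 * (quasi_dist (?z j) (?z i) + quasi_dist (?z i) (?z k)))"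
          by (intro mult_left_mono quasi_dist_triangle n1) auto
        also have "\<dots> \<le> 24 * (1/2) ^ l"
          using j k quasi_dist_commute[of "?z j" "?z i"] by (simp add: E_def)
        also have "\<dots> < 25 * (1/2) ^ l"
          by simp
        finally show "quasi_dist (x j) (x k) < 25 * (1/2) ^ l" .
      qed
      then have "card (E - {k}) \<le> card {j \<in> dyadic_indices r m - {k}. quasi_dist (x j) (x k) < 25 * (1/2) ^ l}"
        by (intro card_mono finite_subset[OF _ fin[of m]]) auto
      moreover have "card E \<le> 1 + card (E - {k})"
        by (simp add: card_Diff_singleton k) 
      moreover have "k \<in> dyadic_indices r m" using k by (simp add: E_def shell)
      ultimately show ?thesis
        using count[OF l, of k] R by linarith
    qed
    then show "real (card {j. lev j = m \<and> quasi_dist (?z i) (?z j) \<le> 2 * (1/2) ^ l})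
      \<le> 2 * A * (1 + (2 ^ CARD('d)) ^ m / (2 ^ CARD('d)) ^ l / b ^ (2 * m))"
      unfolding E_def by (simp only: mult.assoc)
  qed (use b A in auto)
qed

end

section \<open>Almost sure box counts\<close>

text \<open>Conditionally on the value at the centre \<open>i\<close>, the events that the other points fall in its
  neighbourhood are independent.\<close>

lemma (in prob_space) prob_all_related_le:
  assumes indep: "indep_vars (\<lambda>_. N) X I" and J: "finite J" "i \<notin> J" "insert i J \<subseteq> I"
    and distr: "\<And>j. j \<in> insert i J \<Longrightarrow> distr M N (X j) = \<nu>"
    and R: "Measurable.pred (N \<Otimes>\<^sub>M N) (\<lambda>(x, y). R x y)"
    and p: "0 \<le> p" "AE x in \<nu>. emeasure \<nu> {y \<in> space N. R x y} \<le> ennreal p"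
  shows "prob {\<omega> \<in> space M. \<forall>j\<in>J. R (X i \<omega>) (X j \<omega>)} \<le> p ^ card J"
proof -
  let ?K = "insert i J"
  have indK: "indep_vars (\<lambda>_. N) X ?K"
    using indep_vars_subset[OF indep J(3)] .
  have rv [measurable]: "X j \<in> measurable M N" if "j \<in> ?K" for j
    using indK that by (auto simp: indep_vars_def)
  have sets_\<nu> [measurable_cong, simp]: "sets \<nu> = sets N"
    using distr[of i] by auto
  have space_\<nu> [simp]: "space \<nu> = space N"
    by (rule sets_eq_imp_space_eq) simp
  interpret \<nu>: prob_space \<nu>
    using distr[of i] prob_space_distr[of "X i" N] rv[of i] by auto
  interpret P: product_sigma_finite "\<lambda>_. \<nu>"
    by standard
  have "distr M (PiM ?K (\<lambda>_. N)) (\<lambda>\<omega>. \<lambda>k\<in>?K. X k \<omega>) = PiM ?K (\<lambda>k. distr M N (X k))"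
    using indK by (subst (asm) indep_vars_iff_distr_eq_PiM') (auto intro: rv)
  also have "\<dots> = PiM ?K (\<lambda>_. \<nu>)"
    using distr by (intro PiM_cong) auto
  finally have D: "distr M (PiM ?K (\<lambda>_. N)) (\<lambda>\<omega>. \<lambda>k\<in>?K. X k \<omega>) = PiM ?K (\<lambda>_. \<nu>)" .
  have [measurable]: "Measurable.pred (\<nu> \<Otimes>\<^sub>M \<nu>) (\<lambda>q. R (fst q) (snd q))"
    using R by (simp add: case_prod_beta cong: measurable_cong_sets)
  let ?g = "\<lambda>x y. if R x y then 1 else 0 :: ennreal"
  have [measurable]: "(\<lambda>q. ?g (fst q) (snd q)) \<in> borel_measurable (\<nu> \<Otimes>\<^sub>M \<nu>)"
    by measurable
  have sec: "Measurable.pred \<nu> (R x)" if "x \<in> space N" for x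
  proof -
    have "(\<lambda>y. (x, y)) \<in> \<nu> \<rightarrow>\<^sub>M \<nu> \<Otimes>\<^sub>M \<nu>"
      using that by (intro measurable_Pair1') simp
    from measurable_compose[OF this, of "\<lambda>q. R (fst q) (snd q)" "count_space UNIV"] show ?thesis
      by simp
  qed
  have f_meas: "(\<lambda>\<omega>. \<Prod>j\<in>J. ?g (\<omega> i) (\<omega> j)) \<in> borel_measurable (PiM ?K (\<lambda>_. \<nu>))"
  proof (intro borel_measurable_prod_ennreal)
    fix j assume "j \<in> J"
    then have "(\<lambda>\<omega>. (\<omega> i, \<omega> j)) \<in> PiM ?K (\<lambda>_. \<nu>) \<rightarrow>\<^sub>M \<nu> \<Otimes>\<^sub>M \<nu>"
      by (intro measurable_Pair measurable_component_singleton) auto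
    from measurable_compose[OF this, of "\<lambda>q. ?g (fst q) (snd q)" borel]
    show "(\<lambda>\<omega>. ?g (\<omega> i) (\<omega> j)) \<in> borel_measurable (PiM ?K (\<lambda>_. \<nu>))"
      by simp
  qed
  have f_meas': "(\<lambda>\<omega>. \<Prod>j\<in>J. ?g (\<omega> i) (\<omega> j)) \<in> borel_measurable (PiM ?K (\<lambda>_. N))"
    using f_meas by (simp cong: measurable_cong_sets sets_PiM_cong)
  let ?E = "{\<omega> \<in> space M. \<forall>j\<in>J. R (X i \<omega>) (X j \<omega>)}"
  have E: "?E \<in> sets M"
  proof -
    have "Measurable.pred M (\<lambda>\<omega>. R (X i \<omega>) (X j \<omega>))" if "j \<in> J" for j
    proof -
      have "(\<lambda>\<omega>. (X i \<omega>, X j \<omega>)) \<in> M \<rightarrow>\<^sub>M N \<Otimes>\<^sub>M N"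
        using that by (intro measurable_Pair rv) auto
      from measurable_compose[OF this R] show ?thesis by simp
    qed
    then have "Measurable.pred M (\<lambda>\<omega>. \<forall>j\<in>J. R (X i \<omega>) (X j \<omega>))"
      using J(1) by (intro pred_intros_finite) auto
    then show ?thesis by (simp add: pred_def)
  qed
  have "emeasure M ?E = (\<integral>\<^sup>+\<omega>. indicator ?E \<omega> \<partial>M)"
    using E by simp
  also have "\<dots> = (\<integral>\<^sup>+\<omega>. (\<Prod>j\<in>J. ?g ((\<lambda>k\<in>?K. X k \<omega>) i) ((\<lambda>k\<in>?K. X k \<omega>) j)) \<partial>M)"
    using J(1) by (intro nn_integral_cong) (auto simp: indicator_def prod_eq_1_iff intro!: prod_zero)
  also have "\<dots> = (\<integral>\<^sup>+\<omega>. (\<Prod>j\<in>J. ?g (\<omega> i) (\<omega> j)) \<partial>distr M (PiM ?K (\<lambda>_. N)) (\<lambda>\<omega>. \<lambda>k\<in>?K. X k \<omega>))"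
    by (subst nn_integral_distr) (auto intro!: measurable_restrict rv f_meas')
  also have "\<dots> = (\<integral>\<^sup>+x. (\<integral>\<^sup>+\<omega>. (\<Prod>j\<in>J. ?g (fun_upd \<omega> i x i) (fun_upd \<omega> i x j)) \<partial>PiM J (\<lambda>_. \<nu>)) \<partial>\<nu>)"
    unfolding D by (rule P.product_nn_integral_insert_rev[OF J(1,2) f_meas])
  also have "\<dots> = (\<integral>\<^sup>+x. (emeasure \<nu> {y \<in> space N. R x y}) ^ card J \<partial>\<nu>)"
  proof (rule nn_integral_cong)
    fix x assume "x \<in> space \<nu>"
    then have x: "x \<in> space N" by simp
    have [measurable]: "Measurable.pred \<nu> (R x)" by (rule sec[OF x])
    have "(\<integral>\<^sup>+\<omega>. (\<Prod>j\<in>J. ?g (fun_upd \<omega> i x i) (fun_upd \<omega> i x j)) \<partial>PiM J (\<lambda>_. \<nu>))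
        = (\<integral>\<^sup>+\<omega>. (\<Prod>j\<in>J. ?g x (\<omega> j)) \<partial>PiM J (\<lambda>_. \<nu>))"
      using J(2) by (intro nn_integral_cong prod.cong) auto
    also have "\<dots> = (\<Prod>j\<in>J. (\<integral>\<^sup>+y. ?g x y \<partial>\<nu>))"
      by (intro P.product_nn_integral_prod J(1)) measurable
    also have "(\<integral>\<^sup>+y. ?g x y \<partial>\<nu>) = (\<integral>\<^sup>+y. indicator {y \<in> space N. R x y} y \<partial>\<nu>)"
      by (intro nn_integral_cong) (auto simp: indicator_def)
    also have "\<dots> = emeasure \<nu> {y \<in> space N. R x y}"
      using sec[OF x] by (intro nn_integral_indicator) (simp add: pred_def)
    finally show "(\<integral>\<^sup>+\<omega>. (\<Prod>j\<in>J. ?g (fun_upd \<omega> i x i) (fun_upd \<omega> i x j)) \<partial>PiM J (\<lambda>_. \<nu>))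
        = (emeasure \<nu> {y \<in> space N. R x y}) ^ card J"
      by simp
  qed
  also have "\<dots> \<le> (\<integral>\<^sup>+x. ennreal (p ^ card J) \<partial>\<nu>)"
    using p(2) by (intro nn_integral_mono_AE) (auto simp: ennreal_power[symmetric] p(1) intro!: power_mono)
  also have "\<dots> = ennreal (p ^ card J)"
    using \<nu>.emeasure_space_1 by simp
  finally show ?thesis
    using p(1) by (simp add: emeasure_eq_measure)
qed

text \<open>Markov's inequality for the binomial moment of order \<open>K\<close>, that is for the number of \<open>K\<close>-element
  sets of indices whose points all lie in the neighbourhood of the centre. As \<open>K\<close> is at one's
  disposal, exceeding the expected count by a factor becomes as improbable as any prescribed power of
  that factor.\<close>

lemma (in prob_space) prob_count_ge_le:
  fixes p B :: real
  assumes indep: "indep_vars (\<lambda>_. N) X I" and S: "finite S" "S \<subseteq> I" "i \<in> I" "i \<notin> S"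
    and distr: "\<And>j. j \<in> I \<Longrightarrow> distr M N (X j) = \<nu>"
    and R: "Measurable.pred (N \<Otimes>\<^sub>M N) (\<lambda>(x, y). R x y)"
    and p: "0 \<le> p" "AE x in \<nu>. emeasure \<nu> {y \<in> space N. R x y} \<le> ennreal p"
    and K: "0 < K" "real K \<le> B"
  defines "E \<equiv> {\<omega> \<in> space M. B \<le> card {j \<in> S. R (X i \<omega>) (X j \<omega>)}}"
  shows "E \<in> events" "prob E \<le> (card S * p * K / B) ^ K"
proof -
  have rv [measurable]: "X j \<in> measurable M N" if "j \<in> I" for j
    using indep that by (auto simp: indep_vars_def)
  have pr: "Measurable.pred M (\<lambda>\<omega>. R (X i \<omega>) (X j \<omega>))" if "j \<in> S" for j
  proof -
    have "(\<lambda>\<omega>. (X i \<omega>, X j \<omega>)) \<in> M \<rightarrow>\<^sub>M N \<Otimes>\<^sub>M N"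
      using that S by (intro measurable_Pair rv) auto
    from measurable_compose[OF this R] show ?thesis by simp
  qed
  let ?c = "\<lambda>\<omega>. card {j \<in> S. R (X i \<omega>) (X j \<omega>)}"
  have c: "real (?c \<omega>) = (\<Sum>j\<in>S. if R (X i \<omega>) (X j \<omega>) then 1 else 0)" for \<omega>
    using S(1) by (simp add: sum.If_cases Int_def)
  have "(\<lambda>\<omega>. real (?c \<omega>)) \<in> borel_measurable M"
    unfolding c using pr by (intro borel_measurable_sum) measurable
  then show E: "E \<in> events"
    unfolding E_def by (rule borel_measurable_le[OF borel_measurable_const])
  define F where "F = {J. J \<subseteq> S \<and> card J = K}"
  have finF: "finite F"
    unfolding F_def using S(1) by (auto intro: finite_subset[OF _ finite_Pow_iff[THEN iffD2, OF S(1)]])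
  define EJ where "EJ J = {\<omega> \<in> space M. \<forall>j\<in>J. R (X i \<omega>) (X j \<omega>)}" for J
  have EJ: "EJ J \<in> events" if "J \<in> F" for J
  proof -
    have "finite J" using that S(1) unfolding F_def by (auto intro: finite_subset)
    then have "Measurable.pred M (\<lambda>\<omega>. \<forall>j\<in>J. R (X i \<omega>) (X j \<omega>))"
      using that pr unfolding F_def by (intro pred_intros_finite) auto
    then show ?thesis by (simp add: pred_def EJ_def)
  qed
  have B: "0 < B" using K by linarith
  have pJ: "prob (EJ J) \<le> p ^ K" if "J \<in> F" for J
  proof -
    have "J \<subseteq> S" "card J = K" "finite J"
      using that S(1) unfolding F_def by (auto intro: finite_subset)
    then show ?thesis
      using prob_all_related_le[OF indep \<open>finite J\<close> _ _ distr R p, of i] S unfolding EJ_def by blast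
  qed
  have count: "real (?c \<omega> choose K) = (\<Sum>J\<in>F. indicator (EJ J) \<omega>)" if "\<omega> \<in> space M" for \<omega>
  proof -
    let ?T = "{j \<in> S. R (X i \<omega>) (X j \<omega>)}"
    have "?c \<omega> choose K = card {J. J \<subseteq> ?T \<and> card J = K}"
      using S(1) by (simp add: n_subsets)
    also have "{J. J \<subseteq> ?T \<and> card J = K} = {J \<in> F. \<omega> \<in> EJ J}"
      using that unfolding F_def EJ_def by auto
    also have "real (card \<dots>) = (\<Sum>J\<in>F. if \<omega> \<in> EJ J then 1 else 0)"
      using finF by (simp add: sum.If_cases Int_def)
    finally show ?thesis by (simp add: indicator_def of_bool_def)
  qed
  have "(B / K) ^ K * prob E = expectation (\<lambda>\<omega>. (B / K) ^ K * indicator E \<omega>)"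
    using E by simp
  also have "\<dots> \<le> expectation (\<lambda>\<omega>. \<Sum>J\<in>F. indicator (EJ J) \<omega>)"
  proof (rule integral_mono)
    show "integrable M (\<lambda>\<omega>. (B / real K) ^ K * indicator E \<omega>)"
      using E by (intro integrable_mult_right) (simp add: integrable_indicator_iff less_top[symmetric])
    show "integrable M (\<lambda>\<omega>. \<Sum>J\<in>F. indicator (EJ J) \<omega> :: real)"
      using EJ by (intro Bochner_Integration.integrable_sum) (simp add: integrable_indicator_iff less_top[symmetric])
    fix \<omega> assume w: "\<omega> \<in> space M"
    show "(B / real K) ^ K * indicator E \<omega> \<le> (\<Sum>J\<in>F. indicator (EJ J) \<omega> :: real)"
    proof (cases "\<omega> \<in> E")
      case True
      then have b: "B \<le> real (?c \<omega>)" by (simp add: E_def)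
      then have "K \<le> ?c \<omega>" using K by linarith
      have "(B / real K) ^ K \<le> (real (?c \<omega>) / real K) ^ K"
        using b B K by (intro power_mono divide_right_mono) auto
      also have "\<dots> \<le> real (?c \<omega> choose K)"
        by (rule binomial_ge_n_over_k_pow_k[OF \<open>K \<le> ?c \<omega>\<close>])
      finally show ?thesis using True count[OF w] by simp
    qed (auto intro: sum_nonneg)
  qed
  also have "\<dots> = (\<Sum>J\<in>F. prob (EJ J))"
    using EJ by (subst Bochner_Integration.integral_sum) (auto simp: integrable_indicator_iff less_top[symmetric])
  also have "\<dots> \<le> (\<Sum>J\<in>F. p ^ K)"
    by (intro sum_mono pJ)
  also have "\<dots> = real (card S choose K) * p ^ K"
    using n_subsets[OF S(1), of K] by (simp add: F_def)
  also have "\<dots> \<le> real (card S) ^ K * p ^ K"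
  proof (intro mult_right_mono)
    have "card S choose K \<le> card S ^ K"
      by (cases "K \<le> card S") (auto simp: binomial_le_pow binomial_eq_0)
    then show "real (card S choose K) \<le> real (card S) ^ K"
      by (metis of_nat_le_iff of_nat_power)
  qed (use p in simp)
  finally show "prob E \<le> (card S * p * K / B) ^ K"
    using B K by (simp add: power_mult_distrib power_divide field_simps)
qed

lemma measurable_pred_quasi_dist:
  "Measurable.pred (borel \<Otimes>\<^sub>M borel) (\<lambda>(x, y). quasi_dist y x < h)"
proof -
  have "(\<lambda>q. quasi_dist (snd q) (fst q)) \<in> borel_measurable (borel \<Otimes>\<^sub>M borel)"
    by measurable
  then show ?thesis
    unfolding case_prod_beta by measurable
qed

lemma (in prob_space) AE_norm_eq_1:
  assumes [measurable]: "X \<in> borel_measurable M" and distr: "distr M borel X = sphere_uniform"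
  shows "AE \<omega> in M. norm (X \<omega>) = 1"
proof -
  have "AE x in distr M borel X. x \<in> sphere 0 1"
    unfolding distr by (rule AE_sphere_uniform)
  then show ?thesis
    by (subst (asm) AE_distr_iff) auto
qed

text \<open>Half of the gain \<open>b ^ (4 * m)\<close> in the growth hypothesis is kept for Schur's test. The other half
  is the factor by which the counts have to exceed their expectation to be harmful.\<close>

theorem (in prob_space) AE_carleson_sequence:
  fixes \<xi> :: "nat \<Rightarrow> 'a \<Rightarrow> complex^'d" and r :: "nat \<Rightarrow> real"
  assumes H: "hardy_space H ip" and r: "\<And>n. 0 < r n \<and> r n < 1"
    and indep: "indep_vars (\<lambda>_. borel) \<xi> UNIV" and distr: "\<And>n. distr M borel (\<xi> n) = sphere_uniform"
    and b: "1 < b" "b < 2 ^ CARD('d)" and fin: "\<And>m. finite (dyadic_indices r m)"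
    and C: "0 < C" "\<And>m. card (dyadic_indices r m) \<le> C * (2 ^ CARD('d)) ^ m / b ^ (4 * m)"
  shows "AE \<omega> in M. carleson_sequence (ball 0 1) szego_kernel H ip (\<lambda>n. r n *\<^sub>R \<xi> n \<omega>)"
proof -
  define D :: real where "D = 2 ^ CARD('d)"
  have D: "1 < D" "b < D" unfolding D_def using b by auto
  let ?S = "dyadic_indices r"
  obtain C1 where C1: "0 < C1" "\<And>\<zeta> h. norm (\<zeta> :: complex^'d) = 1 \<Longrightarrow> 0 \<le> h \<Longrightarrow>
      emeasure sphere_uniform {x. quasi_dist x \<zeta> < h} \<le> ennreal (C1 * h ^ CARD('d))"
    using emeasure_cap_upper by blast
  define C2 where "C2 = C1 * 25 ^ CARD('d)"
  have C2: "0 < C2" using C1 by (simp add: C2_def)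
  have capD: "C1 * (25 * (1/2) ^ l) ^ CARD('d) = C2 / D ^ l" for l
    by (simp add: C2_def D_def power_mult_distrib power_divide power_mult[symmetric] mult.commute)
  \<comment> \<open>with this \<open>K\<close> the tail probability \<open>b ^ (- 2 * K * m)\<close> outweighs the number \<open>D ^ m\<close> of centres\<close>
  obtain K0 where K0: "2 * D < (b\<^sup>2) ^ K0"
    using real_arch_pow[of "b\<^sup>2" "2 * D"] b by (auto simp: one_less_power)
  define K where "K = Suc K0"
  have K: "0 < K" "2 * D \<le> b ^ (2 * K)"
  proof -
    have "(b\<^sup>2) ^ K0 \<le> (b\<^sup>2) ^ K"
      unfolding K_def using b by (intro power_increasing) (auto simp: one_le_power)
    then show "2 * D \<le> b ^ (2 * K)" using K0 by (simp add: power_mult)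
  qed (simp add: K_def)
  define B where "B m l = real K * (1 + D ^ m / D ^ l / b ^ (2 * m))" for m l
  have BK: "real K \<le> B m l" and Bp: "real K * (D ^ m / D ^ l / b ^ (2 * m)) \<le> B m l" for m l
    using K D b by (auto simp: B_def distrib_left)
  define E where "E m l k = {\<omega> \<in> space M. B m l
      \<le> card {j \<in> ?S m - {k}. quasi_dist (\<xi> j \<omega>) (\<xi> k \<omega>) < 25 * (1/2) ^ l}}" for m l k
  have cap_AE: "AE x in (sphere_uniform :: (complex^'d) measure). emeasure sphere_uniform {y \<in> space borel. quasi_dist y x < 25 * (1/2) ^ l}
      \<le> ennreal (C2 / D ^ l)" for l
  proof -
    have *: "emeasure sphere_uniform {y. quasi_dist y x < 25 * (1/2) ^ l} \<le> ennreal (C2 / D ^ l)"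
      if "norm x = 1" for x :: "complex^'d"
      by (subst capD[symmetric], rule C1(2)) (use that in auto)
    from AE_sphere_uniform show ?thesis
      by eventually_elim (use * in auto)
  qed
  have E: "E m l k \<in> events" "prob (E m l k) \<le> (C * C2) ^ K * (1 / b ^ (2 * K)) ^ m" if "k \<in> ?S m" for m l k
  proof -
    note tail = prob_count_ge_le[where R = "\<lambda>x y. quasi_dist y x < 25 * (1/2) ^ l" and S = "?S m - {k}"
        and i = k and B = "B m l", OF indep _ _ _ _ distr measurable_pred_quasi_dist _ cap_AE K(1) BK]
    show "E m l k \<in> events"
      unfolding E_def by (rule tail(1)) (use fin C2 D in auto)
    have "prob (E m l k) \<le> (card (?S m - {k}) * (C2 / D ^ l) * K / B m l) ^ K"
      unfolding E_def by (rule tail(2)) (use fin C2 D in auto)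
    also have "\<dots> \<le> (C * C2 / b ^ (2 * m)) ^ K"
    proof (rule power_mono)
      have "card (?S m - {k}) * (C2 / D ^ l) * K / B m l
        \<le> (C * D ^ m / b ^ (4 * m)) * (C2 / D ^ l) * K / (real K * (D ^ m / D ^ l / b ^ (2 * m)))"
      proof (intro frac_le mult_right_mono Bp)
        have "real (card (?S m - {k})) \<le> real (card (?S m))"
          by (simp add: card_Diff1_le fin)
        also have "\<dots> \<le> C * D ^ m / b ^ (4 * m)"
          using C(2) by (simp add: D_def)
        finally show "real (card (?S m - {k})) \<le> C * D ^ m / b ^ (4 * m)" .
      qed (use C C2 K b D in auto)
      also have "\<dots> = C * C2 / b ^ (2 * m)"
        using K b D by (simp add: field_simps flip: power_add)
      finally show "card (?S m - {k}) * (C2 / D ^ l) * K / B m l \<le> C * C2 / b ^ (2 * m)" .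
      show "0 \<le> card (?S m - {k}) * (C2 / D ^ l) * K / B m l"
        using C2 D order_trans[OF _ BK[of m l]] by auto
    qed
    also have "\<dots> = (C * C2) ^ K * (1 / b ^ (2 * K)) ^ m"
      by (simp add: power_divide power_mult[symmetric] mult.commute mult.left_commute)
    finally show "prob (E m l k) \<le> (C * C2) ^ K * (1 / b ^ (2 * K)) ^ m" .
  qed
  define U where "U m = (\<Union>(l, k)\<in>{..m + 1} \<times> ?S m. E m l k)" for m
  have U: "U m \<in> events" for m
    unfolding U_def using E(1) fin by (intro sets.finite_UN) auto
  have pU: "prob (U m) \<le> C * (C * C2) ^ K * ((real m + 2) * (1/2) ^ m)" for m
  proof -
    have "prob (U m) \<le> (\<Sum>(l, k)\<in>{..m + 1} \<times> ?S m. prob (E m l k))"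
      unfolding U_def using finite_measure_subadditive_finite[of "{..m + 1} \<times> ?S m" "\<lambda>(l, k). E m l k"] E(1) fin
      by (force simp: case_prod_beta)
    also have "\<dots> \<le> (\<Sum>(l, k)\<in>{..m + 1} \<times> ?S m. (C * C2) ^ K * (1 / b ^ (2 * K)) ^ m)"
      by (intro sum_mono) (use E(2) in auto)
    also have "\<dots> = (real m + 2) * card (?S m) * ((C * C2) ^ K * (1 / b ^ (2 * K)) ^ m)"
      by (simp add: card_cartesian_product distrib_right)
    also have "\<dots> \<le> (real m + 2) * (C * D ^ m) * ((C * C2) ^ K * (1 / (2 * D)) ^ m)"
    proof (intro mult_mono power_mono)
      have "C * D ^ m / b ^ (4 * m) \<le> C * D ^ m"
        using divide_left_mono[of 1 "b ^ (4 * m)" "C * D ^ m"] C D b by (simp add: one_le_power)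
      then show "real (card (?S m)) \<le> C * D ^ m"
        using C(2)[of m] by (simp add: D_def)
      show "1 / b ^ (2 * K) \<le> 1 / (2 * D)"
        using K D by (intro divide_left_mono) auto
    qed (use C C2 b D in auto)
    also have "\<dots> = C * (C * C2) ^ K * ((real m + 2) * (1/2) ^ m)"
      using D by (simp add: power_divide power_mult_distrib)
    finally show ?thesis .
  qed
  have "summable (\<lambda>m. prob (U m))"
  proof (rule summable_comparison_test_ev)
    have c: "norm (1/2 :: real) < 1" by simp
    have "summable (\<lambda>m. of_nat (Suc m) * (1/2 :: real) ^ m + (1/2) ^ m)"
      by (intro summable_add summable_geometric c sums_summable[OF geometric_deriv_sums[OF c]])
    then have "summable (\<lambda>m. (real m + 2) * (1/2) ^ m)"
      by (simp add: algebra_simps)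
    then show "summable (\<lambda>m. C * (C * C2) ^ K * ((real m + 2) * (1/2) ^ m))"
      by (rule summable_mult)
  qed (use pU in auto)
  then have "AE \<omega> in M. eventually (\<lambda>m. \<omega> \<in> space M - U m) sequentially"
    by (intro borel_cantelli_AE1 U) (auto simp: less_top[symmetric])
  moreover have "AE \<omega> in M. \<forall>n. norm (\<xi> n \<omega>) = 1"
  proof -
    have "AE \<omega> in M. norm (\<xi> n \<omega>) = 1" for n
      by (rule AE_norm_eq_1[OF _ distr]) (use indep in \<open>auto simp: indep_vars_def\<close>)
    then show ?thesis by (simp add: AE_all_countable)
  qed
  ultimately show ?thesis
  proof eventually_elim
    case (elim \<omega>)
    then obtain m0 where m0: "\<And>m. m0 \<le> m \<Longrightarrow> \<omega> \<in> space M - U m"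
      by (auto simp: eventually_sequentially)
    \<comment> \<open>the finitely many exceptional levels are covered by the trivial bound\<close>
    define A where "A = real K + (\<Sum>m<m0. real (card (?S m)))"
    have A: "real K \<le> A" unfolding A_def by (simp add: sum_nonneg)
    interpret H: hardy_space H ip by (rule H)
    show ?case
    proof (rule H.carleson_of_cap_counts[where A = A and b = b])
      show "1 \<le> A" using A K by linarith
      fix k m l assume l: "l \<le> m + 1" and k: "k \<in> ?S m"
      let ?c = "card {j \<in> ?S m - {k}. quasi_dist (\<xi> j \<omega>) (\<xi> k \<omega>) < 25 * (1/2) ^ l}"
      have t: "0 \<le> D ^ m / D ^ l / b ^ (2 * m)" using D b by simp
      have "real ?c \<le> A * (1 + D ^ m / D ^ l / b ^ (2 * m))"
      proof (cases "m < m0")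
        case True
        have "?c \<le> card (?S m)"
          using fin by (intro card_mono) auto
        also have "real (card (?S m)) \<le> (\<Sum>m<m0. real (card (?S m)))"
          using True by (intro member_le_sum) auto
        also have "\<dots> \<le> A" by (simp add: A_def)
        also have "\<dots> \<le> A * (1 + D ^ m / D ^ l / b ^ (2 * m))"
          using t A by (simp add: mult_le_cancel_left1)
        finally show ?thesis by simp
      next
        case False
        then have "\<omega> \<in> space M - E m l k"
          using m0[of m] l k by (auto simp: U_def)
        then have "real ?c < B m l"
          by (auto simp: E_def)
        also have "\<dots> \<le> A * (1 + D ^ m / D ^ l / b ^ (2 * m))"
          unfolding B_def using A t by (intro mult_right_mono) auto
        finally show ?thesis by simp
      qed
      then show "real ?c \<le> A * (1 + (2 ^ CARD('d)) ^ m / (2 ^ CARD('d)) ^ l / b ^ (2 * m))"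
        by (simp only: D_def)
    qed (use elim r fin b in auto)
  qed
qed

section \<open>Negative correlation and the second moment\<close>

text \<open>Chebyshev's inequality for the number of events that occur: its variance is at most its mean.\<close>

lemma (in prob_space) prob_none_of_negatively_correlated:
  assumes G: "finite G" and A: "\<And>c. c \<in> G \<Longrightarrow> A c \<in> events"
    and corr: "\<And>c c'. c \<in> G \<Longrightarrow> c' \<in> G \<Longrightarrow> c \<noteq> c' \<Longrightarrow> prob (A c \<inter> A c') \<le> prob (A c) * prob (A c')"
  shows "prob (space M - (\<Union>c\<in>G. A c)) * (\<Sum>c\<in>G. prob (A c)) \<le> 1"
proof -
  define \<mu> where "\<mu> = (\<Sum>c\<in>G. prob (A c))"
  define E where "E = space M - (\<Union>c\<in>G. A c)"
  have E: "E \<in> events"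
    unfolding E_def using A G by (intro sets.Diff sets.finite_UN) auto
  let ?Y = "\<lambda>\<omega>. \<Sum>c\<in>G. indicator (A c) \<omega> :: real"
  have int: "integrable M (indicator B :: 'a \<Rightarrow> real)" if "B \<in> events" for B
    using that by (simp add: integrable_indicator_iff less_top[symmetric])
  have expand: "(?Y \<omega> - \<mu>)\<^sup>2 = (\<Sum>c\<in>G. \<Sum>c'\<in>G. indicator (A c \<inter> A c') \<omega>) - 2 * \<mu> * ?Y \<omega> + \<mu>\<^sup>2" for \<omega>
  proof -
    have "(\<Sum>c\<in>G. \<Sum>c'\<in>G. indicator (A c \<inter> A c') \<omega>) = ?Y \<omega> * ?Y \<omega>"
      by (simp add: sum_product indicator_inter_arith)
    then show ?thesis
      by (simp only: power2_eq_square) (simp only: algebra_simps mult_2)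
  qed
  have int2: "integrable M (\<lambda>\<omega>. (?Y \<omega> - \<mu>)\<^sup>2)"
    unfolding expand using A
    by (intro Bochner_Integration.integrable_add Bochner_Integration.integrable_diff
        Bochner_Integration.integrable_sum integrable_mult_right int) auto
  have "\<mu>\<^sup>2 * prob E = expectation (\<lambda>\<omega>. \<mu>\<^sup>2 * indicator E \<omega>)"
    using E by simp
  also have "\<dots> \<le> expectation (\<lambda>\<omega>. (?Y \<omega> - \<mu>)\<^sup>2)"
  proof (rule integral_mono[OF _ int2])
    fix \<omega>
    show "\<mu>\<^sup>2 * indicator E \<omega> \<le> (?Y \<omega> - \<mu>)\<^sup>2"
    proof (cases "\<omega> \<in> E")
      case True
      then have "?Y \<omega> = 0"
        by (intro sum.neutral) (auto simp: E_def)
      then show ?thesis using True by simp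
    qed simp
  qed (use int[OF E] in simp)
  also have "\<dots> = (\<Sum>c\<in>G. \<Sum>c'\<in>G. prob (A c \<inter> A c')) - 2 * \<mu> * \<mu> + \<mu>\<^sup>2"
  proof -
    have "expectation (\<lambda>\<omega>. (?Y \<omega> - \<mu>)\<^sup>2)
        = expectation (\<lambda>\<omega>. \<Sum>c\<in>G. \<Sum>c'\<in>G. indicator (A c \<inter> A c') \<omega>) - expectation (\<lambda>\<omega>. 2 * \<mu> * ?Y \<omega>) + \<mu>\<^sup>2"
      unfolding expand using A
      by (subst Bochner_Integration.integral_add Bochner_Integration.integral_diff;
          (intro Bochner_Integration.integrable_add Bochner_Integration.integrable_diff
            Bochner_Integration.integrable_sum integrable_mult_right int)?; auto simp: prob_space)+
    also have "expectation (\<lambda>\<omega>. \<Sum>c\<in>G. \<Sum>c'\<in>G. indicator (A c \<inter> A c') \<omega>) = (\<Sum>c\<in>G. \<Sum>c'\<in>G. prob (A c \<inter> A c'))"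
    proof (subst Bochner_Integration.integral_sum)
      show "integrable M (\<lambda>\<omega>. \<Sum>c'\<in>G. indicator (A c \<inter> A c') \<omega> :: real)" if "c \<in> G" for c
        using A that by (intro Bochner_Integration.integrable_sum int) auto
      show "(\<Sum>c\<in>G. expectation (\<lambda>\<omega>. \<Sum>c'\<in>G. indicator (A c \<inter> A c') \<omega>)) = (\<Sum>c\<in>G. \<Sum>c'\<in>G. prob (A c \<inter> A c'))"
        using A by (intro sum.cong refl, subst Bochner_Integration.integral_sum) (auto intro!: int)
    qed
    also have "expectation (\<lambda>\<omega>. 2 * \<mu> * ?Y \<omega>) = 2 * \<mu> * \<mu>"
    proof -
      have "expectation ?Y = \<mu>"
        unfolding \<mu>_def using A by (subst Bochner_Integration.integral_sum) (auto intro!: int)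
      then show ?thesis by simp
    qed
    finally show ?thesis .
  qed
  also have "(\<Sum>c\<in>G. \<Sum>c'\<in>G. prob (A c \<inter> A c')) \<le> (\<Sum>c\<in>G. prob (A c) + (\<Sum>c'\<in>G. prob (A c) * prob (A c')))"
  proof (rule sum_mono)
    fix c assume c: "c \<in> G"
    have "(\<Sum>c'\<in>G. prob (A c \<inter> A c')) = prob (A c) + (\<Sum>c'\<in>G - {c}. prob (A c \<inter> A c'))"
      using c G by (simp add: sum.remove)
    also have "(\<Sum>c'\<in>G - {c}. prob (A c \<inter> A c')) \<le> (\<Sum>c'\<in>G - {c}. prob (A c) * prob (A c'))"
      using c by (intro sum_mono corr) auto
    also have "\<dots> \<le> (\<Sum>c'\<in>G. prob (A c) * prob (A c'))"
      using G by (intro sum_mono2) auto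
    finally show "(\<Sum>c'\<in>G. prob (A c \<inter> A c')) \<le> prob (A c) + (\<Sum>c'\<in>G. prob (A c) * prob (A c'))"
      by simp
  qed
  also have "\<dots> = \<mu> + \<mu> * \<mu>"
    by (simp add: \<mu>_def sum.distrib sum_product)
  finally have "\<mu> * (\<mu> * prob E) \<le> \<mu> * 1"
    by (simp add: power2_eq_square)
  moreover have "0 \<le> \<mu>"
    by (simp add: \<mu>_def sum_nonneg)
  ultimately have "\<mu> * prob E \<le> 1"
    by (cases "\<mu> = 0") (auto simp: mult_le_cancel_left)
  then show ?thesis
    by (simp add: \<mu>_def E_def mult.commute)
qed

lemma one_minus_power_ge:
  fixes p :: real
  assumes "0 \<le> p" "p \<le> 1" shows "n * p / (1 + n * p) \<le> 1 - (1 - p) ^ n"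
proof -
  have "(1 + n * p) * (1 - p) ^ n \<le> (1 + p) ^ n * (1 - p) ^ n"
    using assms Bernoulli_inequality[of p n] by (intro mult_right_mono) auto
  also have "\<dots> = ((1 + p) * (1 - p)) ^ n"
    by (simp add: power_mult_distrib)
  also have "\<dots> \<le> 1 ^ n"
    using assms by (intro power_mono) (auto simp: algebra_simps mult_le_one)
  finally have "(1 - p) ^ n \<le> 1 / (1 + n * p)"
    using assms by (simp add: pos_le_divide_eq add_pos_nonneg mult.commute)
  moreover have "1 - 1 / (1 + n * p) = n * p / (1 + n * p)"
    using assms by (simp add: field_simps add_pos_nonneg add_nonneg_eq_0_iff)
  ultimately show ?thesis by linarith
qed

text \<open>For a single group of independent points: the probabilities of missing \<open>B\<close>, missing \<open>B'\<close> and
  missing both are \<open>(1 - p) ^ n\<close>, \<open>(1 - p') ^ n\<close> and \<open>(1 - p - p') ^ n \<le> ((1 - p) (1 - p')) ^ n\<close>.\<close>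

lemma (in prob_space) prob_hit:
  assumes indep: "indep_vars (\<lambda>_. N) X I" and S: "finite S" "S \<subseteq> I"
    and distr: "\<And>j. j \<in> I \<Longrightarrow> distr M N (X j) = \<nu>"
    and B: "B \<in> sets N" "B' \<in> sets N" "B \<inter> B' = {}"
  defines "hit \<equiv> \<lambda>B. {\<omega> \<in> space M. \<exists>j\<in>S. X j \<omega> \<in> B}"
  shows "prob (hit B) = 1 - (1 - measure \<nu> B) ^ card S"
    "prob (hit B \<inter> hit B') \<le> prob (hit B) * prob (hit B')"
proof -
  have rv [measurable]: "X j \<in> measurable M N" if "j \<in> I" for j
    using indep that by (auto simp: indep_vars_def)
  have p\<nu>: "prob (X j -` T \<inter> space M) = measure \<nu> T" if "j \<in> S" "T \<in> sets N" for j T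
  proof -
    have "j \<in> I" using that S by auto
    from measure_distr[OF rv[OF this] that(2)] distr[OF this] show ?thesis by simp
  qed
  have "prob (hit B) = 1 - (1 - measure \<nu> B) ^ card S \<and> prob (hit B \<inter> hit B') \<le> prob (hit B) * prob (hit B')"
  proof (cases "S = {}")
    case True
    then show ?thesis
      by (simp add: hit_def)
  next
    case False
    then obtain j0 where j0: "j0 \<in> S" by blast
    have X_space: "\<forall>j\<in>S. \<forall>\<omega>\<in>space M. X j \<omega> \<in> space N"
      using S measurable_space[OF rv] by blast
    have hit_ev: "hit T \<in> events" if "T \<in> sets N" for T
    proof -
      have "hit T = (\<Union>j\<in>S. X j -` T \<inter> space M)" by (auto simp: hit_def)
      also have "\<dots> \<in> events"
        using S that by (intro sets.finite_UN measurable_sets[OF rv]) auto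
      finally show ?thesis .
    qed
    have miss: "prob (space M - hit T) = (1 - measure \<nu> T) ^ card S" if T: "T \<in> sets N" for T
    proof -
      have "space M - hit T = (\<Inter>j\<in>S. X j -` (space N - T) \<inter> space M)"
        using False X_space unfolding hit_def by blast
      then have "prob (space M - hit T) = (\<Prod>j\<in>S. prob (X j -` (space N - T) \<inter> space M))"
        using indep_varsD[OF indep False S, of "\<lambda>_. space N - T"] T by simp
      also have "\<dots> = (\<Prod>j\<in>S. 1 - measure \<nu> T)"
      proof (rule prod.cong[OF refl])
        fix j assume j: "j \<in> S"
        then have "j \<in> I" using S by auto
        have "X j -` (space N - T) \<inter> space M = space M - (X j -` T \<inter> space M)"
          using measurable_space[OF rv[OF \<open>j \<in> I\<close>]] by auto
        then show "prob (X j -` (space N - T) \<inter> space M) = 1 - measure \<nu> T"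
          using prob_compl[OF measurable_sets[OF rv[OF \<open>j \<in> I\<close>] T]] p\<nu>[OF j T] by simp
      qed
      finally show ?thesis by simp
    qed
    have hit: "prob (hit T) = 1 - (1 - measure \<nu> T) ^ card S" if T: "T \<in> sets N" for T
      using prob_compl[OF hit_ev[OF T]] miss[OF T] by simp
    have sub: "measure \<nu> (B \<union> B') = measure \<nu> B + measure \<nu> B'"
    proof -
      have "X j0 -` (B \<union> B') \<inter> space M = (X j0 -` B \<inter> space M) \<union> (X j0 -` B' \<inter> space M)"
        by auto
      moreover have "prob ((X j0 -` B \<inter> space M) \<union> (X j0 -` B' \<inter> space M))
          = prob (X j0 -` B \<inter> space M) + prob (X j0 -` B' \<inter> space M)"
        using B j0 S by (intro finite_measure_Union measurable_sets[OF rv]) auto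
      ultimately show ?thesis
        using p\<nu>[OF j0, of "B \<union> B'"] p\<nu>[OF j0 B(1)] p\<nu>[OF j0 B(2)] B by (simp del: vimage_Un)
    qed
    have le1: "measure \<nu> T \<le> 1" if "T \<in> sets N" for T
      using p\<nu>[OF j0 that] prob_le_1 by metis
    have "hit (B \<union> B') = hit B \<union> hit B'"
      by (auto simp: hit_def)
    then have "prob (hit B \<inter> hit B') = prob (hit B) + prob (hit B') - prob (hit (B \<union> B'))"
      using measure_Un3[of "hit B" M "hit B'"] hit_ev B by (simp add: fmeasurable_eq_sets)
    also have "\<dots> = 1 - (1 - measure \<nu> B) ^ card S - (1 - measure \<nu> B') ^ card S
        + (1 - (measure \<nu> B + measure \<nu> B')) ^ card S"
      using B by (simp add: hit sub[symmetric])
    also have "(1 - (measure \<nu> B + measure \<nu> B')) ^ card S \<le> ((1 - measure \<nu> B) * (1 - measure \<nu> B')) ^ card S"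
      using le1[of "B \<union> B'"] B sub by (intro power_mono) (auto simp: algebra_simps)
    also have "1 - (1 - measure \<nu> B) ^ card S - (1 - measure \<nu> B') ^ card S
        + ((1 - measure \<nu> B) * (1 - measure \<nu> B')) ^ card S = prob (hit B) * prob (hit B')"
      unfolding hit[OF B(1)] hit[OF B(2)] power_mult_distrib by (simp add: algebra_simps)
    finally have "prob (hit B \<inter> hit B') \<le> prob (hit B) * prob (hit B')"
      by simp
    with hit[OF B(1)] show ?thesis by blast
  qed
  then show "prob (hit B) = 1 - (1 - measure \<nu> B) ^ card S"
    "prob (hit B \<inter> hit B') \<le> prob (hit B) * prob (hit B')"
    by blast+
qed

text \<open>If the points are split into \<open>K\<close> independent groups and every group is asked to hit \<open>B c\<close>, then
  the negative correlation of distinct cells is inherited from single groups by multiplying over the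
  groups. For the larger event that \<open>B c\<close> contains \<open>K\<close> points it would be harder to see.\<close>

lemma (in prob_space) prob_no_common_cell:
  assumes indep: "indep_vars (\<lambda>_. N) X I" and K: "0 < (K::nat)"
    and S: "\<And>g. g < K \<Longrightarrow> finite (S g) \<and> S g \<subseteq> I \<and> card (S g) = n" "disjoint_family_on S {..<K}"
    and distr: "\<And>j. j \<in> I \<Longrightarrow> distr M N (X j) = \<nu>"
    and G: "finite G" "\<And>c. c \<in> G \<Longrightarrow> B c \<in> sets N" "disjoint_family_on B G"
    and p: "0 \<le> p" "\<And>c. c \<in> G \<Longrightarrow> p \<le> measure \<nu> (B c)"
  defines "E \<equiv> {\<omega> \<in> space M. \<forall>c\<in>G. \<exists>g<K. \<forall>j\<in>S g. X j \<omega> \<notin> B c}"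
  shows "E \<in> events" "prob E * (card G * (n * p / (1 + n * p)) ^ K) \<le> 1"
proof -
  have rv [measurable]: "X j \<in> measurable M N" if "j \<in> I" for j
    using indep that by (auto simp: indep_vars_def)
  define hit where "hit g T = {\<omega> \<in> space M. \<exists>j\<in>S g. X j \<omega> \<in> T}" for g T
  have hit_ev: "hit g T \<in> events" if "T \<in> sets N" "g < K" for T g
  proof -
    have "hit g T = (\<Union>j\<in>S g. X j -` T \<inter> space M)" by (auto simp: hit_def)
    also have "\<dots> \<in> events"
      using S(1)[OF that(2)] that by (intro sets.finite_UN measurable_sets[OF rv]) auto
    finally show ?thesis .
  qed
  have indR: "indep_vars (\<lambda>g. PiM (S g) (\<lambda>_. N)) (\<lambda>g \<omega>. restrict (\<lambda>i. X i \<omega>) (S g)) {..<K}"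
    using S by (intro indep_vars_restrict[OF indep]) auto
  have group_indep: "prob (\<Inter>g\<in>{..<K}. hit g T \<inter> hit g T') = (\<Prod>g\<in>{..<K}. prob (hit g T \<inter> hit g T'))"
    if T: "T \<in> sets N" "T' \<in> sets N" for T T'
  proof -
    let ?P = "\<lambda>g. PiM (S g) (\<lambda>_. N)"
    define Q where "Q g = (\<Union>j\<in>S g. (\<lambda>f. f j) -` T \<inter> space (?P g)) \<inter> (\<Union>j\<in>S g. (\<lambda>f. f j) -` T' \<inter> space (?P g))" for g
    have Q: "Q g \<in> sets (?P g)" if "g < K" for g
      unfolding Q_def using T S(1)[OF that]
      by (intro sets.Int sets.finite_UN measurable_sets[OF measurable_component_singleton]) auto
    have eq: "(\<lambda>\<omega>. restrict (\<lambda>i. X i \<omega>) (S g)) -` Q g \<inter> space M = hit g T \<inter> hit g T'" if g: "g < K" for g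
    proof -
      have "restrict (\<lambda>i. X i \<omega>) (S g) \<in> space (?P g)" if "\<omega> \<in> space M" for \<omega>
        using that S(1)[OF g] measurable_space[OF rv] by (auto simp: space_PiM)
      then show ?thesis
        by (auto simp: Q_def hit_def)
    qed
    have "prob (\<Inter>g\<in>{..<K}. (\<lambda>\<omega>. restrict (\<lambda>i. X i \<omega>) (S g)) -` Q g \<inter> space M)
      = (\<Prod>g\<in>{..<K}. prob ((\<lambda>\<omega>. restrict (\<lambda>i. X i \<omega>) (S g)) -` Q g \<inter> space M))"
      using K Q by (intro indep_varsD[OF indR]) auto
    moreover have "(\<Inter>g\<in>{..<K}. (\<lambda>\<omega>. restrict (\<lambda>i. X i \<omega>) (S g)) -` Q g \<inter> space M)
        = (\<Inter>g\<in>{..<K}. hit g T \<inter> hit g T')"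
      by (rule INF_cong[OF refl]) (rule eq, simp)
    moreover have "(\<Prod>g\<in>{..<K}. prob ((\<lambda>\<omega>. restrict (\<lambda>i. X i \<omega>) (S g)) -` Q g \<inter> space M))
        = (\<Prod>g\<in>{..<K}. prob (hit g T \<inter> hit g T'))"
      by (rule prod.cong[OF refl]) (simp add: eq)
    ultimately show ?thesis by (simp only:)
  qed
  define A where "A c = (\<Inter>g\<in>{..<K}. hit g (B c))" for c
  have A: "A c \<in> events" if "c \<in> G" for c
    unfolding A_def using K hit_ev G(2)[OF that] by (intro sets.finite_INT) auto
  have pA: "prob (A c) = (\<Prod>g\<in>{..<K}. prob (hit g (B c)))" if "c \<in> G" for c
    using group_indep[of "B c" "B c"] G(2)[OF that] by (simp add: A_def)
  have "prob (space M - (\<Union>c\<in>G. A c)) * (\<Sum>c\<in>G. prob (A c)) \<le> 1"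
  proof (rule prob_none_of_negatively_correlated[OF G(1) A])
    fix c c' assume c: "c \<in> G" "c' \<in> G" "c \<noteq> c'"
    have "A c \<inter> A c' = (\<Inter>g\<in>{..<K}. hit g (B c) \<inter> hit g (B c'))"
      by (auto simp: A_def)
    then have "prob (A c \<inter> A c') = (\<Prod>g\<in>{..<K}. prob (hit g (B c) \<inter> hit g (B c')))"
      using group_indep[of "B c" "B c'"] G(2) c by simp
    also have "\<dots> \<le> (\<Prod>g\<in>{..<K}. prob (hit g (B c)) * prob (hit g (B c')))"
    proof (intro prod_mono conjI)
      fix g assume g: "g \<in> {..<K}"
      have "B c \<inter> B c' = {}" using G(3) c by (auto simp: disjoint_family_on_def)
      then show "prob (hit g (B c) \<inter> hit g (B c')) \<le> prob (hit g (B c)) * prob (hit g (B c'))"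
        unfolding hit_def using g S(1)[of g] G(2) c distr
        by (intro prob_hit(2)[OF indep]) auto
    qed auto
    also have "\<dots> = prob (A c) * prob (A c')"
      using c by (simp add: pA prod.distrib)
    finally show "prob (A c \<inter> A c') \<le> prob (A c) * prob (A c')" .
  qed
  moreover have E: "space M - (\<Union>c\<in>G. A c) = E"
    unfolding E_def A_def hit_def by auto (meson lessThan_iff)
  moreover have "card G * (n * p / (1 + n * p)) ^ K \<le> (\<Sum>c\<in>G. prob (A c))"
  proof -
    have "(n * p / (1 + n * p)) ^ K \<le> prob (A c)" if c: "c \<in> G" for c
    proof -
      let ?m = "measure \<nu> (B c)"
      have hit: "prob (hit g (B c)) = 1 - (1 - ?m) ^ n" if "g < K" for g
        unfolding hit_def using S(1)[OF that] prob_hit(1)[OF indep, of "S g" \<nu> "B c" "{}"] G(2)[OF c] distr by auto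
      have m1: "?m \<le> 1" if "n \<noteq> 0"
      proof -
        have "S 0 \<noteq> {}" using S(1)[of 0] K that by auto
        then obtain j where "j \<in> S 0" by blast
        then have "j \<in> I" using S(1)[of 0] K by auto
        from measure_distr[OF rv[OF this] G(2)[OF c]] distr[OF this] prob_le_1
        show ?thesis by metis
      qed
      have "n * p / (1 + n * p) \<le> 1 - (1 - ?m) ^ n"
      proof (cases "n = 0")
        case False
        have "n * p / (1 + n * p) \<le> n * ?m / (1 + n * ?m)"
        proof -
          have "n * p \<le> n * ?m" using p(2)[OF c] by (intro mult_left_mono) auto
          then have "1 - 1 / (1 + n * p) \<le> 1 - 1 / (1 + n * ?m)"
            using p(1) by (intro diff_left_mono divide_left_mono mult_pos_pos) (auto simp: add_pos_nonneg)
          moreover have "1 - 1 / (1 + t) = t / (1 + t)" if "0 \<le> t" for t :: real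
            using that by (simp add: field_simps)
          ultimately show ?thesis using p(1) by simp
        qed
        also have "\<dots> \<le> 1 - (1 - ?m) ^ n"
          by (rule one_minus_power_ge[OF measure_nonneg m1[OF False]])
        finally show ?thesis .
      qed simp
      then have "(n * p / (1 + n * p)) ^ K \<le> (1 - (1 - ?m) ^ n) ^ K"
        using p by (intro power_mono) auto
      also have "\<dots> = prob (A c)"
        by (simp add: pA[OF c] hit)
      finally show ?thesis .
    qed
    then have "(\<Sum>c\<in>G. (n * p / (1 + n * p)) ^ K) \<le> (\<Sum>c\<in>G. prob (A c))"
      by (rule sum_mono)
    then show ?thesis by simp
  qed
  ultimately show "prob E * (card G * (n * p / (1 + n * p)) ^ K) \<le> 1"
    using mult_left_mono[of "card G * (n * p / (1 + n * p)) ^ K" "\<Sum>c\<in>G. prob (A c)" "prob E"] by simp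
  show "E \<in> events"
    unfolding E[symmetric] using A G by (intro sets.Diff sets.finite_UN) auto
qed

section \<open>Almost sure clusters\<close>

text \<open>Restricting to the sphere keeps the caps within the closed ball, where the triangle inequality
  for the quasi-distance holds.\<close>

definition sphere_cap :: "complex^'d \<Rightarrow> real \<Rightarrow> (complex^'d) set" where
  "sphere_cap \<zeta> h = {x. norm x = 1 \<and> quasi_dist x \<zeta> < h}"

lemma sets_sphere_cap [measurable, simp]: "sphere_cap \<zeta> h \<in> sets borel"
proof -
  have "sphere_cap \<zeta> h = sphere 0 1 \<inter> {x. quasi_dist x \<zeta> < h}"
    by (auto simp: sphere_cap_def)
  then show ?thesis by (simp add: sets.Int)
qed

lemma emeasure_sphere_cap:
  "emeasure sphere_uniform (sphere_cap \<zeta> h) = emeasure sphere_uniform {x. quasi_dist x \<zeta> < h}"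
proof (rule emeasure_eq_AE)
  show "AE x in sphere_uniform. x \<in> sphere_cap \<zeta> h \<longleftrightarrow> x \<in> {x. quasi_dist x \<zeta> < h}"
    using AE_sphere_uniform by eventually_elim (simp add: sphere_cap_def)
qed simp_all

text \<open>A maximal family of disjoint caps. The sixfold enlarged caps cover the sphere, so that the
  upper bound on their measure turns into a lower bound on their number.\<close>

lemma cap_packing:
  obtains c1 c2 where "0 < c1" "0 < c2"
    "\<And>h. 0 < h \<Longrightarrow> h \<le> 1 \<Longrightarrow> \<exists>Z :: (complex^'d) set. finite Z \<and> (\<forall>\<zeta>\<in>Z. norm \<zeta> = 1) \<and>
      disjoint_family_on (\<lambda>\<zeta>. sphere_cap \<zeta> h) Z \<and> c2 / h ^ CARD('d) \<le> card Z \<and>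
      (\<forall>\<zeta>\<in>Z. c1 * h ^ CARD('d) \<le> measure sphere_uniform (sphere_cap \<zeta> h))"
proof -
  interpret S: prob_space "sphere_uniform :: (complex^'d) measure"
    by (rule prob_space_sphere_uniform)
  obtain c where c: "0 < c" "\<And>\<zeta> h. norm (\<zeta> :: complex^'d) = 1 \<Longrightarrow> 0 < h \<Longrightarrow> h \<le> 1 \<Longrightarrow>
    ennreal (c * h ^ CARD('d)) \<le> emeasure sphere_uniform {x. quasi_dist x \<zeta> < h}"
    using emeasure_cap_lower by blast
  obtain C where C: "0 < C" "\<And>\<zeta> h. norm (\<zeta> :: complex^'d) = 1 \<Longrightarrow> 0 \<le> h \<Longrightarrow>
    emeasure sphere_uniform {x. quasi_dist x \<zeta> < h} \<le> ennreal (C * h ^ CARD('d))"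
    using emeasure_cap_upper by blast
  show ?thesis
  proof (rule that[of c "1 / (C * 6 ^ CARD('d))"])
    fix h :: real assume h: "0 < h" "h \<le> 1"
    have lower: "c * h ^ CARD('d) \<le> measure sphere_uniform (sphere_cap \<zeta> h)" if "norm \<zeta> = 1" for \<zeta> :: "complex^'d"
      using c(2)[OF that h, folded emeasure_sphere_cap] by (simp add: S.emeasure_eq_measure)
    define P where "P Z \<longleftrightarrow> finite Z \<and> (\<forall>\<zeta>\<in>Z. norm \<zeta> = 1) \<and> disjoint_family_on (\<lambda>\<zeta>. sphere_cap \<zeta> h) Z"
      for Z :: "(complex^'d) set"
    have bound: "real (card Z) * (c * h ^ CARD('d)) \<le> 1" if "P Z" for Z
    proof -
      have "real (card Z) * (c * h ^ CARD('d)) \<le> (\<Sum>\<zeta>\<in>Z. measure sphere_uniform (sphere_cap \<zeta> h))"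
        using that lower sum_mono[of Z "\<lambda>_. c * h ^ CARD('d)"] by (simp add: P_def)
      also have "\<dots> = measure sphere_uniform (\<Union>\<zeta>\<in>Z. sphere_cap \<zeta> h)"
        using that by (intro S.finite_measure_finite_Union[symmetric]) (auto simp: P_def)
      also have "\<dots> \<le> 1" by simp
      finally show ?thesis .
    qed
    have ch: "0 < c * h ^ CARD('d)" using c h by simp
    define N where "N = nat \<lceil>1 / (c * h ^ CARD('d))\<rceil>"
    have "card Z \<le> N" if "P Z" for Z
    proof -
      have "real (card Z) \<le> 1 / (c * h ^ CARD('d))"
        using bound[OF that] ch by (simp add: pos_le_divide_eq)
      also have "\<dots> \<le> real N" unfolding N_def by (rule real_nat_ceiling_ge)
      finally show ?thesis by simp
    qed
    moreover have "P {}" by (simp add: P_def disjoint_family_on_def)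
    ultimately obtain Z where Z: "P Z" "\<And>Z'. P Z' \<Longrightarrow> card Z' \<le> card Z"
      using ex_has_greatest_nat[of P "{}" card "Suc N"] by (metis less_Suc_eq_le)
    have cover: "sphere 0 1 \<subseteq> (\<Union>\<zeta>\<in>Z. sphere_cap \<zeta> (6 * h))"
    proof
      fix x :: "complex^'d" assume x: "x \<in> sphere 0 1"
      have "\<exists>\<zeta>\<in>Z. sphere_cap x h \<inter> sphere_cap \<zeta> h \<noteq> {}"
      proof (rule ccontr)
        assume a: "\<not> ?thesis"
        have "x \<in> sphere_cap x h"
          using x h by (simp add: sphere_cap_def quasi_dist_def cinner_vec_self)
        with a have "x \<notin> Z" by blast
        moreover have "P (insert x Z)"
          using a Z(1) x by (auto simp: P_def disjoint_family_on_def)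
        ultimately show False
          using Z(2)[of "insert x Z"] Z(1) by (simp add: P_def)
      qed
      then obtain \<zeta> y where \<zeta>: "\<zeta> \<in> Z" "y \<in> sphere_cap x h" "y \<in> sphere_cap \<zeta> h" by blast
      then have "quasi_dist x \<zeta> \<le> 3 * (quasi_dist x y + quasi_dist y \<zeta>)"
        using Z(1) x by (intro quasi_dist_triangle) (auto simp: P_def sphere_cap_def)
      also have "\<dots> < 6 * h"
        using \<zeta> quasi_dist_commute[of x y] by (simp add: sphere_cap_def)
      finally show "x \<in> (\<Union>\<zeta>\<in>Z. sphere_cap \<zeta> (6 * h))"
        using \<zeta>(1) x by (auto simp: sphere_cap_def)
    qed
    have "1 = measure sphere_uniform (sphere (0 :: complex^'d) 1)"
      using AE_sphere_uniform S.prob_eq_1[of "sphere 0 1"] by simp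
    also have "\<dots> \<le> measure sphere_uniform (\<Union>\<zeta>\<in>Z. sphere_cap \<zeta> (6 * h))"
      using cover Z(1) by (intro S.finite_measure_mono) (auto simp: P_def intro!: sets.finite_UN)
    also have "\<dots> \<le> (\<Sum>\<zeta>\<in>Z. measure sphere_uniform (sphere_cap \<zeta> (6 * h)))"
      using Z(1) by (intro S.finite_measure_subadditive_finite) (auto simp: P_def)
    also have "\<dots> \<le> (\<Sum>\<zeta>\<in>Z. C * (6 * h) ^ CARD('d))"
    proof (rule sum_mono)
      fix \<zeta> assume "\<zeta> \<in> Z"
      then have "norm \<zeta> = 1" using Z(1) by (simp add: P_def)
      from C(2)[OF this, of "6 * h", folded emeasure_sphere_cap] show "measure sphere_uniform (sphere_cap \<zeta> (6 * h)) \<le> C * (6 * h) ^ CARD('d)"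
        using h C(1) by (simp add: S.emeasure_eq_measure)
    qed
    finally have "1 / (C * 6 ^ CARD('d)) / h ^ CARD('d) \<le> card Z"
      using C(1) h by (simp add: field_simps power_mult_distrib)
    with Z(1) lower show "\<exists>Z :: (complex^'d) set. finite Z \<and> (\<forall>\<zeta>\<in>Z. norm \<zeta> = 1) \<and>
      disjoint_family_on (\<lambda>\<zeta>. sphere_cap \<zeta> h) Z \<and> 1 / (C * 6 ^ CARD('d)) / h ^ CARD('d) \<le> card Z \<and>
      (\<forall>\<zeta>\<in>Z. c * h ^ CARD('d) \<le> measure sphere_uniform (sphere_cap \<zeta> h))"
      unfolding P_def by blast
  qed (use c C in auto)
qed

lemma exists_disjoint_groups:
  assumes "finite T" "K * n \<le> card T"
  obtains S where "\<And>g. g < K \<Longrightarrow> finite (S g) \<and> S g \<subseteq> T \<and> card (S g) = n" "disjoint_family_on S {..<K}"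
proof -
  obtain f :: "nat \<Rightarrow> 'a" where f: "bij_betw f {0..<card T} T"
    using ex_bij_betw_nat_finite[OF assms(1)] by blast
  define S where "S g = f ` {g * n..<g * n + n}" for g
  have sub: "{g * n..<g * n + n} \<subseteq> {0..<card T}" if "g < K" for g
  proof -
    have "(g + 1) * n \<le> K * n" using that by (intro mult_right_mono) auto
    then show ?thesis using assms(2) by (auto simp: algebra_simps)
  qed
  have inj: "inj_on f {0..<card T}" using f by (auto simp: bij_betw_def)
  show ?thesis
  proof (rule that[of S])
    fix g assume g: "g < K"
    show "finite (S g) \<and> S g \<subseteq> T \<and> card (S g) = n"
    proof (intro conjI)
      show "S g \<subseteq> T"
        using image_mono[OF sub[OF g], of f] f by (simp add: S_def bij_betw_def)
      show "card (S g) = n"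
        using card_image[OF inj_on_subset[OF inj sub[OF g]]] by (simp add: S_def)
    qed (simp add: S_def)
  next
    have "S g \<inter> S g' = {}" if g: "g < g'" "g' < K" for g g'
    proof -
      have "(g + 1) * n \<le> g' * n" using g by (intro mult_right_mono) auto
      then have "{g * n..<g * n + n} \<inter> {g' * n..<g' * n + n} = {}"
        by (auto simp: algebra_simps)
      then show ?thesis
        unfolding S_def using inj_on_image_Int[OF inj sub[of g] sub[of g']] g by simp
    qed
    then show "disjoint_family_on S {..<K}"
      unfolding disjoint_family_on_def by (metis Int_commute lessThan_iff linorder_neqE_nat)
  qed
qed

text \<open>With \<open>N \<ge> (D / \<beta>) ^ m\<close> points and order \<open>D ^ m\<close> cells, about
  \<open>D ^ m (N / D ^ m) ^ K \<ge> (D / \<beta> ^ K) ^ m\<close> cells are expected to receive \<open>K\<close> points. For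
  \<open>\<beta> ^ K = \<surd>D\<close> this tends to infinity.\<close>

lemma (in prob_space) AE_cluster:
  fixes \<xi> :: "nat \<Rightarrow> 'a \<Rightarrow> complex^'d"
  assumes indep: "indep_vars (\<lambda>_. borel) \<xi> UNIV" and distr: "\<And>n. distr M borel (\<xi> n) = sphere_uniform"
    and fin: "\<And>m. finite (T m)" and K: "0 < K"
    and many: "\<And>m0. \<exists>m>m0. (2 powr (CARD('d) * (1 - 1 / (2 * real K)))) ^ m < card (T m :: nat set)"
  shows "AE \<omega> in M. \<exists>m J. J \<subseteq> T m \<and> card J = K \<and> (\<forall>j\<in>J. norm (\<xi> j \<omega>) = 1) \<and>
    (\<forall>i\<in>J. \<forall>j\<in>J. quasi_dist (\<xi> i \<omega>) (\<xi> j \<omega>) \<le> 6 * (1/2) ^ m)"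
proof -
  let ?d = "real CARD('d)"
  define D :: real where "D = 2 powr ?d"
  define \<beta> :: real where "\<beta> = 2 powr (?d / (2 * real K))"
  define s :: real where "s = 2 powr (?d / 2)"
  have D2: "D = 2 ^ CARD('d)" by (simp add: D_def powr_realpow)
  have \<beta>1: "1 \<le> \<beta>" unfolding \<beta>_def by (intro ge_one_powr_ge_zero) auto
  have s1: "1 < s" unfolding s_def by (subst gr_one_powr) auto
  have D0: "0 < D" "1 \<le> D" by (auto simp: D2)
  have \<beta>K: "\<beta> ^ K = s"
    using K by (simp add: \<beta>_def s_def powr_realpow[symmetric] powr_powr)
  have Ds: "D / s = s"
    by (simp add: D_def s_def powr_diff[symmetric])
  have D\<beta>: "2 powr (?d * (1 - 1 / (2 * real K))) = D / \<beta>"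
    by (simp add: D_def \<beta>_def powr_diff[symmetric] right_diff_distrib)
  have D\<beta>1: "1 < D / \<beta>"
  proof -
    have "1 / (2 * real K) < 1" using K by simp
    then show ?thesis unfolding D\<beta>[symmetric] by (subst gr_one_powr) auto
  qed
  obtain c1 c2 where c: "0 < c1" "0 < c2" and pack:
    "\<And>h. 0 < h \<Longrightarrow> h \<le> 1 \<Longrightarrow> \<exists>Z :: (complex^'d) set. finite Z \<and> (\<forall>\<zeta>\<in>Z. norm \<zeta> = 1) \<and>
      disjoint_family_on (\<lambda>\<zeta>. sphere_cap \<zeta> h) Z \<and> c2 / h ^ CARD('d) \<le> card Z \<and>
      (\<forall>\<zeta>\<in>Z. c1 * h ^ CARD('d) \<le> measure sphere_uniform (sphere_cap \<zeta> h))"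
    using cap_packing by blast
  define y0 where "y0 = c1 / (2 * real K)"
  have y0: "0 < y0" using c K by (simp add: y0_def)
  define c3 where "c3 = c2 * (y0 / (1 + y0)) ^ K"
  have c3: "0 < c3" using c y0 by (simp add: c3_def)
  have step: "\<exists>E\<in>events. prob E < e \<and> (\<forall>\<omega>\<in>space M - E. \<exists>m J. J \<subseteq> T m \<and> card J = K
      \<and> (\<forall>j\<in>J. norm (\<xi> j \<omega>) = 1) \<and> (\<forall>i\<in>J. \<forall>j\<in>J. quasi_dist (\<xi> i \<omega>) (\<xi> j \<omega>) \<le> 6 * (1/2) ^ m))"
    if e: "0 < e" for e :: real
  proof -
    obtain m1 where m1: "1 / (c3 * e) < s ^ m1"
      using real_arch_pow[OF s1] by blast
    obtain m2 where m2: "2 * real K < (D / \<beta>) ^ m2"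
      using real_arch_pow[OF D\<beta>1] by blast
    obtain m where m: "max m1 m2 < m" "(D / \<beta>) ^ m < card (T m)"
      using many[of "max m1 m2", unfolded D\<beta>] by (elim exE conjE) (rule that)
    define n where "n = card (T m) div K"
    have n: "(D / \<beta>) ^ m / (2 * real K) \<le> n"
    proof -
      have "(D / \<beta>) ^ m2 \<le> (D / \<beta>) ^ m"
        using m(1) D\<beta>1 by (intro power_increasing) auto
      with m2 have "2 * real K < (D / \<beta>) ^ m" by linarith
      then have "2 * real K < card (T m)" using m(2) by linarith
      moreover have "card (T m) < K * n + K"
        unfolding n_def using K by (metis add.commute dividend_less_times_div)
      then have "real (card (T m)) < real K * real n + real K"
        by (metis of_nat_add of_nat_less_iff of_nat_mult)
      ultimately have "real (card (T m)) \<le> 2 * (real K * real n)" by linarith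
      with m(2) have "(D / \<beta>) ^ m \<le> real n * (2 * real K)" by (simp add: algebra_simps)
      then show ?thesis using K by (simp add: pos_divide_le_eq)
    qed
    define h :: real where "h = (1/2) ^ m"
    have h: "0 < h" "h \<le> 1" by (auto simp: h_def power_le_one)
    have hD: "h ^ CARD('d) = 1 / D ^ m"
      by (simp add: h_def D2 power_divide power_mult[symmetric] mult.commute)
    obtain Z :: "(complex^'d) set" where Z: "finite Z" "\<And>\<zeta>. \<zeta> \<in> Z \<Longrightarrow> norm \<zeta> = 1"
      "disjoint_family_on (\<lambda>\<zeta>. sphere_cap \<zeta> h) Z" "c2 / h ^ CARD('d) \<le> card Z"
      "\<And>\<zeta>. \<zeta> \<in> Z \<Longrightarrow> c1 * h ^ CARD('d) \<le> measure sphere_uniform (sphere_cap \<zeta> h)"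
      using pack[OF h] by blast
    have "K * n \<le> card (T m)" unfolding n_def by simp
    then obtain S where S: "\<And>g. g < K \<Longrightarrow> finite (S g) \<and> S g \<subseteq> T m \<and> card (S g) = n"
      "disjoint_family_on S {..<K}"
      using exists_disjoint_groups[OF fin] by metis
    define p where "p = c1 * h ^ CARD('d)"
    have p: "0 < p" using c h by (simp add: p_def)
    define E where "E = {\<omega> \<in> space M. \<forall>\<zeta>\<in>Z. \<exists>g<K. \<forall>j\<in>S g. \<xi> j \<omega> \<notin> sphere_cap \<zeta> h}"
    note cells = prob_no_common_cell[OF indep K _ S(2) distr Z(1) _ Z(3), where n = n and p = p, folded E_def]
    have E: "E \<in> events" and pE: "prob E * (card Z * (n * p / (1 + n * p)) ^ K) \<le> 1"
      using cells S(1) Z(5) p by (auto simp: p_def)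
    have "c3 * s ^ m \<le> card Z * (n * p / (1 + n * p)) ^ K"
    proof -
      define y where "y = y0 / \<beta> ^ m"
      have y: "0 < y" "y \<le> y0"
        using y0 \<beta>1 divide_left_mono[of 1 "\<beta> ^ m" y0] by (auto simp: y_def one_le_power)
      have "y = (D / \<beta>) ^ m / (2 * real K) * p"
        using D0 by (simp add: y_def y0_def p_def hD power_divide)
      also have "\<dots> \<le> n * p"
        using n p by (intro mult_right_mono) auto
      finally have np: "y \<le> n * p" .
      have "y / (1 + y0) \<le> y / (1 + y)"
        using y by (intro divide_left_mono) auto
      also have "\<dots> \<le> n * p / (1 + n * p)"
        using np y by (simp add: divide_simps) (simp add: algebra_simps)
      finally have "(y / (1 + y0)) ^ K \<le> (n * p / (1 + n * p)) ^ K"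
        using y y0 by (intro power_mono) auto
      moreover have "c2 * D ^ m \<le> card Z"
        using Z(4) by (simp add: hD)
      ultimately have "c2 * D ^ m * (y / (1 + y0)) ^ K \<le> card Z * (n * p / (1 + n * p)) ^ K"
        using c D0 y y0 by (intro mult_mono) auto
      moreover have "c2 * D ^ m * (y / (1 + y0)) ^ K = c3 * s ^ m"
      proof -
        have "(\<beta> ^ m) ^ K = s ^ m"
          by (metis \<beta>K power_commutes power_mult mult.commute)
        then have "c2 * D ^ m * (y / (1 + y0)) ^ K = c3 * (D ^ m / s ^ m)"
          by (simp add: y_def c3_def power_divide power_mult_distrib mult.commute mult.left_commute)
        then show ?thesis by (simp add: power_divide[symmetric] Ds)
      qed
      ultimately show ?thesis by simp
    qed
    then have "prob E * (c3 * s ^ m) \<le> 1"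
      using pE mult_left_mono[of "c3 * s ^ m" _ "prob E"] by (meson measure_nonneg order_trans)
    then have "prob E \<le> 1 / (c3 * s ^ m)"
      using c3 s1 by (simp add: pos_le_divide_eq)
    also have "\<dots> < e"
    proof -
      have "s ^ m1 \<le> s ^ m"
        using m(1) s1 by (intro power_increasing) auto
      with m1 have "1 / (c3 * e) < s ^ m" by linarith
      then show ?thesis using c3 e s1 by (simp add: field_simps)
    qed
    finally have "prob E < e" .
    moreover have "\<exists>m J. J \<subseteq> T m \<and> card J = K \<and> (\<forall>j\<in>J. norm (\<xi> j \<omega>) = 1) \<and>
      (\<forall>i\<in>J. \<forall>j\<in>J. quasi_dist (\<xi> i \<omega>) (\<xi> j \<omega>) \<le> 6 * (1/2) ^ m)" if w: "\<omega> \<in> space M - E" for \<omega>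
    proof -
      obtain \<zeta> where \<zeta>: "\<zeta> \<in> Z" "\<forall>g<K. \<exists>j\<in>S g. \<xi> j \<omega> \<in> sphere_cap \<zeta> h"
        using w by (auto simp: E_def)
      then obtain f where f: "\<And>g. g < K \<Longrightarrow> f g \<in> S g \<and> \<xi> (f g) \<omega> \<in> sphere_cap \<zeta> h"
        by metis
      have inj: "inj_on f {..<K}"
      proof (rule inj_onI)
        fix g g' assume g: "g \<in> {..<K}" "g' \<in> {..<K}" "f g = f g'"
        then have "f g \<in> S g \<inter> S g'" using f[of g] f[of g'] by auto
        then show "g = g'" using S(2) g by (auto simp: disjoint_family_on_def)
      qed
      have "quasi_dist (\<xi> i \<omega>) (\<xi> j \<omega>) \<le> 6 * (1/2) ^ m" if "i \<in> f ` {..<K}" "j \<in> f ` {..<K}" for i j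
      proof -
        have ij: "\<xi> i \<omega> \<in> sphere_cap \<zeta> h" "\<xi> j \<omega> \<in> sphere_cap \<zeta> h" using that f by auto
        then have "quasi_dist (\<xi> i \<omega>) (\<xi> j \<omega>) \<le> 3 * (quasi_dist (\<xi> i \<omega>) \<zeta> + quasi_dist \<zeta> (\<xi> j \<omega>))"
          using Z(2)[OF \<zeta>(1)] by (intro quasi_dist_triangle) (auto simp: sphere_cap_def)
        also have "\<dots> \<le> 6 * h"
          using ij quasi_dist_commute[of \<zeta> "\<xi> j \<omega>"] by (simp add: sphere_cap_def)
        finally show ?thesis by (simp add: h_def)
      qed
      moreover have "f ` {..<K} \<subseteq> T m" "\<forall>j\<in>f ` {..<K}. norm (\<xi> j \<omega>) = 1"
        using f S(1) by (fastforce simp: sphere_cap_def)+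
      moreover have "card (f ` {..<K}) = K"
        using card_image[OF inj] by simp
      ultimately show ?thesis by blast
    qed
    ultimately show ?thesis using E by blast
  qed
  have "\<forall>i. \<exists>E\<in>events. prob E < inverse (Suc i) \<and> (\<forall>\<omega>\<in>space M - E. \<exists>m J. J \<subseteq> T m \<and> card J = K
      \<and> (\<forall>j\<in>J. norm (\<xi> j \<omega>) = 1) \<and> (\<forall>i\<in>J. \<forall>j\<in>J. quasi_dist (\<xi> i \<omega>) (\<xi> j \<omega>) \<le> 6 * (1/2) ^ m))"
    by (intro allI step) simp
  then obtain E where E: "\<And>i. E i \<in> events" "\<And>i. prob (E i) < inverse (Suc i)"
    "\<And>i \<omega>. \<omega> \<in> space M - E i \<Longrightarrow> \<exists>m J. J \<subseteq> T m \<and> card J = K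
      \<and> (\<forall>j\<in>J. norm (\<xi> j \<omega>) = 1) \<and> (\<forall>i\<in>J. \<forall>j\<in>J. quasi_dist (\<xi> i \<omega>) (\<xi> j \<omega>) \<le> 6 * (1/2) ^ m)"
    by metis
  have null: "(\<Inter>i. E i) \<in> null_sets M"
  proof -
    have ev: "(\<Inter>i. E i) \<in> events" using E(1) by auto
    have small: "prob (\<Inter>i. E i) \<le> e" if e: "0 < e" for e :: real
    proof -
      obtain i where "inverse (Suc i) < e" using reals_Archimedean[OF e] by blast
      moreover have "prob (\<Inter>i. E i) \<le> prob (E i)" using E(1) by (intro finite_measure_mono) auto
      ultimately show ?thesis using E(2)[of i] by linarith
    qed
    have "prob (\<Inter>i. E i) \<le> 0"
    proof (rule field_le_epsilon)
      fix e :: real assume "0 < e"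
      from small[OF this] show "prob (\<Inter>i. E i) \<le> 0 + e" by simp
    qed
    then show ?thesis
      using ev by (simp add: null_sets_def emeasure_eq_measure measure_le_0_iff)
  qed
  show ?thesis
    by (rule AE_I'[OF null]) (use E(3) in blast)
qed

text \<open>The radii within a level differ from \<open>1\<close> by at most \<open>2 ^ -m\<close>, so the points of a cluster have
  quasi-distance at most \<open>(2 + 6) * 2 ^ -m\<close> in the ball. The bound on the size of a cluster therefore
  does not depend on \<open>m\<close>, while almost surely there are clusters of every size.\<close>

theorem (in prob_space) AE_not_carleson_sequence:
  fixes \<xi> :: "nat \<Rightarrow> 'a \<Rightarrow> complex^'d" and r :: "nat \<Rightarrow> real"
  assumes H: "hardy_space H ip" and r: "\<And>n. 0 < r n \<and> r n < 1"
    and indep: "indep_vars (\<lambda>_. borel) \<xi> UNIV" and distr: "\<And>n. distr M borel (\<xi> n) = sphere_uniform"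
    and fin: "\<And>m. finite (dyadic_indices r m)"
    and many: "\<And>K m0. 0 < K \<Longrightarrow>
      \<exists>m>m0. (2 powr (CARD('d) * (1 - 1 / (2 * real K)))) ^ m < card (dyadic_indices r m)"
  shows "AE \<omega> in M. \<not> carleson_sequence (ball 0 1) szego_kernel H ip (\<lambda>n. r n *\<^sub>R \<xi> n \<omega>)"
proof -
  interpret H: hardy_space H ip by (rule H)
  let ?z = "\<lambda>\<omega> n. r n *\<^sub>R \<xi> n \<omega>"
  have "AE \<omega> in M. \<exists>m J. J \<subseteq> dyadic_indices r m \<and> card J = Suc K \<and> (\<forall>j\<in>J. norm (\<xi> j \<omega>) = 1) \<and>
    (\<forall>i\<in>J. \<forall>j\<in>J. quasi_dist (\<xi> i \<omega>) (\<xi> j \<omega>) \<le> 6 * (1/2) ^ m)" for K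
    by (rule AE_cluster[OF indep distr fin _ many]) auto
  then have "AE \<omega> in M. \<forall>K. \<exists>m J. J \<subseteq> dyadic_indices r m \<and> card J = Suc K \<and> (\<forall>j\<in>J. norm (\<xi> j \<omega>) = 1) \<and>
    (\<forall>i\<in>J. \<forall>j\<in>J. quasi_dist (\<xi> i \<omega>) (\<xi> j \<omega>) \<le> 6 * (1/2) ^ m)"
    by (simp add: AE_all_countable)
  then show ?thesis
  proof eventually_elim
    case (elim \<omega>)
    show ?case
    proof
      assume "carleson_sequence (ball 0 1) szego_kernel H ip (?z \<omega>)"
      then obtain C :: nat where ball: "\<And>n. ?z \<omega> n \<in> ball 0 1" and C: "\<And>f F. f \<in> H \<Longrightarrow> finite F \<Longrightarrow>
        (\<Sum>n\<in>F. (1 - (norm (?z \<omega> n))\<^sup>2) ^ CARD('d) * (cmod (f (?z \<omega> n)))\<^sup>2) \<le> (C * ip_norm ip f)\<^sup>2"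
        unfolding H.carleson_sequence_iff_finite_sums by blast
      obtain K :: nat where K: "(real C)\<^sup>2 * 16 ^ (2 * CARD('d)) \<le> real K"
        using real_arch_simple by blast
      obtain m J where J: "J \<subseteq> dyadic_indices r m" "card J = Suc K" "\<And>j. j \<in> J \<Longrightarrow> norm (\<xi> j \<omega>) = 1"
        "\<And>i j. i \<in> J \<Longrightarrow> j \<in> J \<Longrightarrow> quasi_dist (\<xi> i \<omega>) (\<xi> j \<omega>) \<le> 6 * (1/2) ^ m"
        using elim[rule_format, of K] by blast
      have finJ: "finite J" using J(2) card_ge_0_finite[of J] by simp
      obtain i where i: "i \<in> J" using J(2) by fastforce
      have sh: "(1/2) ^ (m + 1) \<le> 1 - r j" "1 - r j < (1/2) ^ m" if "j \<in> J" for j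
        using J(1) that by (auto simp: dyadic_indices_def)
      have "real (card J) \<le> (real C)\<^sup>2 * (8 * (1/2) ^ m / (1/2) ^ (m + 1)) ^ (2 * CARD('d))"
      proof (rule H.carleson_cluster_bound[OF C ball finJ i])
        fix j assume j: "j \<in> J"
        have "quasi_dist (?z \<omega> j) (?z \<omega> i) \<le> (1 - r j) + (1 - r i) + quasi_dist (\<xi> j \<omega>) (\<xi> i \<omega>)"
          using J(3)[OF j] J(3)[OF i] r[of i] r[of j] by (intro quasi_dist_radial(2)) auto
        then show "quasi_dist (?z \<omega> j) (?z \<omega> i) \<le> 8 * (1/2) ^ m"
          using sh[OF j] sh[OF i] J(4)[OF j i] by linarith
        show "(1/2) ^ (m + 1) \<le> 1 - norm (?z \<omega> j)"
          using sh(1)[OF j] J(3)[OF j] r[of j] by simp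
      qed simp_all
      also have "8 * (1/2) ^ m / (1/2) ^ (m + 1) = (16 :: real)"
        by simp
      finally show False
        using K J(2) by simp
    qed
  qed
qed

text \<open>Infinitely many points of one level are a cluster of unbounded size, at mutual quasi-distance
  at most \<open>2\<close>.\<close>

theorem (in prob_space) AE_not_carleson_sequence_infinite:
  fixes \<xi> :: "nat \<Rightarrow> 'a \<Rightarrow> complex^'d" and r :: "nat \<Rightarrow> real"
  assumes H: "hardy_space H ip" and r: "\<And>n. 0 < r n \<and> r n < 1"
    and norm1: "AE \<omega> in M. \<forall>n. norm (\<xi> n \<omega>) = 1"
    and inf: "infinite (dyadic_indices r m)"
  shows "AE \<omega> in M. \<not> carleson_sequence (ball 0 1) szego_kernel H ip (\<lambda>n. r n *\<^sub>R \<xi> n \<omega>)"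
  using norm1
proof eventually_elim
  case (elim \<omega>)
  interpret H: hardy_space H ip by (rule H)
  let ?z = "\<lambda>n. r n *\<^sub>R \<xi> n \<omega>"
  show ?case
  proof
    assume "carleson_sequence (ball 0 1) szego_kernel H ip ?z"
    then obtain C :: nat where ball: "\<And>n. ?z n \<in> ball 0 1" and C: "\<And>f F. f \<in> H \<Longrightarrow> finite F \<Longrightarrow>
      (\<Sum>n\<in>F. (1 - (norm (?z n))\<^sup>2) ^ CARD('d) * (cmod (f (?z n)))\<^sup>2) \<le> (C * ip_norm ip f)\<^sup>2"
      unfolding H.carleson_sequence_iff_finite_sums by blast
    let ?a = "(1/2) ^ (m + 1) :: real"
    obtain K :: nat where K: "(real C)\<^sup>2 * (2 / ?a) ^ (2 * CARD('d)) \<le> real K"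
      using real_arch_simple by blast
    obtain J where J: "J \<subseteq> dyadic_indices r m" "finite J" "card J = Suc K"
      using infinite_arbitrarily_large[OF inf] by blast
    obtain i where i: "i \<in> J" using J(3) by fastforce
    have "real (card J) \<le> (real C)\<^sup>2 * (2 / ?a) ^ (2 * CARD('d))"
    proof (rule H.carleson_cluster_bound[OF C ball J(2) i])
      fix j assume j: "j \<in> J"
      show "quasi_dist (?z j) (?z i) \<le> 2"
        using ball[of i] ball[of j] by (intro quasi_dist_le_2) auto
      show "?a \<le> 1 - norm (?z j)"
        using J(1) j elim r[of j] by (auto simp: dyadic_indices_def)
    qed simp_all
    then show False using K J(3) by simp
  qed
qed

section \<open>The zero-one law\<close>

lemma ereal_of_enat_counting_le:
  fixes x :: real
  shows "ereal_of_enat (counting_function r m) \<le> ereal x \<longleftrightarrow>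
    finite (dyadic_indices r m) \<and> card (dyadic_indices r m) \<le> x"
proof (cases "finite (dyadic_indices r m)")
  case True
  then have "ereal_of_enat (counting_function r m) = ereal (card (dyadic_indices r m))"
    by (simp add: counting_function_def)
  then show ?thesis using True by (simp only: ereal_less_eq) simp
next
  case False
  then have "ereal_of_enat (counting_function r m) = \<infinity>"
    by (simp add: counting_function_def)
  then show ?thesis using False by (simp only: ereal_infty_less_eq) simp
qed

theorem theorem1p3:
  fixes H :: "(complex^'d \<Rightarrow> complex) set"
    and ip :: "(complex^'d \<Rightarrow> complex) \<Rightarrow> (complex^'d \<Rightarrow> complex) \<Rightarrow> complex"
    and M :: "'w measure"
    and r :: "nat \<Rightarrow> real"
    and \<xi> :: "nat \<Rightarrow> 'w \<Rightarrow> complex^'d"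
  assumes "hardy_space H ip"
    and "prob_space M"
    and "\<And>n. 0 < r n \<and> r n < 1"
    and "prob_space.indep_vars M (\<lambda>_. borel) \<xi> UNIV"
    and "\<And>n. distr M borel (\<xi> n) = sphere_uniform"
  shows "let
      carleson = {\<omega> \<in> space M. carleson_sequence (ball 0 1) szego_kernel H ip (\<lambda>n. r n *\<^sub>R \<xi> n \<omega>)};
      growth = (\<exists>\<epsilon>>0. \<exists>C>0. \<forall>m. ereal_of_enat (counting_function r m)
        \<le> ereal (C * 2 powr (real CARD('d) * (1 - \<epsilon>) * real m)))
    in carleson \<in> sets M
      \<and> (growth \<longrightarrow> measure M carleson = 1)
      \<and> (\<not> growth \<longrightarrow> measure M carleson = 0)"
proof -
  interpret M: prob_space M by (rule assms(2))
  interpret H: hardy_space H ip by (rule assms(1))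
  let ?d = "real CARD('d)" and ?S = "dyadic_indices r"
  define car where "car = {\<omega> \<in> space M. carleson_sequence (ball 0 1) szego_kernel H ip (\<lambda>n. r n *\<^sub>R \<xi> n \<omega>)}"
  define growth where "growth \<longleftrightarrow> (\<exists>\<epsilon>>0. \<exists>C>0. \<forall>m. ereal_of_enat (counting_function r m)
        \<le> ereal (C * 2 powr (?d * (1 - \<epsilon>) * real m)))"
  have rv: "\<xi> n \<in> borel_measurable M" for n
    using assms(4) by (auto simp: M.indep_vars_def)
  have meas: "car \<in> sets M"
    unfolding car_def by (rule H.carleson_event_measurable[OF rv])
  have pow: "2 powr (a * real m) = (2 powr a) ^ m" for a :: real and m
    by (simp add: powr_powr[symmetric] powr_realpow)
  have D: "(2::real) ^ CARD('d) = 2 powr ?d"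
    by (simp add: powr_realpow)
  have pos: "measure M car = 1" if growth
  proof -
    obtain \<epsilon> C where e: "0 < \<epsilon>" and C: "0 < C" and le: "\<And>m. finite (?S m) \<and>
        card (?S m) \<le> C * 2 powr (?d * (1 - \<epsilon>) * real m)"
      using \<open>growth\<close> unfolding growth_def ereal_of_enat_counting_le by blast
    \<comment> \<open>a larger \<open>\<epsilon>\<close> only strengthens the growth condition, so it may be cut down to \<open>\<epsilon> \<le> 1\<close>\<close>
    define e' where "e' = min \<epsilon> 1"
    define b :: real where "b = 2 powr (?d * e' / 4)"
    have e': "0 < e'" "e' \<le> 1" "e' \<le> \<epsilon>" using e by (auto simp: e'_def)
    have "AE \<omega> in M. carleson_sequence (ball 0 1) szego_kernel H ip (\<lambda>n. r n *\<^sub>R \<xi> n \<omega>)"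
    proof (rule M.AE_carleson_sequence[OF assms(1,3,4,5), where b = b and C = C])
      show "1 < b" unfolding b_def using e' by (subst gr_one_powr) auto
      show "b < 2 ^ CARD('d)" unfolding b_def D
      proof (rule powr_less_mono)
        have "?d * e' \<le> ?d * 1" using e' by (intro mult_left_mono) auto
        then show "?d * e' / 4 < ?d" using zero_less_card_finite[where 'a='d] by linarith
      qed simp
      show "finite (?S m)" for m using le by blast
      show "card (?S m) \<le> C * (2 ^ CARD('d)) ^ m / b ^ (4 * m)" for m
      proof -
        have "?d * (1 - \<epsilon>) * real m \<le> ?d * (1 - e') * real m"
          using e' by (intro mult_right_mono mult_left_mono) auto
        then have "2 powr (?d * (1 - \<epsilon>) * real m) \<le> 2 powr (?d * (1 - e') * real m)"
          by (rule powr_mono) simp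
        also have "\<dots> = (2 ^ CARD('d)) ^ m / b ^ (4 * m)"
        proof -
          have "b ^ (4 * m) = 2 powr (?d * e' * real m)"
            unfolding b_def by (simp add: powr_realpow[symmetric] powr_powr algebra_simps)
          moreover have "(2 ^ CARD('d)) ^ m = 2 powr (?d * real m)"
            unfolding D by (simp add: pow)
          ultimately show ?thesis
            by (simp add: powr_diff[symmetric] algebra_simps)
        qed
        finally have "C * 2 powr (?d * (1 - \<epsilon>) * real m) \<le> C * ((2 ^ CARD('d)) ^ m / b ^ (4 * m))"
          using C by (intro mult_left_mono) auto
        then show ?thesis using le[of m] by simp
      qed
    qed (rule C)
    then have "AE \<omega> in M. \<omega> \<in> car"
      unfolding car_def by (auto simp: AE_conj_iff)
    then show ?thesis using meas by (simp add: M.prob_eq_1)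
  qed
  have neg: "measure M car = 0" if ng: "\<not> growth"
  proof -
    have "AE \<omega> in M. \<not> carleson_sequence (ball 0 1) szego_kernel H ip (\<lambda>n. r n *\<^sub>R \<xi> n \<omega>)"
    proof (cases "\<forall>m. finite (?S m)")
      case False
      then obtain m where m: "infinite (?S m)" by blast
      have "AE \<omega> in M. norm (\<xi> n \<omega>) = 1" for n
        by (rule M.AE_norm_eq_1[OF rv assms(5)])
      then have "AE \<omega> in M. \<forall>n. norm (\<xi> n \<omega>) = 1" by (simp add: AE_all_countable)
      then show ?thesis
        by (rule M.AE_not_carleson_sequence_infinite[OF assms(1,3) _ m])
    next
      case True
      show ?thesis
      proof (rule M.AE_not_carleson_sequence[OF assms(1,3,4,5)])
        show "finite (?S m)" for m using True by blast
        fix K m0 :: nat assume K: "0 < K"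
        let ?e = "1 / (2 * real K)"
        have e: "0 < ?e" "?e \<le> 1" using K by auto
        \<comment> \<open>this constant absorbs the levels up to \<open>m0\<close>, so that a violation occurs beyond them\<close>
        define C where "C = 1 + (\<Sum>m\<le>m0. real (card (?S m)))"
        have C: "1 \<le> C" unfolding C_def by (simp add: sum_nonneg)
        have C0: "0 < C" using C by linarith
        have "\<not> (\<forall>m. finite (?S m) \<and> card (?S m) \<le> C * 2 powr (?d * (1 - ?e) * real m))"
          using ng e(1) C0 unfolding growth_def ereal_of_enat_counting_le by blast
        then obtain m where "\<not> card (?S m) \<le> C * 2 powr (?d * (1 - ?e) * real m)"
          using True by blast
        then have m: "C * (2 powr (?d * (1 - ?e))) ^ m < card (?S m)"
          unfolding pow by (rule not_le_imp_less)
        have one: "1 \<le> (2 powr (?d * (1 - ?e))) ^ m"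
          using e by (intro one_le_power ge_one_powr_ge_zero) auto
        have "m0 < m"
        proof (rule ccontr)
          assume "\<not> m0 < m"
          then have "real (card (?S m)) \<le> (\<Sum>m\<le>m0. real (card (?S m)))"
            by (intro member_le_sum) auto
          also have "\<dots> \<le> C * 1" by (simp add: C_def)
          also have "\<dots> \<le> C * (2 powr (?d * (1 - ?e))) ^ m"
            using one C by (intro mult_left_mono) auto
          finally show False using m by simp
        qed
        moreover have "(2 powr (?d * (1 - ?e))) ^ m < card (?S m)"
        proof (rule le_less_trans[OF _ m])
          have "1 * (2 powr (?d * (1 - ?e))) ^ m \<le> C * (2 powr (?d * (1 - ?e))) ^ m"
            using one C by (intro mult_right_mono) auto
          then show "(2 powr (?d * (1 - ?e))) ^ m \<le> C * (2 powr (?d * (1 - ?e))) ^ m"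
            by (simp only: mult_1_left)
        qed
        ultimately show "\<exists>m>m0. (2 powr (?d * (1 - ?e))) ^ m < card (?S m)"
          by blast
      qed
    qed
    then have "AE \<omega> in M. \<omega> \<notin> car"
      by eventually_elim (simp add: car_def)
    then show ?thesis
      using meas by (simp add: M.prob_eq_0)
  qed
  show ?thesis
    unfolding Let_def car_def[symmetric] growth_def[symmetric] using meas pos neg by blast
qed

end
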